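(* For $\alpha,\beta,m,\gamma_1,\dots,\gamma_m\ge1$ let $$R^{\mathrm B}_{\alpha,\beta;\gamma_1,\dots,\gamma_m}:=\frac1{m!}\left.\frac{\partial^{m+2}F_{B_N}}{\partial t_\alpha\,\partial t_\beta\,\partial t_{N+1-\gamma_1}\cdots\partial t_{N+1-\gamma_m}}\right|_{t=0},\qquad N=\alpha+\beta+1,\ \ 1\le\gamma_i\le N .$$ The system of PDEs on $f=f(t_1,t_2,\dots)$ $$\partial_\alpha\partial_\beta f=\sum_{m\ge1}\ \sum_{\gamma_1+\dots+\gamma_m=\alpha+\beta-1}R^{\mathrm B}_{\alpha,\beta;\gamma_1,\dots,\gamma_m}\,\partial_1\partial_{\gamma_1}f\cdots\partial_1\partial_{\gamma_m}f,\qquad\alpha,\beta\ge1,\qquad(\ast)$$ coincides with the dispersionless BKP hierarchy after the change of variables $t_k\mapsto t_{2k-1}/(2k-1)$ and the substitution $f\mapsto2F_0$. That is, writing $F_0=F_0(T_1,T_3,T_5,\dots)$ for a function of the odd-indexed BKP times, the function $f(t_1,t_2,\dots):=2F_0\big|_{T_{2k-1}=t_k/(2k-1),\ k\ge1}$ satisfies $(\ast)$ if and only if $F_0$ satisfies the dispersionless BKP hierarchy.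
   Context: The $A_N$ Frobenius potential $F_{A_N}$ ($N\ge1$). Let $\Lambda=\frac{x^{N+1}}{N+1}+y^2+\sum_{k=1}^Nv_kx^{k-1}$ with parameters $v=(v_1,\dots,v_N)\in\mathbb{C}^N$, and let $c_{ab}^k(v)$ be the structure constants of the ring $\mathbb{C}[x,y]/(\partial\Lambda/\partial x,\partial\Lambda/\partial y)$ in the basis of classes of $x^{k-1}$, $1\le k\le N$. Define the product $\frac{\partial}{\partial v_a}\circ\frac{\partial}{\partial v_b}=\sum_kc_{ab}^k(v)\frac{\partial}{\partial v_k}$ on vector fields and the pairing $\eta(\frac{\partial}{\partial v_a},\frac{\partial}{\partial v_b})=c_{ab}^N(v)$. The flat coordinates $t_1,\dots,t_N$ are related to $v$ by the invertible polynomial change $$v_\gamma=\sum_{\substack{a_1,\dots,a_N\ge0\\ \sum_k(N+2-k)a_k=N+2-\gamma}}\frac{(|a|+\gamma-2)!}{(\gamma-1)!}\prod_{k=1}^N\frac{t_k^{a_k}}{a_k!},\qquad|a|=\sum_ka_k,$$ and in them $\eta(\frac{\partial}{\partial t_\alpha},\frac{\partial}{\partial t_\beta})=\delta_{\alpha+\beta,N+1}$. $F_{A_N}\in\mathbb{Q}[t_1,\dots,t_N]$ is the unique polynomial without terms of degree $\le2$ such that $\frac{\partial^3F_{A_N}}{\partial t_\alpha\partial t_\beta\partial t_\gamma}=\eta(\frac{\partial}{\partial t_\alpha}\circ\frac{\partial}{\partial t_\beta},\frac{\partial}{\partial t_\gamma})$. The $B_N$ Frobenius potential is $F_{B_N}(t_1,\dots,t_N):=F_{A_{2N-1}}(t_1,0,t_2,0,t_3,\dots,0,t_N)$,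 i.e. the $(2k-1)$-st argument is $t_k$ and the even-indexed arguments are $0$. Notation: $\partial_k=\partial/\partial t_k$ in $(\ast)$. Dispersionless BKP hierarchy on $F_0=F_0(T_1,T_3,T_5,\dots)$: with $D^{\mathrm B}(z)=\sum_{n\ge0}\frac{z^{-2n-1}}{2n+1}\frac{\partial}{\partial T_{2n+1}}$ and $\partial_{T_1}=\partial/\partial T_1$, $$\left(1-\frac{\partial_{T_1}(2D^{\mathrm B}(z_1)+2D^{\mathrm B}(z_2))F_0}{z_1+z_2}\right)e^{2D^{\mathrm B}(z_1)\cdot2D^{\mathrm B}(z_2)F_0}=1-\frac{\partial_{T_1}(2D^{\mathrm B}(z_1)-2D^{\mathrm B}(z_2))F_0}{z_1-z_2},$$ an identity of formal power series in $z_1^{-1},z_2^{-1}$. Functions may be taken to be formal power series in the time variables. *)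

theory Defs
  imports
    Complex_Main
    "HOL-Library.Poly_Mapping"
    "HOL-Computational_Algebra.Polynomial"
    "HOL-Computational_Algebra.Formal_Power_Series"
begin

section \<open>Formal power series in countably many variables\<close>

text \<open>
  A series in the variables with indices $0, 1, 2, \dots$ is its coefficient function on monomials;
  the monomial with exponent vector \<open>m :: nat \<Rightarrow>\<^sub>0 nat\<close> is the product of the
  \<open>k\<close>-th variables to the power \<open>Poly_Mapping.lookup m k\<close>.  Polynomials are the series
  with finite support.
\<close>

typedef 'a pseries = "UNIV :: ((nat \<Rightarrow>\<^sub>0 nat) \<Rightarrow> 'a) set"
  morphisms mcoeff Abs_pseries
  by simp

setup_lifting type_definition_pseries

lemma pseries_eqI: "(\<And>m. mcoeff f m = mcoeff g m) \<Longrightarrow> f = g"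
  by transfer auto

lemma finite_exponents_below: "finite {a :: nat \<Rightarrow>\<^sub>0 nat. \<forall>k. Poly_Mapping.lookup a k \<le> Poly_Mapping.lookup m k}"
proof -
  let ?B = "insert 0 (\<Union>k\<in>Poly_Mapping.keys m. {..Poly_Mapping.lookup m k})"
  let ?F = "{f :: nat \<Rightarrow> nat. \<forall>k. (k \<in> Poly_Mapping.keys m \<longrightarrow> f k \<in> ?B) \<and> (k \<notin> Poly_Mapping.keys m \<longrightarrow> f k = 0)}"
  have fin: "finite ?F"
    by (rule finite_set_of_finite_funs) auto
  have sub: "Poly_Mapping.lookup ` {a. \<forall>k. Poly_Mapping.lookup a k \<le> Poly_Mapping.lookup m k} \<subseteq> ?F"
  proof (rule image_subsetI)
    fix a :: "nat \<Rightarrow>\<^sub>0 nat" assume a: "a \<in> {a. \<forall>k. Poly_Mapping.lookup a k \<le> Poly_Mapping.lookup m k}"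
    have "Poly_Mapping.lookup a k = 0" if "k \<notin> Poly_Mapping.keys m" for k
      using a that by (metis (mono_tags, lifting) in_keys_iff le_zero_eq mem_Collect_eq)
    thus "Poly_Mapping.lookup a \<in> ?F" using a by auto
  qed
  have "inj_on Poly_Mapping.lookup {a :: nat \<Rightarrow>\<^sub>0 nat. \<forall>k. Poly_Mapping.lookup a k \<le> Poly_Mapping.lookup m k}"
    by (auto intro: inj_onI poly_mapping_eqI)
  thus ?thesis using finite_subset[OF sub fin] by (rule finite_imageD[rotated])
qed

lemma finite_exponent_splits: "finite {(a, b). a + b = (m :: nat \<Rightarrow>\<^sub>0 nat)}"
proof (rule finite_subset)
  show "{(a, b). a + b = m} \<subseteq>
      {a. \<forall>k. Poly_Mapping.lookup a k \<le> Poly_Mapping.lookup m k} \<times> {a. \<forall>k. Poly_Mapping.lookup a k \<le> Poly_Mapping.lookup m k}"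
    by (auto simp: lookup_add)
  show "finite ({a. \<forall>k. Poly_Mapping.lookup a k \<le> Poly_Mapping.lookup m k} \<times> {a. \<forall>k. Poly_Mapping.lookup a k \<le> Poly_Mapping.lookup m k})"
    by (intro finite_cartesian_product finite_exponents_below)
qed

instantiation pseries :: (comm_ring_1) comm_ring_1
begin

lift_definition zero_pseries :: "'a pseries" is "\<lambda>_. 0" .
lift_definition one_pseries :: "'a pseries" is "\<lambda>m. if m = 0 then 1 else 0" .
lift_definition plus_pseries :: "'a pseries \<Rightarrow> 'a pseries \<Rightarrow> 'a pseries" is "\<lambda>f g m. f m + g m" .
lift_definition minus_pseries :: "'a pseries \<Rightarrow> 'a pseries \<Rightarrow> 'a pseries" is "\<lambda>f g m. f m - g m" .
lift_definition uminus_pseries :: "'a pseries \<Rightarrow> 'a pseries" is "\<lambda>f m. - f m" .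
lift_definition times_pseries :: "'a pseries \<Rightarrow> 'a pseries \<Rightarrow> 'a pseries"
  is "\<lambda>f g m. \<Sum>(a, b) | a + b = m. f a * g b" .

instance
proof
  fix f g h :: "'a pseries"
  show "f * g * h = f * (g * h)"
  proof (transfer, rule ext)
    fix f g h :: "(nat \<Rightarrow>\<^sub>0 nat) \<Rightarrow> 'a" and m
    have "(\<Sum>(a, b) | a + b = m. (\<Sum>(c, d) | c + d = a. f c * g d) * h b) =
          (\<Sum>p\<in>{(a, b). a + b = m}. \<Sum>q\<in>{(c, d). c + d = fst p}. f (fst q) * g (snd q) * h (snd p))"
      by (simp add: sum_distrib_right case_prod_beta)
    also have "\<dots> = (\<Sum>(p, q)\<in>(SIGMA p:{(a, b). a + b = m}. {(c, d). c + d = fst p}).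
          f (fst q) * g (snd q) * h (snd p))"
      by (rule sum.Sigma) (use finite_exponent_splits in auto)
    also have "\<dots> = (\<Sum>(p, q)\<in>(SIGMA p:{(a, b). a + b = m}. {(c, d). c + d = snd p}).
          f (fst p) * (g (fst q) * h (snd q)))"
      by (rule sum.reindex_bij_witness
            [where i = "\<lambda>(p, q). ((fst p + fst q, snd q), (fst p, fst q))"
               and j = "\<lambda>(p, q). ((fst q, snd q + snd p), (snd q, snd p))"])
         (auto simp: add.assoc mult.assoc)
    also have "\<dots> = (\<Sum>p\<in>{(a, b). a + b = m}. \<Sum>q\<in>{(c, d). c + d = snd p}.
          f (fst p) * (g (fst q) * h (snd q)))"
      by (rule sum.Sigma[symmetric]) (use finite_exponent_splits in auto)
    also have "\<dots> = (\<Sum>(a, b) | a + b = m. f a * (\<Sum>(c, d) | c + d = b. g c * h d))"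
      by (simp add: sum_distrib_left case_prod_beta)
    finally show "(\<Sum>(a, b) | a + b = m. (\<Sum>(c, d) | c + d = a. f c * g d) * h b) =
        (\<Sum>(a, b) | a + b = m. f a * (\<Sum>(c, d) | c + d = b. g c * h d))" .
  qed
  show "f * g = g * f"
    by (transfer, rule ext,
        rule sum.reindex_bij_witness[where i = "\<lambda>(a, b). (b, a)" and j = "\<lambda>(a, b). (b, a)"])
       (auto simp: add.commute mult.commute)
  show "1 * f = f"
  proof (transfer, rule ext)
    fix f :: "(nat \<Rightarrow>\<^sub>0 nat) \<Rightarrow> 'a" and m
    have "(\<Sum>(a, b) | a + b = m. (if a = 0 then 1 else 0) * f b) =
        (\<Sum>(a, b)\<in>{(0 :: nat \<Rightarrow>\<^sub>0 nat, m)}. (if a = 0 then 1 else 0) * f b)"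
      by (rule sum.mono_neutral_right[OF finite_exponent_splits]) (auto split: if_splits)
    thus "(\<Sum>(a, b) | a + b = m. (if a = 0 then 1 else 0) * f b) = f m" by simp
  qed
  show "(f + g) * h = f * h + g * h"
    by transfer (auto simp: fun_eq_iff case_prod_beta distrib_right sum.distrib)
  show "(0 :: 'a pseries) \<noteq> 1"
    by transfer (auto simp: fun_eq_iff)
qed (transfer; auto simp: fun_eq_iff)+

end

lift_definition sconst :: "'a::zero \<Rightarrow> 'a pseries" is "\<lambda>c m. if m = 0 then c else 0" .

lift_definition svar :: "nat \<Rightarrow> 'a::zero_neq_one pseries"
  is "\<lambda>k m. if m = Poly_Mapping.single k 1 then 1 else 0" .

lift_definition pd :: "nat \<Rightarrow> 'a::semiring_1 pseries \<Rightarrow> 'a pseries"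
  is "\<lambda>k f m. of_nat (Poly_Mapping.lookup m k + 1) * f (m + Poly_Mapping.single k 1)" .

definition series_in :: "nat set \<Rightarrow> 'a::zero pseries \<Rightarrow> bool" where
  "series_in V f \<longleftrightarrow> (\<forall>m. mcoeff f m \<noteq> 0 \<longrightarrow> Poly_Mapping.keys m \<subseteq> V)"

definition is_polynomial :: "'a::zero pseries \<Rightarrow> bool" where
  "is_polynomial f \<longleftrightarrow> finite {m. mcoeff f m \<noteq> 0}"

definition total_degree :: "(nat \<Rightarrow>\<^sub>0 nat) \<Rightarrow> nat" where
  "total_degree m = (\<Sum>k\<in>Poly_Mapping.keys m. Poly_Mapping.lookup m k)"

text \<open>Value of a polynomial at the point \<open>x\<close>; used only for series with finite support.\<close>

definition peval :: "'a::comm_semiring_1 pseries \<Rightarrow> (nat \<Rightarrow> 'a) \<Rightarrow> 'a" where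
  "peval f x = Sum_any (\<lambda>m. mcoeff f m * (\<Prod>k\<in>Poly_Mapping.keys m. x k ^ Poly_Mapping.lookup m k))"

text \<open>
  Substitution of the series \<open>s k\<close> for the \<open>k\<close>-th variable.  Each coefficient of the result is
  the sum of the corresponding coefficients over all monomials of \<open>f\<close>; the substitutions below
  are such that only finitely many monomials contribute to a given coefficient.
\<close>

definition psubst :: "(nat \<Rightarrow> 'a::comm_ring_1 pseries) \<Rightarrow> 'a pseries \<Rightarrow> 'a pseries" where
  "psubst s f = Abs_pseries (\<lambda>m.
     Sum_any (\<lambda>n. mcoeff f n * mcoeff (\<Prod>k\<in>Poly_Mapping.keys n. s k ^ Poly_Mapping.lookup n k) m))"


section \<open>The Frobenius potentials of type A and B\<close>

text \<open>
  The ring of polynomials in \<open>x\<close>, \<open>y\<close> is \<open>complex poly poly\<close>: the outer variable is \<open>y\<close> and the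
  coefficients are polynomials in \<open>x\<close>.
\<close>

definition X_poly :: "complex poly poly" where "X_poly = [:[:0, 1:]:]"
definition Y_poly :: "complex poly poly" where "Y_poly = [:0, 1:]"

abbreviation C_poly :: "complex \<Rightarrow> complex poly poly" where "C_poly c \<equiv> [:[:c:]:]"

definition Lambda :: "nat \<Rightarrow> (nat \<Rightarrow> complex) \<Rightarrow> complex poly poly" where
  "Lambda N v = C_poly (1 / of_nat (N + 1)) * X_poly ^ (N + 1) + Y_poly ^ 2
     + (\<Sum>k=1..N. C_poly (v k) * X_poly ^ (k - 1))"

definition diff_x :: "complex poly poly \<Rightarrow> complex poly poly" where "diff_x p = map_poly pderiv p"
definition diff_y :: "complex poly poly \<Rightarrow> complex poly poly" where "diff_y p = pderiv p"

text \<open>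
  \<open>structure_const N v a b k\<close> is the coefficient of the class of $x^{k-1}$ in the product of the
  classes of $x^{a-1}$ and $x^{b-1}$ in the quotient of the polynomial ring by the ideal
  generated by the two partial derivatives of \<open>Lambda N v\<close>.
\<close>

definition structure_const :: "nat \<Rightarrow> (nat \<Rightarrow> complex) \<Rightarrow> nat \<Rightarrow> nat \<Rightarrow> nat \<Rightarrow> complex" where
  "structure_const N v a b = (THE c. (\<forall>k. k \<notin> {1..N} \<longrightarrow> c k = 0) \<and>
     (\<exists>p q. X_poly ^ (a - 1) * X_poly ^ (b - 1) - (\<Sum>k=1..N. C_poly (c k) * X_poly ^ (k - 1))
            = p * diff_x (Lambda N v) + q * diff_y (Lambda N v)))"

text \<open>A tangent vector at \<open>v\<close> is given by its components in the basis $\partial/\partial v_k$.\<close>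

definition frob_mult ::
    "nat \<Rightarrow> (nat \<Rightarrow> complex) \<Rightarrow> (nat \<Rightarrow> complex) \<Rightarrow> (nat \<Rightarrow> complex) \<Rightarrow> nat \<Rightarrow> complex" where
  "frob_mult N v \<xi> \<zeta> k = (\<Sum>a=1..N. \<Sum>b=1..N. \<xi> a * \<zeta> b * structure_const N v a b k)"

definition frob_eta ::
    "nat \<Rightarrow> (nat \<Rightarrow> complex) \<Rightarrow> (nat \<Rightarrow> complex) \<Rightarrow> (nat \<Rightarrow> complex) \<Rightarrow> complex" where
  "frob_eta N v \<xi> \<zeta> = (\<Sum>a=1..N. \<Sum>b=1..N. \<xi> a * \<zeta> b * structure_const N v a b N)"

text \<open>
  \<open>v_series N \<gamma>\<close> is $v_\gamma$ as a polynomial in the flat coordinates.  The truncated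
  subtractions in \<open>v_exponents\<close> and \<open>v_series\<close> are exact for $1 \le \gamma \le N$, because the
  weight condition then forces the exponent vector to be non-zero.
\<close>

definition v_exponents :: "nat \<Rightarrow> nat \<Rightarrow> (nat \<Rightarrow>\<^sub>0 nat) set" where
  "v_exponents N \<gamma> = {a. Poly_Mapping.keys a \<subseteq> {1..N} \<and> (\<Sum>k=1..N. (N + 2 - k) * Poly_Mapping.lookup a k) = N + 2 - \<gamma>}"

definition v_series :: "nat \<Rightarrow> nat \<Rightarrow> complex pseries" where
  "v_series N \<gamma> = (\<Sum>a\<in>v_exponents N \<gamma>.
     sconst (fact (total_degree a + \<gamma> - 2) / fact (\<gamma> - 1))
     * (\<Prod>k=1..N. sconst (1 / fact (Poly_Mapping.lookup a k)) * svar k ^ Poly_Mapping.lookup a k))"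

definition v_point :: "nat \<Rightarrow> (nat \<Rightarrow> complex) \<Rightarrow> nat \<Rightarrow> complex" where
  "v_point N t \<gamma> = peval (v_series N \<gamma>) t"

text \<open>The vector $\partial/\partial t_\alpha$ at the point with flat coordinates \<open>t\<close>.\<close>

definition flat_vec :: "nat \<Rightarrow> (nat \<Rightarrow> complex) \<Rightarrow> nat \<Rightarrow> nat \<Rightarrow> complex" where
  "flat_vec N t \<alpha> a = peval (pd \<alpha> (v_series N a)) t"

definition is_A_potential :: "nat \<Rightarrow> complex pseries \<Rightarrow> bool" where
  "is_A_potential N F \<longleftrightarrow>
     is_polynomial F \<and> series_in {1..N} F \<and> (\<forall>m. mcoeff F m \<in> \<rat>) \<and>
     (\<forall>m. total_degree m \<le> 2 \<longrightarrow> mcoeff F m = 0) \<and>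
     (\<forall>\<alpha>\<in>{1..N}. \<forall>\<beta>\<in>{1..N}. \<forall>\<gamma>\<in>{1..N}. \<forall>t.
        peval (pd \<alpha> (pd \<beta> (pd \<gamma> F))) t =
        frob_eta N (v_point N t)
          (frob_mult N (v_point N t) (flat_vec N t \<alpha>) (flat_vec N t \<beta>)) (flat_vec N t \<gamma>))"

definition F_A :: "nat \<Rightarrow> complex pseries" where
  "F_A N = (THE F. is_A_potential N F)"

text \<open>Argument number \<open>2 k - 1\<close> becomes $t_k$, the even-numbered arguments become 0.\<close>

definition F_B :: "nat \<Rightarrow> complex pseries" where
  "F_B N = psubst (\<lambda>j. if odd j then svar ((j + 1) div 2) else 0) (F_A (2 * N - 1))"


section \<open>The system of PDEs\<close>

text \<open>The list \<open>gs\<close> is $(\gamma_1, \dots, \gamma_m)$.\<close>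

definition R_B :: "nat \<Rightarrow> nat \<Rightarrow> nat list \<Rightarrow> complex" where
  "R_B \<alpha> \<beta> gs = (let N = \<alpha> + \<beta> + 1 in
     1 / fact (length gs) *
     peval (pd \<alpha> (pd \<beta> (foldr (\<lambda>\<gamma>. pd (N + 1 - \<gamma>)) gs (F_B N)))) (\<lambda>_. 0))"

definition pde_indices :: "nat \<Rightarrow> nat \<Rightarrow> nat list set" where
  "pde_indices \<alpha> \<beta> = {gs. length gs \<ge> 1 \<and> (\<forall>\<gamma>\<in>set gs. \<gamma> \<ge> 1) \<and> sum_list gs = \<alpha> + \<beta> - 1}"

definition B_system :: "complex pseries \<Rightarrow> bool" where
  "B_system f \<longleftrightarrow> (\<forall>\<alpha>\<ge>1. \<forall>\<beta>\<ge>1.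
     pd \<alpha> (pd \<beta> f) =
     (\<Sum>gs\<in>pde_indices \<alpha> \<beta>. sconst (R_B \<alpha> \<beta> gs) * (\<Prod>\<gamma>\<leftarrow>gs. pd 1 (pd \<gamma> f))))"


section \<open>The dispersionless BKP hierarchy\<close>

text \<open>
  Series in $z_1^{-1}$, $z_2^{-1}$ with coefficients in the series in the times are elements of
  \<open>complex pseries fps fps\<close>, the outer variable being $z_1^{-1}$ and the inner one $z_2^{-1}$;
  \<open>bps c\<close> has the coefficient \<open>c i j\<close> at $z_1^{-i} z_2^{-j}$.
\<close>

definition bps :: "(nat \<Rightarrow> nat \<Rightarrow> 'a) \<Rightarrow> 'a fps fps" where
  "bps c = Abs_fps (\<lambda>i. Abs_fps (\<lambda>j. c i j))"

definition z1_inv :: "complex pseries fps fps" where "z1_inv = fps_X"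
definition z2_inv :: "complex pseries fps fps" where "z2_inv = fps_const fps_X"

text \<open>\<open>DB i\<close> is the coefficient of $z^{-i}$ in the operator $D^B(z)$.\<close>

definition DB :: "nat \<Rightarrow> complex pseries \<Rightarrow> complex pseries" where
  "DB i F = (if odd i then sconst (1 / of_nat i) * pd i F else 0)"

definition DB1 :: "complex pseries \<Rightarrow> complex pseries fps fps" where
  "DB1 F = bps (\<lambda>i j. if j = 0 then DB i F else 0)"

definition DB2 :: "complex pseries \<Rightarrow> complex pseries fps fps" where
  "DB2 F = bps (\<lambda>i j. if i = 0 then DB j F else 0)"

definition DB12 :: "complex pseries \<Rightarrow> complex pseries fps fps" where
  "DB12 F = bps (\<lambda>i j. DB i (DB j F))"

definition pd_coeffs :: "nat \<Rightarrow> complex pseries fps fps \<Rightarrow> complex pseries fps fps" where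
  "pd_coeffs k G = bps (\<lambda>i j. pd k (fps_nth (fps_nth G i) j))"

text \<open>Exact quotient; the quotients used below exist and are unique by \<open>dBKP_quotients_exist\<close>
  and \<open>exact_quot_eqI\<close>.\<close>

definition exact_quot :: "'a::comm_ring_1 \<Rightarrow> 'a \<Rightarrow> 'a" where
  "exact_quot n d = (THE q. q * d = n)"

lemma nth_mult_z1_inv:
  "fps_nth (fps_nth (G * z1_inv) i) j = (if i = 0 then 0 else fps_nth (fps_nth G (i - 1)) j)"
  by (simp add: z1_inv_def)

lemma nth_mult_z2_inv:
  "fps_nth (fps_nth (G * z2_inv) i) j = (if j = 0 then 0 else fps_nth (fps_nth G i) (j - 1))"
  by (simp add: z2_inv_def)

lemma mult_z_sum_eq_0:
  assumes "G * (z1_inv + z2_inv) = 0 \<or> G * (z2_inv - z1_inv) = 0"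
  shows "G = 0"
proof -
  have "fps_nth (fps_nth G i) j = 0" for i j
  proof (induction i arbitrary: j)
    case 0
    have "fps_nth (fps_nth (G * (z1_inv + z2_inv)) 0) (Suc j) = 0 \<or>
          fps_nth (fps_nth (G * (z2_inv - z1_inv)) 0) (Suc j) = 0"
      using assms by (elim disjE; simp only: fps_zero_nth simp_thms)
    thus ?case by (simp add: ring_distribs nth_mult_z1_inv nth_mult_z2_inv del: fps_mult_nth_0)
  next
    case (Suc i)
    have "fps_nth (fps_nth (G * (z1_inv + z2_inv)) (Suc i)) (Suc j) = 0 \<or>
          fps_nth (fps_nth (G * (z2_inv - z1_inv)) (Suc i)) (Suc j) = 0"
      using assms by (elim disjE; simp only: fps_zero_nth simp_thms)
    thus ?case using Suc by (simp add: ring_distribs nth_mult_z1_inv nth_mult_z2_inv del: fps_mult_nth_0)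
  qed
  thus ?thesis by (simp add: fps_eq_iff)
qed

lemma exact_quot_eqI:
  assumes "d = z1_inv + z2_inv \<or> d = z2_inv - z1_inv" "q * d = n"
  shows "exact_quot n d = q"
  unfolding exact_quot_def
proof (rule the_equality)
  fix q' assume "q' * d = n"
  hence "(q' - q) * d = 0" using assms(2) by (simp add: ring_distribs)
  thus "q' = q" using assms(1) mult_z_sum_eq_0[of "q' - q"] by auto
qed (rule assms)

lemma pd_0 [simp]: "pd k 0 = (0 :: 'a::comm_ring_1 pseries)"
  by transfer simp

lemma pd_add: "pd k (f + g) = pd k f + pd k (g :: 'a::comm_ring_1 pseries)"
  by transfer (simp add: fun_eq_iff distrib_left)

lemma pd_diff: "pd k (f - g) = pd k f - pd k (g :: 'a::comm_ring_1 pseries)"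
  by transfer (simp add: fun_eq_iff right_diff_distrib)

lemma dBKP_quotients_exist:
  "\<exists>q. q * (z1_inv + z2_inv) = z1_inv * z2_inv * pd_coeffs 1 (2 * DB1 F + 2 * DB2 F)"
  "\<exists>q. q * (z2_inv - z1_inv) = z1_inv * z2_inv * pd_coeffs 1 (2 * DB1 F - 2 * DB2 F)"
proof -
  define a where "a i = pd 1 (2 * DB i F)" for i
  have a_even: "a i = 0" if "even i" for i
    using that by (simp add: a_def DB_def)
  have num: "fps_nth (fps_nth (2 * G) i) j = 2 * fps_nth (fps_nth G i) j"
    for G :: "complex pseries fps fps" and i j
    by (simp only: mult_2 fps_add_nth)
  have plus: "fps_nth (fps_nth (pd_coeffs 1 (2 * DB1 F + 2 * DB2 F)) i) j =
      (if j = 0 then a i else 0) + (if i = 0 then a j else 0)" for i j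
    by (simp add: pd_coeffs_def bps_def num DB1_def DB2_def a_def pd_add)
  have minus: "fps_nth (fps_nth (pd_coeffs 1 (2 * DB1 F - 2 * DB2 F)) i) j =
      (if j = 0 then a i else 0) - (if i = 0 then a j else 0)" for i j
    by (simp add: pd_coeffs_def bps_def num DB1_def DB2_def a_def pd_diff)
  have lift: "\<exists>q. q * d = z1_inv * z2_inv * n" if "q * d = n" for q d n
    using that by (intro exI[of _ "z1_inv * z2_inv * q"]) (simp add: mult.assoc)
  define q where "q = bps (\<lambda>i j. (- 1) ^ j * a (i + j + 1))"
  have "fps_nth (fps_nth (q * (z1_inv + z2_inv)) i) j =
      (if j = 0 then a i else 0) + (if i = 0 then a j else 0)" for i j
    by (cases i; cases j; cases "even j")
       (simp_all add: ring_distribs nth_mult_z1_inv nth_mult_z2_inv q_def bps_def a_even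
          del: fps_mult_nth_0)
  hence "q * (z1_inv + z2_inv) = pd_coeffs 1 (2 * DB1 F + 2 * DB2 F)"
    by (simp only: fps_eq_iff plus) simp
  thus "\<exists>q. q * (z1_inv + z2_inv) = z1_inv * z2_inv * pd_coeffs 1 (2 * DB1 F + 2 * DB2 F)"
    by (rule lift)
  define r where "r = bps (\<lambda>i j. - a (i + j + 1))"
  have "fps_nth (fps_nth (r * (z2_inv - z1_inv)) i) j =
      (if j = 0 then a i else 0) - (if i = 0 then a j else 0)" for i j
    by (cases i; cases j)
       (simp_all add: right_diff_distrib nth_mult_z1_inv nth_mult_z2_inv r_def bps_def a_even
          del: fps_mult_nth_0)
  hence "r * (z2_inv - z1_inv) = pd_coeffs 1 (2 * DB1 F - 2 * DB2 F)"
    by (simp only: fps_eq_iff minus) simp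
  thus "\<exists>q. q * (z2_inv - z1_inv) = z1_inv * z2_inv * pd_coeffs 1 (2 * DB1 F - 2 * DB2 F)"
    by (rule lift)
qed

text \<open>
  The exponential of a series without constant term with respect to $z_1^{-1}$, as the composition
  with the exponential series.  The library's \<open>fps_exp\<close> requires coefficients in a field.
\<close>

definition bexp :: "complex pseries fps fps \<Rightarrow> complex pseries fps fps" where
  "bexp G = Abs_fps (\<lambda>n. fps_const (sconst (1 / fact n))) oo G"

text \<open>
  In terms of the inverse variables, $1/(z_1 + z_2) = z_1^{-1} z_2^{-1} / (z_1^{-1} + z_2^{-1})$ and
  $1/(z_1 - z_2) = z_1^{-1} z_2^{-1} / (z_2^{-1} - z_1^{-1})$.
\<close>

definition dBKP :: "complex pseries \<Rightarrow> bool" where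
  "dBKP F \<longleftrightarrow>
     (1 - exact_quot (z1_inv * z2_inv * pd_coeffs 1 (2 * DB1 F + 2 * DB2 F)) (z1_inv + z2_inv))
       * bexp (2 * 2 * DB12 F)
     = 1 - exact_quot (z1_inv * z2_inv * pd_coeffs 1 (2 * DB1 F - 2 * DB2 F)) (z2_inv - z1_inv)"

text \<open>The change of variables $T_{2k-1} = t_k / (2k-1)$ in a series in the odd-indexed times.\<close>

definition odd_time_change :: "complex pseries \<Rightarrow> complex pseries" where
  "odd_time_change = psubst (\<lambda>j. if odd j then sconst (1 / of_nat j) * svar ((j + 1) div 2) else 0)"

end

theory Submission
  imports Defs
begin

text \<open>
  Write $n = 2N - 1$.  The polynomials $\varphi_\alpha(x) = \partial\lambda/\partial t_\alpha$ that
  represent the flat vector fields in the Jacobian ring of type $A_n$ are the coefficients of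
  $1/(p(z) - x)$, where $p(z) = z - \sum_j s_j z^{-j}$ with $s_j = t_{n+1-j}$; for the explicit $v_\gamma$
  this is Pascal's rule for multinomial coefficients.  Hence
  \[ K \sum_{i,j} \varphi_i \varphi_j z_1^{-i} z_2^{-j} = \sum_{i,j} \varphi_{i+j-1} z_1^{-i} z_2^{-j},
     \qquad K = \frac{p(z_1) - p(z_2)}{z_1 - z_2}, \]
  and as $\eta(\varphi_\alpha, \varphi_\beta) = \delta_{\alpha+\beta,n+1}$, the third derivatives
  $\partial_i \partial_j \partial_\gamma F$ with $i + j \le n + 1$ are the coefficients of
  $K^{-1} \partial_\gamma K = \partial_\gamma \log K$.  So $R^{\rm B}$ collects the Taylor coefficients of
  $\log K$ with $s_j = 0$ for even $j$.  The dispersionless BKP hierarchy reads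
  $K(z_1, -z_2) e^{G} = K(z_1, z_2)$ with $s_j$ the second derivatives $\partial_1 \partial_j$ and $G$ twice
  the generating series of all second derivatives; taking logarithms turns it into $(\ast)$.

  The existence of the potential, that is the closedness of the third derivatives, is a residue
  computation which uses that $\varphi_{\alpha+\delta-n-1}$ is at the same time the quotient of
  $\varphi_\alpha \varphi_\delta$ by $\lambda'$ and an $x$-primitive of $\partial\varphi_\alpha/\partial t_\delta$.
\<close>

section \<open>Power series in countably many variables\<close>

text \<open>The identity for K survives the pairing only while phi_{i+j-1} belongs to the basis,
  hence the truncation at total degree n + 1; N = \<alpha> + \<beta> + 1 keeps the indices 2
  \<alpha> - 1 and 2 \<beta> - 1 in this range. As K = 1 + sum_g s_g E_g is affine in s,
  differentiating E_g / K another m - 1 times gives (-1)^(m-1) (m-1)! times m factors E over K^m; at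
  s = 0 the denominator is 1, and the prefactor 1/m! leaves (-1)^(m-1)/m, the coefficients of the
  logarithm. On the BKP side s_j = 0 for even j, so log K has only terms of even total degree, and
  log K(z_1, z_2) - log K(z_1, -z_2) is twice its part that is odd in both variables. This 2 against
  the 4 in the exponent explains f = 2 F_0. The coefficients are series and do not form a field:
  divisors are monic, cancellation rests on the absence of zero divisors, and exp and log are
  compared through their differential equations. The potential is defined by its values at points,
  so identities of functions must be turned into identities of polynomials.\<close>

lemma mcoeff_Abs_pseries [simp]: "mcoeff (Abs_pseries f) = f"
  by (simp add: Abs_pseries_inverse)

lemma mcoeff_0 [simp]: "mcoeff 0 m = 0"
  by (simp add: zero_pseries.rep_eq)

lemma mcoeff_1: "mcoeff 1 m = (if m = 0 then 1 else 0)"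
  by (simp add: one_pseries.rep_eq)

lemma mcoeff_add [simp]: "mcoeff (f + g) m = mcoeff f m + mcoeff g m"
  by (simp add: plus_pseries.rep_eq)

lemma mcoeff_diff [simp]: "mcoeff (f - g) m = mcoeff f m - mcoeff g m"
  by (simp add: minus_pseries.rep_eq)

lemma mcoeff_uminus [simp]: "mcoeff (- f) m = - mcoeff f m"
  by (simp add: uminus_pseries.rep_eq)

lemma mcoeff_sum: "mcoeff (sum f A) m = (\<Sum>x\<in>A. mcoeff (f x) m)"
  by (induction A rule: infinite_finite_induct) simp_all

lemma mcoeff_mult: "mcoeff (f * g) m = (\<Sum>(a, b) | a + b = m. mcoeff f a * mcoeff g b)"
  by (simp add: times_pseries.rep_eq)

lemma mcoeff_sconst: "mcoeff (sconst c) m = (if m = 0 then c else 0)"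
  by (simp add: sconst.rep_eq)

lemma mcoeff_pd: "mcoeff (pd k f) m = of_nat (Poly_Mapping.lookup m k + 1) * mcoeff f (m + Poly_Mapping.single k 1)"
  by (simp add: pd.rep_eq)

lemma pseries_eq_iff: "f = g \<longleftrightarrow> (\<forall>m. mcoeff f m = mcoeff g m)"
  by (metis pseries_eqI)

definition smonom :: "(nat \<Rightarrow>\<^sub>0 nat) \<Rightarrow> 'a::comm_ring_1 pseries" where
  "smonom a = Abs_pseries (\<lambda>m. if m = a then 1 else 0)"

lemma mcoeff_smonom: "mcoeff (smonom a) m = (if m = a then 1 else 0)"
  by (simp add: smonom_def)

lemma mcoeff_mult_0: "mcoeff (f * g) 0 = mcoeff f 0 * mcoeff g 0"
proof -
  have "{(a, b). a + b = (0 :: nat \<Rightarrow>\<^sub>0 nat)} = {(0, 0)}"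
    by (auto simp: poly_mapping_eq_iff lookup_add fun_eq_iff)
  thus ?thesis by (simp add: mcoeff_mult)
qed

lemma mcoeff_smonom_mult_add: "mcoeff (smonom a * f) (a + m) = mcoeff f m"
proof -
  have "mcoeff (smonom a * f) (a + m) = (\<Sum>(a', b)\<in>{(a, m)}. mcoeff (smonom a) a' * mcoeff f b)"
    unfolding mcoeff_mult
    by (rule sum.mono_neutral_right[OF finite_exponent_splits]) (auto simp: mcoeff_smonom split: if_splits)
  thus ?thesis by (simp add: mcoeff_smonom)
qed

lemma mcoeff_smonom_mult_not_add:
  assumes "\<And>b. m \<noteq> a + b"
  shows "mcoeff (smonom a * f) m = 0"
  unfolding mcoeff_mult using assms by (intro sum.neutral) (auto simp: mcoeff_smonom)

lemma smonom_0 [simp]: "smonom 0 = 1"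
  by (simp add: pseries_eq_iff mcoeff_smonom mcoeff_1)

lemma smonom_add: "smonom (a + b) = smonom a * smonom b"
proof (rule pseries_eqI)
  fix m show "mcoeff (smonom (a + b)) m = mcoeff (smonom a * smonom b :: 'a pseries) m"
  proof (cases "\<exists>c. m = a + c")
    case True
    then show ?thesis by (auto simp: mcoeff_smonom_mult_add mcoeff_smonom)
  next
    case False
    then show ?thesis using mcoeff_smonom_mult_not_add[of m a] by (auto simp: mcoeff_smonom)
  qed
qed

lemma svar_eq_smonom: "svar k = smonom (Poly_Mapping.single k 1)"
  by (simp add: pseries_eq_iff mcoeff_smonom svar.rep_eq)

lemma single_add_minus:
  "Poly_Mapping.lookup m k \<noteq> 0 \<Longrightarrow> Poly_Mapping.single k 1 + (m - Poly_Mapping.single k 1) = (m :: nat \<Rightarrow>\<^sub>0 nat)"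
  by (rule poly_mapping_eqI) (auto simp: lookup_add lookup_minus lookup_single when_def)

lemma mcoeff_svar_mult:
  "mcoeff (svar k * f) m = (if Poly_Mapping.lookup m k = 0 then 0 else mcoeff f (m - Poly_Mapping.single k 1))"
proof (cases "Poly_Mapping.lookup m k = 0")
  case True
  hence "m \<noteq> Poly_Mapping.single k 1 + b" for b
    by (auto simp: lookup_add)
  with True show ?thesis by (simp add: svar_eq_smonom mcoeff_smonom_mult_not_add)
next
  case False
  then show ?thesis
    by (metis mcoeff_smonom_mult_add single_add_minus svar_eq_smonom)
qed

lemma svar_power: "svar k ^ e = smonom (Poly_Mapping.single k e)"
  by (induction e) (simp_all add: svar_eq_smonom smonom_add[symmetric] single_add[symmetric])

lemma smonom_sum: "smonom (sum f A) = (\<Prod>x\<in>A. smonom (f x))"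
  by (induction A rule: infinite_finite_induct) (simp_all add: smonom_add)

lemma sum_single_lookup:
  assumes "finite A" "Poly_Mapping.keys m \<subseteq> A"
  shows "(\<Sum>k\<in>A. Poly_Mapping.single k (Poly_Mapping.lookup m k)) = (m :: nat \<Rightarrow>\<^sub>0 nat)"
proof (rule poly_mapping_eqI)
  fix j
  have "Poly_Mapping.lookup (\<Sum>k\<in>A. Poly_Mapping.single k (Poly_Mapping.lookup m k)) j =
      (\<Sum>k\<in>A. if k = j then Poly_Mapping.lookup m k else 0)"
    by (simp add: lookup_sum lookup_single when_def)
  also have "\<dots> = Poly_Mapping.lookup m j"
    using assms by (auto simp: sum.delta' in_keys_iff)
  finally show "Poly_Mapping.lookup (\<Sum>k\<in>A. Poly_Mapping.single k (Poly_Mapping.lookup m k)) j =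
      Poly_Mapping.lookup m j" .
qed

lemma prod_svar_power:
  assumes "finite A" "Poly_Mapping.keys m \<subseteq> A"
  shows "(\<Prod>k\<in>A. svar k ^ Poly_Mapping.lookup m k) = smonom m"
  using sum_single_lookup[OF assms] by (simp add: svar_power smonom_sum[symmetric])

lemma sconst_0 [simp]: "sconst 0 = (0 :: 'a::comm_ring_1 pseries)"
  by (simp add: pseries_eq_iff mcoeff_sconst)

lemma sconst_1 [simp]: "sconst 1 = (1 :: 'a::comm_ring_1 pseries)"
  by (simp add: pseries_eq_iff mcoeff_sconst mcoeff_1)

lemma mcoeff_sconst_mult [simp]: "mcoeff (sconst c * f) m = c * mcoeff f m"
proof -
  have "mcoeff (sconst c * f) m = (\<Sum>(a, b)\<in>{(0, m)}. mcoeff (sconst c) a * mcoeff f b)"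
    unfolding mcoeff_mult
    by (rule sum.mono_neutral_right[OF finite_exponent_splits]) (auto simp: mcoeff_sconst split: if_splits)
  thus ?thesis by (simp add: mcoeff_sconst)
qed

lemma sconst_add: "sconst (a + b) = (sconst a + sconst b :: 'a::comm_ring_1 pseries)"
  by (simp add: pseries_eq_iff mcoeff_sconst)

lemma sconst_mult: "sconst (a * b) = (sconst a * sconst b :: 'a::comm_ring_1 pseries)"
  by (simp add: pseries_eq_iff) (simp add: mcoeff_sconst)

lemma sconst_uminus: "sconst (- a) = - (sconst a :: 'a::comm_ring_1 pseries)"
  by (simp add: pseries_eq_iff mcoeff_sconst)

lemma sconst_power: "sconst (a ^ n) = (sconst a ^ n :: 'a::comm_ring_1 pseries)"
  by (induction n) (simp_all add: sconst_mult)

lemma sconst_prod: "sconst (prod f A) = (\<Prod>x\<in>A. sconst (f x) :: 'a::comm_ring_1 pseries)"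
  by (induction A rule: infinite_finite_induct) (simp_all add: sconst_mult)

lemma sconst_of_nat: "sconst (of_nat n) = (of_nat n :: 'a::comm_ring_1 pseries)"
  by (induction n) (simp_all add: sconst_add)

lemma mcoeff_of_nat_mult [simp]: "mcoeff (of_nat n * f) m = of_nat n * mcoeff f m"
  by (simp add: sconst_of_nat[symmetric])

lemma of_nat_mult_pseries_eq_0: "of_nat n * f = (0 :: complex pseries) \<Longrightarrow> n > 0 \<Longrightarrow> f = 0"
  by (simp add: pseries_eq_iff)

lemma pd_uminus: "pd k (- f) = - pd k (f :: 'a::comm_ring_1 pseries)"
  by (simp add: pseries_eq_iff mcoeff_pd)

lemma pd_sum: "pd k (sum f A) = (\<Sum>x\<in>A. pd k (f x :: 'a::comm_ring_1 pseries))"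
  by (induction A rule: infinite_finite_induct) (simp_all add: pd_add)

text \<open>Leibniz rule. In every decomposition a + b of the shifted monomial the differentiated
  exponent is the sum of those of a and b. The a half, shifted back, is the first product
  (\<open>left\<close>); the b half follows by exchanging f and g.\<close>

lemma pd_mult: "pd k (f * g) = pd k f * g + f * pd k (g :: 'a::comm_ring_1 pseries)"
proof (rule pseries_eqI)
  fix m :: "nat \<Rightarrow>\<^sub>0 nat"
  let ?e = "Poly_Mapping.single k (1::nat)"
  have left: "(\<Sum>(a, b) | a + b = m + ?e. of_nat (Poly_Mapping.lookup a k) * (mcoeff f' a * mcoeff g' b))
      = mcoeff (pd k f' * g') m" for f' g' :: "'a pseries"
  proof -
    have "(\<Sum>(a, b) | a + b = m + ?e. of_nat (Poly_Mapping.lookup a k) * (mcoeff f' a * mcoeff g' b)) =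
        (\<Sum>(a, b) | a + b = m + ?e \<and> Poly_Mapping.lookup a k \<noteq> 0. of_nat (Poly_Mapping.lookup a k) * (mcoeff f' a * mcoeff g' b))"
      by (rule sum.mono_neutral_right[OF finite_exponent_splits]) (auto intro!: gr0I)
    also have "\<dots> = (\<Sum>(a, b) | a + b = m. mcoeff (pd k f') a * mcoeff g' b)"
    proof (rule sum.reindex_bij_witness[where i = "\<lambda>(a, b). (?e + a, b)" and j = "\<lambda>(a, b). (a - ?e, b)"])
      fix p assume "p \<in> {(a, b). a + b = m + ?e \<and> Poly_Mapping.lookup a k \<noteq> 0}"
      then obtain a b where p: "p = (a, b)" "a + b = m + ?e" "Poly_Mapping.lookup a k \<noteq> 0" by auto
      have a: "?e + (a - ?e) = a" by (rule single_add_minus) (rule p)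
      have "?e + (a - ?e + b) = ?e + m"
        by (simp only: add.assoc[symmetric] a p(2) add.commute[of m])
      hence "a - ?e + b = m" by (rule add_left_imp_eq)
      thus "(case p of (a, b) \<Rightarrow> (a - ?e, b)) \<in> {(a, b). a + b = m}" by (simp add: p)
      show "(case case p of (a, b) \<Rightarrow> (a - ?e, b) of (a, b) \<Rightarrow> (?e + a, b)) = p"
        using a by (simp add: p)
      show "(case case p of (a, b) \<Rightarrow> (a - ?e, b) of (a, b) \<Rightarrow> mcoeff (pd k f') a * mcoeff g' b) =
          (case p of (a, b) \<Rightarrow> of_nat (Poly_Mapping.lookup a k) * (mcoeff f' a * mcoeff g' b))"
      proof -
        have "mcoeff (pd k f') (a - ?e) = of_nat (Poly_Mapping.lookup a k) * mcoeff f' a"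
          unfolding mcoeff_pd add.commute[of "a - ?e"] a using p(3) by (simp add: lookup_minus)
        thus ?thesis by (simp add: p mult.assoc)
      qed
    qed (auto simp: lookup_add ac_simps)
    finally show ?thesis by (simp add: mcoeff_mult)
  qed
  have "mcoeff (pd k (f * g)) m = (\<Sum>(a, b) | a + b = m + ?e. of_nat (Poly_Mapping.lookup m k + 1) * (mcoeff f a * mcoeff g b))"
    unfolding mcoeff_pd mcoeff_mult by (simp add: sum_distrib_left case_prod_unfold)
  also have "\<dots> = (\<Sum>(a, b) | a + b = m + ?e. of_nat (Poly_Mapping.lookup a k) * (mcoeff f a * mcoeff g b) +
      of_nat (Poly_Mapping.lookup b k) * (mcoeff f a * mcoeff g b))"
  proof (rule sum.cong[OF refl])
    fix p assume "p \<in> {(a, b). a + b = m + ?e}"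
    then obtain a b where p: "p = (a, b)" "a + b = m + ?e" by auto
    have "Poly_Mapping.lookup m k + 1 = Poly_Mapping.lookup a k + Poly_Mapping.lookup b k"
      by (metis lookup_add lookup_single_eq p(2))
    thus "(case p of (a, b) \<Rightarrow> of_nat (Poly_Mapping.lookup m k + 1) * (mcoeff f a * mcoeff g b)) =
        (case p of (a, b) \<Rightarrow> of_nat (Poly_Mapping.lookup a k) * (mcoeff f a * mcoeff g b) +
          of_nat (Poly_Mapping.lookup b k) * (mcoeff f a * mcoeff g b))"
      unfolding p by (simp only: case_prod_conv of_nat_add distrib_right)
  qed
  also have "\<dots> = (\<Sum>(a, b) | a + b = m + ?e. of_nat (Poly_Mapping.lookup a k) * (mcoeff f a * mcoeff g b)) +
      (\<Sum>(a, b) | a + b = m + ?e. of_nat (Poly_Mapping.lookup b k) * (mcoeff f a * mcoeff g b))"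
    by (simp add: sum.distrib case_prod_unfold)
  also have "(\<Sum>(a, b) | a + b = m + ?e. of_nat (Poly_Mapping.lookup b k) * (mcoeff f a * mcoeff g b)) =
      (\<Sum>(b, a) | b + a = m + ?e. of_nat (Poly_Mapping.lookup b k) * (mcoeff g b * mcoeff f a))"
    by (rule sum.reindex_bij_witness[where i = "\<lambda>(a, b). (b, a)" and j = "\<lambda>(a, b). (b, a)"])
       (auto simp: add.commute mult.commute)
  finally show "mcoeff (pd k (f * g)) m = mcoeff (pd k f * g + f * pd k g) m"
    unfolding left by (simp add: mult.commute)
qed

lemma pd_sconst [simp]: "pd k (sconst c :: 'a::comm_ring_1 pseries) = 0"
proof -
  have "m + Poly_Mapping.single k (Suc 0) \<noteq> 0" for m
    by (metis add_eq_0_iff_both_eq_0 lookup_add lookup_single_eq lookup_zero nat.distinct(1))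
  thus ?thesis by (simp add: pseries_eq_iff mcoeff_pd mcoeff_sconst)
qed

lemma pd_1 [simp]: "pd k (1 :: 'a::comm_ring_1 pseries) = 0"
  using pd_sconst[of k 1] by simp

lemma pd_commute: "pd j (pd k f) = pd k (pd j (f :: 'a::comm_ring_1 pseries))"
  by (cases "j = k") (auto simp: pseries_eq_iff mcoeff_pd lookup_add lookup_single ac_simps)

lemma pd_svar: "pd j (svar k) = (if j = k then 1 else 0 :: 'a::comm_ring_1 pseries)"
proof -
  have *: "m + Poly_Mapping.single j (Suc 0) = Poly_Mapping.single k (Suc 0) \<longleftrightarrow> j = k \<and> m = 0" for m
  proof
    assume h: "m + Poly_Mapping.single j (Suc 0) = Poly_Mapping.single k (Suc 0)"
    hence "Poly_Mapping.lookup (m + Poly_Mapping.single j (Suc 0)) j = Poly_Mapping.lookup (Poly_Mapping.single k (Suc 0)) j"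
      by simp
    hence "j = k" by (auto simp: lookup_add lookup_single when_def split: if_splits)
    thus "j = k \<and> m = 0" using h by simp
  qed simp
  show ?thesis
    by (auto simp: pseries_eq_iff mcoeff_pd svar.rep_eq mcoeff_1 *)
qed

section \<open>Polynomials among the series\<close>

lemma series_inI: "(\<And>m. mcoeff f m \<noteq> 0 \<Longrightarrow> Poly_Mapping.keys m \<subseteq> V) \<Longrightarrow> series_in V f"
  by (auto simp: series_in_def)

lemma series_inD: "series_in V f \<Longrightarrow> \<not> Poly_Mapping.keys m \<subseteq> V \<Longrightarrow> mcoeff f m = 0"
  by (auto simp: series_in_def)

lemma keys_add_nat: "Poly_Mapping.keys (a + b :: nat \<Rightarrow>\<^sub>0 nat) = Poly_Mapping.keys a \<union> Poly_Mapping.keys b"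
  by (auto simp: in_keys_iff lookup_add)

lemma mcoeff_mult_nonzeroE:
  assumes "mcoeff (f * g) m \<noteq> 0"
  obtains a b where "m = a + b" "mcoeff f a \<noteq> 0" "mcoeff g b \<noteq> 0"
proof -
  have "\<exists>p\<in>{(a, b). a + b = m}. (case p of (a, b) \<Rightarrow> mcoeff f a * mcoeff g b) \<noteq> 0"
    using assms unfolding mcoeff_mult by (meson sum.not_neutral_contains_not_neutral)
  thus ?thesis using that by force
qed

lemma series_in_add: "series_in V f \<Longrightarrow> series_in V g \<Longrightarrow> series_in V (f + g :: 'a::comm_ring_1 pseries)"
  unfolding series_in_def by (metis add.right_neutral mcoeff_add)

lemma series_in_uminus: "series_in V f \<Longrightarrow> series_in V (- f :: 'a::comm_ring_1 pseries)"
  unfolding series_in_def by simp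

lemma series_in_mult: "series_in V f \<Longrightarrow> series_in V g \<Longrightarrow> series_in V (f * g :: 'a::comm_ring_1 pseries)"
  unfolding series_in_def by (metis Un_subset_iff keys_add_nat mcoeff_mult_nonzeroE)

lemma series_in_sconst: "series_in V (sconst c :: 'a::comm_ring_1 pseries)"
  by (rule series_inI) (auto simp: mcoeff_sconst split: if_splits)

lemma series_in_pd: "series_in V f \<Longrightarrow> series_in V (pd k f :: 'a::comm_ring_1 pseries)"
  unfolding series_in_def mcoeff_pd by (metis keys_add_nat le_sup_iff mult_zero_right)

lemma is_polynomial_add: "is_polynomial f \<Longrightarrow> is_polynomial g \<Longrightarrow> is_polynomial (f + g :: 'a::comm_ring_1 pseries)"
  unfolding is_polynomial_def
  by (rule finite_subset[of _ "{m. mcoeff f m \<noteq> 0} \<union> {m. mcoeff g m \<noteq> 0}"]) auto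

lemma is_polynomial_uminus: "is_polynomial f \<Longrightarrow> is_polynomial (- f :: 'a::comm_ring_1 pseries)"
  unfolding is_polynomial_def by simp

lemma is_polynomial_mult: "is_polynomial f \<Longrightarrow> is_polynomial g \<Longrightarrow> is_polynomial (f * g :: 'a::comm_ring_1 pseries)"
  unfolding is_polynomial_def
  by (rule finite_subset[of _ "(\<lambda>(a, b). a + b) ` ({m. mcoeff f m \<noteq> 0} \<times> {m. mcoeff g m \<noteq> 0})"])
     (auto elim!: mcoeff_mult_nonzeroE)

lemma is_polynomial_sconst: "is_polynomial (sconst c :: 'a::comm_ring_1 pseries)"
  unfolding is_polynomial_def by (rule finite_subset[of _ "{0}"]) (auto simp: mcoeff_sconst split: if_splits)

lemma is_polynomial_smonom: "is_polynomial (smonom a :: 'a::comm_ring_1 pseries)"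
  unfolding is_polynomial_def by (rule finite_subset[of _ "{a}"]) (auto simp: mcoeff_smonom split: if_splits)

lemma is_polynomial_pd: "is_polynomial f \<Longrightarrow> is_polynomial (pd k f :: 'a::comm_ring_1 pseries)"
  unfolding is_polynomial_def
proof (rule finite_subset[of _ "(\<lambda>m. m - Poly_Mapping.single k 1) ` {m. mcoeff f m \<noteq> 0}"])
  show "{m. mcoeff (pd k f) m \<noteq> 0} \<subseteq> (\<lambda>m. m - Poly_Mapping.single k 1) ` {m. mcoeff f m \<noteq> 0}"
  proof
    fix m assume "m \<in> {m. mcoeff (pd k f) m \<noteq> 0}"
    hence "mcoeff f (m + Poly_Mapping.single k 1) \<noteq> 0" by (auto simp: mcoeff_pd)
    moreover have "m = (m + Poly_Mapping.single k 1) - Poly_Mapping.single k 1" by simp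
    ultimately show "m \<in> (\<lambda>m. m - Poly_Mapping.single k 1) ` {m. mcoeff f m \<noteq> 0}" by blast
  qed
qed simp

text \<open>Three clauses of \<open>is_A_potential\<close> in one predicate. Being closed under the
  ring operations, it can be carried through recursions and through division by a monic
  polynomial.\<close>

definition rat_poly :: "nat \<Rightarrow> complex pseries \<Rightarrow> bool" where
  "rat_poly n f \<longleftrightarrow> is_polynomial f \<and> series_in {1..n} f \<and> (\<forall>m. mcoeff f m \<in> \<rat>)"

lemma rat_poly_add: "rat_poly n f \<Longrightarrow> rat_poly n g \<Longrightarrow> rat_poly n (f + g)"
  by (simp add: rat_poly_def is_polynomial_add series_in_add)

lemma rat_poly_uminus: "rat_poly n f \<Longrightarrow> rat_poly n (- f)"
  by (simp add: rat_poly_def is_polynomial_uminus series_in_uminus)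

lemma rat_poly_diff: "rat_poly n f \<Longrightarrow> rat_poly n g \<Longrightarrow> rat_poly n (f - g)"
  using rat_poly_add[OF _ rat_poly_uminus, of n f g] by simp

lemma rat_poly_mult: "rat_poly n f \<Longrightarrow> rat_poly n g \<Longrightarrow> rat_poly n (f * g)"
  unfolding rat_poly_def using is_polynomial_mult series_in_mult
  by (auto simp: mcoeff_mult intro!: Rats_sum)

lemma rat_poly_sconst: "c \<in> \<rat> \<Longrightarrow> rat_poly n (sconst c)"
  by (simp add: rat_poly_def is_polynomial_sconst series_in_sconst mcoeff_sconst)

lemma rat_poly_0: "rat_poly n 0" and rat_poly_1: "rat_poly n 1"
  using rat_poly_sconst[of 0 n] rat_poly_sconst[of 1 n] by simp_all

lemma rat_poly_svar: "k \<in> {1..n} \<Longrightarrow> rat_poly n (svar k)"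
  by (auto simp: rat_poly_def svar_eq_smonom is_polynomial_smonom series_in_def mcoeff_smonom split: if_splits)

lemma rat_poly_sum: "(\<And>x. x \<in> A \<Longrightarrow> rat_poly n (f x)) \<Longrightarrow> rat_poly n (sum f A)"
  by (induction A rule: infinite_finite_induct) (simp_all add: rat_poly_0 rat_poly_add)

section \<open>Evaluation of polynomials at points\<close>

definition monom_val :: "(nat \<Rightarrow>\<^sub>0 nat) \<Rightarrow> (nat \<Rightarrow> 'a::comm_ring_1) \<Rightarrow> 'a" where
  "monom_val m x = (\<Prod>k\<in>Poly_Mapping.keys m. x k ^ Poly_Mapping.lookup m k)"

lemma monom_val_superset:
  "finite A \<Longrightarrow> Poly_Mapping.keys m \<subseteq> A \<Longrightarrow> monom_val m x = (\<Prod>k\<in>A. x k ^ Poly_Mapping.lookup m k)"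
  unfolding monom_val_def by (rule prod.mono_neutral_left) (auto simp: in_keys_iff)

lemma monom_val_0 [simp]: "monom_val 0 x = 1"
  by (simp add: monom_val_def)

lemma monom_val_add: "monom_val (a + b) x = monom_val a x * monom_val b x"
proof -
  let ?A = "Poly_Mapping.keys a \<union> Poly_Mapping.keys b"
  have "monom_val (a + b) x = (\<Prod>k\<in>?A. x k ^ Poly_Mapping.lookup (a + b) k)"
    "monom_val a x = (\<Prod>k\<in>?A. x k ^ Poly_Mapping.lookup a k)"
    "monom_val b x = (\<Prod>k\<in>?A. x k ^ Poly_Mapping.lookup b k)"
    by (rule monom_val_superset; auto simp: keys_add_nat)+
  thus ?thesis by (simp add: lookup_add power_add prod.distrib)
qed

lemma peval_superset:
  fixes f :: "'a::comm_ring_1 pseries"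
  assumes "finite A" "\<And>m. m \<notin> A \<Longrightarrow> mcoeff f m = 0"
  shows "peval f x = (\<Sum>m\<in>A. mcoeff f m * monom_val m x)"
  unfolding peval_def monom_val_def[symmetric]
  by (rule Sum_any.expand_superset) (use assms in \<open>auto intro: ccontr\<close>)

text \<open>Polynomiality matters: \<open>Sum_any\<close> is 0 on an infinite support, so additivity
  can fail for arbitrary series.\<close>

lemma peval_add:
  fixes f g :: "'a::comm_ring_1 pseries"
  assumes "is_polynomial f" "is_polynomial g"
  shows "peval (f + g) x = peval f x + peval g x"
proof -
  let ?A = "{m. mcoeff f m \<noteq> 0} \<union> {m. mcoeff g m \<noteq> 0}"
  have fin: "finite ?A" using assms by (simp add: is_polynomial_def)
  show ?thesis
    by (subst (1 2 3) peval_superset[OF fin]) (auto simp: sum.distrib distrib_right)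
qed

lemma peval_uminus: "peval (- f) x = - peval f (x :: nat \<Rightarrow> 'a::comm_ring_1)" if "is_polynomial f"
proof -
  have fin: "finite {m. mcoeff f m \<noteq> 0}" using that by (simp add: is_polynomial_def)
  show ?thesis
    by (subst (1 2) peval_superset[OF fin]) (auto simp: sum_negf)
qed

lemma peval_mult:
  fixes f g :: "'a::comm_ring_1 pseries"
  assumes "is_polynomial f" "is_polynomial g"
  shows "peval (f * g) x = peval f x * peval g x"
proof -
  let ?A = "{m. mcoeff f m \<noteq> 0}" and ?B = "{m. mcoeff g m \<noteq> 0}"
  let ?C = "(\<lambda>(a, b). a + b) ` (?A \<times> ?B)"
  have fin: "finite ?A" "finite ?B" "finite ?C" using assms by (auto simp: is_polynomial_def)
  have "peval (f * g) x = (\<Sum>m\<in>?C. mcoeff (f * g) m * monom_val m x)"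
    by (rule peval_superset) (use fin in \<open>auto elim!: mcoeff_mult_nonzeroE intro: ccontr\<close>)
  also have "\<dots> = (\<Sum>m\<in>?C. \<Sum>p\<in>{p \<in> ?A \<times> ?B. (\<lambda>(a, b). a + b) p = m}.
      mcoeff f (fst p) * mcoeff g (snd p) * monom_val (fst p + snd p) x)"
  proof (rule sum.cong[OF refl])
    fix m
    have "mcoeff (f * g) m = (\<Sum>p\<in>{p \<in> ?A \<times> ?B. (\<lambda>(a, b). a + b) p = m}. mcoeff f (fst p) * mcoeff g (snd p))"
      unfolding mcoeff_mult case_prod_unfold
      by (rule sum.mono_neutral_right) (use finite_exponent_splits[of m] in \<open>auto simp: case_prod_unfold\<close>)
    thus "mcoeff (f * g) m * monom_val m x = (\<Sum>p\<in>{p \<in> ?A \<times> ?B. (\<lambda>(a, b). a + b) p = m}.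
        mcoeff f (fst p) * mcoeff g (snd p) * monom_val (fst p + snd p) x)"
      by (simp add: sum_distrib_right case_prod_unfold)
  qed
  also have "\<dots> = (\<Sum>p\<in>?A \<times> ?B. mcoeff f (fst p) * mcoeff g (snd p) * monom_val (fst p + snd p) x)"
    by (rule sum.group) (use fin in auto)
  also have "\<dots> = (\<Sum>a\<in>?A. \<Sum>b\<in>?B. (mcoeff f a * monom_val a x) * (mcoeff g b * monom_val b x))"
    by (simp add: sum.cartesian_product case_prod_unfold monom_val_add mult_ac)
  also have "\<dots> = peval f x * peval g x"
    by (subst sum_product[symmetric], subst peval_superset[OF fin(1)], simp, subst peval_superset[OF fin(2)], simp_all)
  finally show ?thesis .
qed

lemma peval_sconst: "peval (sconst c) x = (c :: 'a::comm_ring_1)"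
  by (subst peval_superset[of "{0}"]) (auto simp: mcoeff_sconst)

lemma peval_0 [simp]: "peval 0 x = (0 :: 'a::comm_ring_1)" and peval_1 [simp]: "peval 1 x = (1 :: 'a::comm_ring_1)"
  using peval_sconst[of 0 x] peval_sconst[of 1 x] by simp_all

lemma peval_at_0: "peval f (\<lambda>_. 0) = mcoeff f (0 :: nat \<Rightarrow>\<^sub>0 nat)" for f :: "'a::comm_ring_1 pseries"
proof -
  have "monom_val m (\<lambda>_. 0 :: 'a) = (if m = 0 then 1 else 0)" for m
    by (auto simp: monom_val_def power_0_left prod_zero_iff in_keys_iff poly_mapping_eq_iff fun_eq_iff
        intro!: prod_zero)
  hence "peval f (\<lambda>_. 0) = Sum_any (\<lambda>m. if m = 0 then mcoeff f m else 0)"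
    unfolding peval_def monom_val_def[symmetric] by (intro Sum_any.cong) auto
  also have "\<dots> = (\<Sum>m\<in>{0}. if m = 0 then mcoeff f m else 0)"
    by (rule Sum_any.expand_superset) auto
  finally show ?thesis by simp
qed

text \<open>Uniqueness of base B expansions, by reduction modulo B; it keeps the exponents in the
  Kronecker substitution distinct.\<close>

lemma digits_eq:
  fixes B :: nat
  assumes "\<And>k. k < L \<Longrightarrow> d k < B \<and> e k < B" "(\<Sum>k<L. d k * B ^ k) = (\<Sum>k<L. e k * B ^ k)" "k < L"
  shows "d k = e k"
  using assms
proof (induction L arbitrary: d e k)
  case (Suc L)
  have split: "(\<Sum>k<Suc L. f k * B ^ k) = f 0 + B * (\<Sum>k<L. f (Suc k) * B ^ k)" for f
    by (simp add: sum.lessThan_Suc_shift sum_distrib_left mult_ac del: sum.lessThan_Suc)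
  have lt: "d 0 < B" "e 0 < B" using Suc.prems(1)[of 0] by auto
  have eq: "d 0 + B * (\<Sum>k<L. d (Suc k) * B ^ k) = e 0 + B * (\<Sum>k<L. e (Suc k) * B ^ k)"
    using Suc.prems(2) unfolding split .
  from arg_cong[OF eq, of "\<lambda>x. x mod B"] have 0: "d 0 = e 0" using lt by simp
  with eq lt have "(\<Sum>k<L. d (Suc k) * B ^ k) = (\<Sum>k<L. e (Suc k) * B ^ k)" by simp
  hence "d (Suc j) = e (Suc j)" if "j < L" for j
    using Suc.IH[of "\<lambda>k. d (Suc k)" "\<lambda>k. e (Suc k)" j] Suc.prems(1) that by auto
  thus ?case using 0 Suc.prems(3) by (cases k) auto
qed simp

text \<open>Kronecker substitution: at \<open>x k = y ^ (B ^ k)\<close> with large \<open>B\<close> the monomials of \<open>f\<close> become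
  distinct powers of \<open>y\<close>.\<close>

lemma polynomial_function_zero:
  fixes f :: "complex pseries"
  assumes "is_polynomial f" "\<And>x. peval f x = 0"
  shows "f = 0"
proof -
  define A where "A = {m. mcoeff f m \<noteq> 0}"
  have fin: "finite A" using assms(1) by (simp add: A_def is_polynomial_def)
  define L where "L = Suc (Max (insert 0 (\<Union>m\<in>A. Poly_Mapping.keys m)))"
  have keys: "k < L" if "m \<in> A" "k \<in> Poly_Mapping.keys m" for m k
    unfolding L_def less_Suc_eq_le using fin that by (intro Max_ge) auto
  define B where "B = Suc (Max (insert 0 (\<Union>m\<in>A. Poly_Mapping.lookup m ` {..<L})))"
  have exps: "Poly_Mapping.lookup m k < B" if "m \<in> A" "k < L" for m k
    unfolding B_def less_Suc_eq_le using fin that by (intro Max_ge) auto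
  define wt where "wt m = (\<Sum>k<L. Poly_Mapping.lookup m k * B ^ k)" for m
  have inj: "inj_on wt A"
  proof (rule inj_onI)
    fix a b assume ab: "a \<in> A" "b \<in> A" "wt a = wt b"
    show "a = b"
    proof (rule poly_mapping_eqI)
      fix k show "Poly_Mapping.lookup a k = Poly_Mapping.lookup b k"
      proof (cases "k < L")
        case True
        then show ?thesis using ab exps
          by (intro digits_eq[where L = L and d = "Poly_Mapping.lookup a" and e = "Poly_Mapping.lookup b" and B = B])
             (auto simp: wt_def)
      next
        case False
        then show ?thesis using ab(1,2) keys by (metis not_in_keys_iff_lookup_eq_zero)
      qed
    qed
  qed
  define p where "p = (\<Sum>m\<in>A. monom (mcoeff f m) (wt m))"
  have "poly p y = 0" for y
  proof -
    have "monom_val m (\<lambda>k. y ^ (B ^ k)) = y ^ wt m" if "m \<in> A" for m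
    proof -
      have "monom_val m (\<lambda>k. y ^ (B ^ k)) = (\<Prod>k<L. (y ^ (B ^ k)) ^ Poly_Mapping.lookup m k)"
        by (rule monom_val_superset) (use keys that in auto)
      thus ?thesis by (simp add: wt_def power_sum power_mult[symmetric] mult.commute)
    qed
    hence "poly p y = (\<Sum>m\<in>A. mcoeff f m * monom_val m (\<lambda>k. y ^ (B ^ k)))"
      by (simp add: p_def poly_sum poly_monom)
    also have "\<dots> = peval f (\<lambda>k. y ^ (B ^ k))"
      by (rule peval_superset[symmetric]) (use fin in \<open>auto simp: A_def\<close>)
    finally show ?thesis using assms(2) by simp
  qed
  hence "p = 0" using poly_all_0_iff_0 by blast
  have "m \<notin> A" for m
  proof
    assume m: "m \<in> A"
    have "coeff p (wt m) = (\<Sum>a\<in>A. if a = m then mcoeff f a else 0)"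
      unfolding p_def coeff_sum using inj m
      by (intro sum.cong) (auto dest: inj_onD)
    thus False using m fin \<open>p = 0\<close> by (simp add: A_def)
  qed
  thus ?thesis by (simp add: pseries_eq_iff A_def)
qed

lemma polynomial_eqI:
  fixes f g :: "complex pseries"
  assumes "is_polynomial f" "is_polynomial g" "\<And>x. peval f x = peval g x"
  shows "f = g"
proof -
  have "peval (f + - g) x = 0" for x
    using assms by (subst peval_add) (auto simp: peval_uminus is_polynomial_uminus)
  hence "f + - g = 0"
    by (intro polynomial_function_zero is_polynomial_add is_polynomial_uminus assms(1,2))
  thus ?thesis by simp
qed

text \<open>Poincare lemma for polynomial 1-forms. The coefficient of the potential at m can be read
  off from any variable occurring in m; closedness makes the reading independent of that
  variable.\<close>

lemma closed_form_potential:
  assumes G: "\<And>\<alpha>. \<alpha> \<in> {1..n} \<Longrightarrow> rat_poly n (G \<alpha>)"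
    and closed: "\<And>\<alpha> \<beta>. \<alpha> \<in> {1..n} \<Longrightarrow> \<beta> \<in> {1..n} \<Longrightarrow> pd \<beta> (G \<alpha>) = pd \<alpha> (G \<beta>)"
  shows "\<exists>H. rat_poly n H \<and> mcoeff H 0 = 0 \<and> (\<forall>\<alpha>\<in>{1..n}. pd \<alpha> H = G \<alpha>)"
proof -
  let ?e = "\<lambda>k. Poly_Mapping.single k (1::nat)"
  \<comment> \<open>\<open>Min\<close> is an arbitrary choice of a variable in m; division by its
    exponent undoes the factor that \<open>pd\<close> introduces.\<close>
  define h where "h m = (if m = 0 \<or> \<not> Poly_Mapping.keys m \<subseteq> {1..n} then 0 else
      let k = Min (Poly_Mapping.keys m) in mcoeff (G k) (m - ?e k) / of_nat (Poly_Mapping.lookup m k))"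
    for m :: "nat \<Rightarrow>\<^sub>0 nat"
  define H where "H = Abs_pseries h"
  have mH: "mcoeff H m = h m" for m by (simp add: H_def)
  have Min_keys: "Min (Poly_Mapping.keys m) \<in> Poly_Mapping.keys m" if "m \<noteq> 0" for m :: "nat \<Rightarrow>\<^sub>0 nat"
    using that by (intro Min_in) (auto simp: poly_mapping_eq_iff fun_eq_iff in_keys_iff)
  have "is_polynomial H"
  proof -
    let ?S = "\<Union>k\<in>{1..n}. (\<lambda>m. ?e k + m) ` {m. mcoeff (G k) m \<noteq> 0}"
    have "m \<in> ?S" if m: "h m \<noteq> 0" for m
    proof -
      define k where "k = Min (Poly_Mapping.keys m)"
      have m': "m \<noteq> 0" "Poly_Mapping.keys m \<subseteq> {1..n}" "mcoeff (G k) (m - ?e k) \<noteq> 0"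
        using m by (auto simp: h_def Let_def k_def split: if_splits)
      have "k \<in> Poly_Mapping.keys m" unfolding k_def by (rule Min_keys[OF m'(1)])
      hence k: "k \<in> {1..n}" "Poly_Mapping.lookup m k \<noteq> 0" using m'(2) by (auto simp only: in_keys_iff)
      show ?thesis using m'(3) single_add_minus[OF k(2)]
        by (intro UN_I[OF k(1)] image_eqI[of _ _ "m - ?e k"]) auto
    qed
    hence "{m. mcoeff H m \<noteq> 0} \<subseteq> ?S" by (auto simp: mH)
    moreover have "finite ?S" using G by (auto simp: rat_poly_def is_polynomial_def)
    ultimately show ?thesis unfolding is_polynomial_def by (rule finite_subset)
  qed
  moreover have "series_in {1..n} H"
    by (rule series_inI) (auto simp: mH h_def split: if_splits)
  moreover have "mcoeff H m \<in> \<rat>" for m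
  proof (cases "m = 0 \<or> \<not> Poly_Mapping.keys m \<subseteq> {1..n}")
    case False
    hence "mcoeff (G (Min (Poly_Mapping.keys m))) x \<in> \<rat>" for x
      using G Min_keys[of m] unfolding rat_poly_def by blast
    thus ?thesis by (simp add: mH h_def Let_def)
  qed (simp add: mH h_def)
  moreover have "pd \<alpha> H = G \<alpha>" if \<alpha>: "\<alpha> \<in> {1..n}" for \<alpha>
  proof (rule pseries_eqI)
    fix m
    show "mcoeff (pd \<alpha> H) m = mcoeff (G \<alpha>) m"
    proof (cases "Poly_Mapping.keys m \<subseteq> {1..n}")
      case False
      hence "mcoeff (G \<alpha>) m = 0" using G[OF \<alpha>] by (auto simp: rat_poly_def dest: series_inD)
      thus ?thesis using False by (simp add: mcoeff_pd mH h_def keys_add_nat)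
    next
      case True
      let ?M = "m + ?e \<alpha>"
      define k where "k = Min (Poly_Mapping.keys ?M)"
      have nz: "?M \<noteq> 0" using lookup_add[of m "?e \<alpha>" \<alpha>] by auto
      have k: "k \<in> Poly_Mapping.keys ?M" unfolding k_def by (rule Min_keys[OF nz])
      have H: "mcoeff H ?M = mcoeff (G k) (?M - ?e k) / of_nat (Poly_Mapping.lookup ?M k)"
        using nz True \<alpha> by (simp add: mH h_def Let_def k_def keys_add_nat)
      show ?thesis
      proof (cases "k = \<alpha>")
        case True
        have "?M - ?e \<alpha> = m" by simp
        thus ?thesis unfolding mcoeff_pd H True
          by (simp add: lookup_add add.commute del: of_nat_Suc)
      next
        case False
        hence mk: "Poly_Mapping.lookup m k \<noteq> 0"
          using k by (auto simp: in_keys_iff lookup_add lookup_single split: if_splits)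
        hence kn: "k \<in> {1..n}"
          using True by (meson in_keys_iff subsetD)
        define m' where "m' = m - ?e k"
        have m: "m = ?e k + m'" unfolding m'_def by (rule single_add_minus[OF mk, symmetric])
        have *: "?M - ?e k = m' + ?e \<alpha>" unfolding m
          by (rule poly_mapping_eqI) (simp add: lookup_add lookup_minus)
        \<comment> \<open>The chosen variable k differs from \<alpha>; closedness at m' links the
          coefficient of \<open>G k\<close> used in \<open>h\<close> with the wanted one of
          \<open>G \<alpha>\<close>.\<close>
        have "mcoeff (pd \<alpha> (G k)) m' = mcoeff (pd k (G \<alpha>)) m'"
          using closed[OF kn \<alpha>] by simp
        hence "of_nat (Poly_Mapping.lookup m \<alpha> + 1) * mcoeff (G k) (m' + ?e \<alpha>) =
            of_nat (Poly_Mapping.lookup m k) * mcoeff (G \<alpha>) m"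
          using False unfolding mcoeff_pd m by (simp add: lookup_add lookup_single add.commute)
        thus ?thesis using mk False unfolding mcoeff_pd H *
          by (simp add: lookup_add lookup_single field_simps)
      qed
    qed
  qed
  ultimately show ?thesis
    by (intro exI[of _ H]) (auto simp: rat_poly_def mH h_def)
qed

section \<open>The ring of series is an integral domain\<close>

lemma total_degree_superset:
  "finite A \<Longrightarrow> Poly_Mapping.keys m \<subseteq> A \<Longrightarrow> total_degree m = (\<Sum>k\<in>A. Poly_Mapping.lookup m k)"
  unfolding total_degree_def by (rule sum.mono_neutral_left) (auto simp: in_keys_iff)

lemma total_degree_add: "total_degree (a + b) = total_degree a + total_degree b"
proof -
  let ?A = "Poly_Mapping.keys a \<union> Poly_Mapping.keys b"
  have "total_degree (a + b) = (\<Sum>k\<in>?A. Poly_Mapping.lookup (a + b) k)"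
    "total_degree a = (\<Sum>k\<in>?A. Poly_Mapping.lookup a k)"
    "total_degree b = (\<Sum>k\<in>?A. Poly_Mapping.lookup b k)"
    by (rule total_degree_superset; auto simp: keys_add_nat)+
  thus ?thesis by (simp add: lookup_add sum.distrib)
qed

lemma lookup_le_total_degree: "Poly_Mapping.lookup m k \<le> total_degree m"
proof (cases "k \<in> Poly_Mapping.keys m")
  case True
  thus ?thesis unfolding total_degree_def by (intro member_le_sum) auto
qed (auto simp: in_keys_iff)

lemma finite_monomials:
  assumes "finite V"
  shows "finite {m. Poly_Mapping.keys m \<subseteq> V \<and> total_degree m = d}"
proof (rule finite_subset)
  let ?M = "\<Sum>k\<in>V. Poly_Mapping.single k d"
  have "Poly_Mapping.lookup ?M k = (if k \<in> V then d else 0)" for k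
    using assms by (simp add: lookup_sum lookup_single when_def)
  moreover have "Poly_Mapping.lookup m k = 0" if "Poly_Mapping.keys m \<subseteq> V" "k \<notin> V" for m :: "nat \<Rightarrow>\<^sub>0 nat" and k
    using that by (meson in_keys_iff subsetD)
  ultimately show "{m. Poly_Mapping.keys m \<subseteq> V \<and> total_degree m = d} \<subseteq>
      {a. \<forall>k. Poly_Mapping.lookup a k \<le> Poly_Mapping.lookup ?M k}"
    using lookup_le_total_degree by auto
qed (rule finite_exponents_below)

text \<open>Total degree comes first and the monomial order only breaks ties: finitely many
  variables have finitely many monomials of each degree, so a minimum exists.\<close>

lemma lowest_monomial:
  fixes f :: "'a::zero pseries"
  assumes "finite V" "mcoeff f m0 \<noteq> 0" "Poly_Mapping.keys m0 \<subseteq> V"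
  obtains p where "mcoeff f p \<noteq> 0" "Poly_Mapping.keys p \<subseteq> V"
    "\<And>m. mcoeff f m \<noteq> 0 \<Longrightarrow> Poly_Mapping.keys m \<subseteq> V \<Longrightarrow>
      total_degree p < total_degree m \<or> total_degree p = total_degree m \<and> p \<le> m"
proof -
  let ?P = "\<lambda>m. mcoeff f m \<noteq> 0 \<and> Poly_Mapping.keys m \<subseteq> V"
  define d where "d = (LEAST d. \<exists>m. ?P m \<and> total_degree m = d)"
  have "\<exists>m. ?P m \<and> total_degree m = d"
    unfolding d_def by (rule LeastI_ex) (use assms in auto)
  moreover have d: "d \<le> total_degree m" if "?P m" for m
    unfolding d_def by (rule Least_le) (use that in auto)
  moreover define A where "A = {m. ?P m \<and> total_degree m = d}"
  ultimately have A: "finite A" "A \<noteq> {}"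
    using finite_monomials[OF assms(1), of d] by (auto intro: finite_subset[rotated] simp: A_def)
  have "Min A \<in> A" by (rule Min_in) (use A in auto)
  moreover have "Min A \<le> m" if "m \<in> A" for m using A that by simp
  ultimately show ?thesis using d
    by (intro that[of "Min A"]) (auto simp: A_def le_less)
qed

text \<open>The lowest monomials p of f and q of g meet without cancellation at p + q, since degree
  and order are both compatible with addition. Restricting to the variables V of two chosen
  monomials loses nothing: every decomposition of p + q stays inside V.\<close>

instance pseries :: (idom) idom
proof
  fix f g :: "'a pseries"
  assume "f \<noteq> 0" "g \<noteq> 0"
  then obtain a b where ab: "mcoeff f a \<noteq> 0" "mcoeff g b \<noteq> 0"
    by (auto simp: pseries_eq_iff)
  define V where "V = Poly_Mapping.keys a \<union> Poly_Mapping.keys b"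
  have V: "finite V" "Poly_Mapping.keys a \<subseteq> V" "Poly_Mapping.keys b \<subseteq> V" by (auto simp: V_def)
  obtain p where p: "mcoeff f p \<noteq> 0" "Poly_Mapping.keys p \<subseteq> V"
    "\<And>m. mcoeff f m \<noteq> 0 \<Longrightarrow> Poly_Mapping.keys m \<subseteq> V \<Longrightarrow>
      total_degree p < total_degree m \<or> total_degree p = total_degree m \<and> p \<le> m"
    by (rule lowest_monomial[OF V(1) ab(1) V(2)]) blast
  obtain q where q: "mcoeff g q \<noteq> 0" "Poly_Mapping.keys q \<subseteq> V"
    "\<And>m. mcoeff g m \<noteq> 0 \<Longrightarrow> Poly_Mapping.keys m \<subseteq> V \<Longrightarrow>
      total_degree q < total_degree m \<or> total_degree q = total_degree m \<and> q \<le> m"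
    by (rule lowest_monomial[OF V(1) ab(2) V(3)]) blast
  have eq: "x = p \<and> y = q" if "x + y = p + q" "mcoeff f x \<noteq> 0" "mcoeff g y \<noteq> 0" for x y
  proof -
    have "Poly_Mapping.keys x \<subseteq> V" "Poly_Mapping.keys y \<subseteq> V"
      using arg_cong[OF that(1), of Poly_Mapping.keys] p(2) q(2) by (auto simp: keys_add_nat)
    moreover have "total_degree x + total_degree y = total_degree p + total_degree q"
      using arg_cong[OF that(1), of total_degree] by (simp add: total_degree_add)
    ultimately have "p \<le> x" "q \<le> y"
      using p(3)[OF that(2)] q(3)[OF that(3)] by auto
    with that(1) show ?thesis
      by (metis add_le_cancel_left add_le_cancel_right add_left_cancel add_right_cancel order_antisym
          add_mono le_less)
  qed
  have "mcoeff (f * g) (p + q) = (\<Sum>(x, y)\<in>{(p, q)}. mcoeff f x * mcoeff g y)"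
    unfolding mcoeff_mult
    by (rule sum.mono_neutral_right[OF finite_exponent_splits]) (use eq in auto)
  thus "f * g \<noteq> 0" using p(1) q(1) by auto
qed

section \<open>The basis adapted to the flat coordinates\<close>

text \<open>The recursion compares coefficients of z^(-b) in (p(z) - x) sum_a phi_a z^(-a) = 1. The
  value 0 at index 0 absorbs all truncated differences of indices.\<close>

fun phi :: "(nat \<Rightarrow> 'a::comm_ring_1) \<Rightarrow> nat \<Rightarrow> 'a poly" where
  "phi s 0 = 0"
| "phi s (Suc a) = (if a = 0 then 1 else pCons 0 (phi s a) + (\<Sum>j=1..a. smult (s j) (phi s (a - j))))"

declare phi.simps(2) [simp del]

lemma phi_1 [simp]: "phi s (Suc 0) = 1"
  by (simp add: phi.simps)

lemma phi_Suc: "a \<ge> 1 \<Longrightarrow> phi s (Suc a) = pCons 0 (phi s a) + (\<Sum>j=1..a. smult (s j) (phi s (a - j)))"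
  by (simp add: phi.simps)

lemma coeff_phi_eq_0: "l \<ge> a \<Longrightarrow> coeff (phi s a) l = 0"
proof (induction a arbitrary: l rule: less_induct)
  case (less a)
  show ?case
  proof (cases a)
    case (Suc b)
    show ?thesis
    proof (cases "b = 0")
      case False
      have "coeff (phi s (b - j)) l = 0" for j using less Suc by auto
      moreover have "coeff (phi s b) (l - 1) = 0" using less Suc by auto
      ultimately show ?thesis using False less(2) Suc
        by (auto simp: phi_Suc coeff_sum coeff_pCons split: nat.split)
    qed (use Suc less in auto)
  qed simp
qed

lemma coeff_phi_top: "a \<ge> 1 \<Longrightarrow> coeff (phi s a) (a - 1) = 1"
proof (induction a)
  case (Suc b)
  show ?case
  proof (cases "b = 0")
    case False
    have "coeff (phi s (b - j)) b = 0" for j by (rule coeff_phi_eq_0) simp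
    thus ?thesis using False Suc by (auto simp: phi_Suc coeff_sum coeff_pCons split: nat.split)
  qed simp
qed simp

lemma degree_phi: "degree (phi s a) = a - 1"
proof (cases "a = 0")
  case False
  have "degree (phi s a) \<le> a - 1"
    using False by (intro degree_le) (auto intro!: coeff_phi_eq_0)
  moreover have "a - 1 \<le> degree (phi s a)"
    using False coeff_phi_top[of a s] by (intro le_degree) auto
  ultimately show ?thesis by simp
qed simp

lemma coeff_phi_mult_eq_0: "l + 1 \<ge> a + b \<Longrightarrow> coeff (phi s a * phi s b) l = 0"
proof (cases "a = 0 \<or> b = 0")
  case False
  assume "l + 1 \<ge> a + b"
  moreover have "degree (phi s a * phi s b) \<le> (a - 1) + (b - 1)"
    using degree_mult_le[of "phi s a" "phi s b"] unfolding degree_phi .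
  ultimately have "degree (phi s a * phi s b) < l"
    using False by arith
  thus ?thesis by (rule coeff_eq_0)
qed auto

lemma coeff_phi_mult_top: "a \<ge> 1 \<Longrightarrow> b \<ge> 1 \<Longrightarrow> coeff (phi s a * phi s b) (a + b - 2) = 1"
  using coeff_mult_degree_sum[of "phi s a" "phi s b"]
  by (simp add: degree_phi coeff_phi_top[simplified]) (metis One_nat_def Nat.add_diff_assoc2 coeff_phi_top diff_diff_add mult.right_neutral one_add_one plus_1_eq_Suc Nat.diff_add_assoc)

text \<open>Coefficient form of the identity for K, the double sum coming from K - 1. The left side
  depends only on i + j, so i can be lowered to 1, where the double sum vanishes because of
  \<open>phi s 0 = 0\<close>.\<close>

lemma phi_mult:
  assumes "i \<ge> 1" "j \<ge> 1"
  shows "phi s i * phi s j + (\<Sum>a=1..i. \<Sum>b=1..j. smult (s (a + b - 1)) (phi s (i - a) * phi s (j - b)))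
    = phi s (i + j - 1)"
proof -
  define H where "H i j = phi s i * phi s j +
      (\<Sum>a=1..i. \<Sum>b=1..j. smult (s (a + b - 1)) (phi s (i - a) * phi s (j - b)))" for i j
  \<comment> \<open>What \<open>H (Suc i) j\<close> becomes after one use of the recursion. Its
    symmetry in i and j, with that of \<open>H\<close>, moves one unit of index from the first
    factor to the second.\<close>
  define S where "S i j = pCons 0 (phi s i * phi s j) + (\<Sum>a=1..i. smult (s a) (phi s (i - a) * phi s j))
      + (\<Sum>b=1..j. smult (s b) (phi s i * phi s (j - b)))
      + (\<Sum>a=1..i. \<Sum>b=1..j. smult (s (a + b)) (phi s (i - a) * phi s (j - b)))" for i j
  have S_commute: "S i j = S j i" for i j
  proof -
    have "(\<Sum>a=1..i. \<Sum>b=1..j. smult (s (a + b)) (phi s (i - a) * phi s (j - b))) =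
        (\<Sum>b=1..j. \<Sum>a=1..i. smult (s (b + a)) (phi s (j - b) * phi s (i - a)))"
      by (subst sum.swap) (simp add: mult.commute add.commute)
    thus ?thesis by (simp add: S_def mult.commute add_ac)
  qed
  have H_commute: "H i j = H j i" for i j
    unfolding H_def by (subst sum.swap) (simp add: mult.commute add.commute)
  have HS: "H (Suc i) j = S i j" if "i \<ge> 1" for i j
  proof -
    have "(\<Sum>a=1..Suc i. \<Sum>b=1..j. smult (s (a + b - 1)) (phi s (Suc i - a) * phi s (j - b))) =
        (\<Sum>a=0..i. \<Sum>b=1..j. smult (s (a + b)) (phi s (i - a) * phi s (j - b)))"
      unfolding One_nat_def sum.shift_bounds_cl_Suc_ivl by simp
    also have "\<dots> = (\<Sum>b=1..j. smult (s b) (phi s i * phi s (j - b))) +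
        (\<Sum>a=1..i. \<Sum>b=1..j. smult (s (a + b)) (phi s (i - a) * phi s (j - b)))"
      by (subst sum.atLeast_Suc_atMost) simp_all
    finally show ?thesis using that
      by (simp add: H_def S_def phi_Suc distrib_right sum_distrib_right add_ac)
  qed
  have step: "H (Suc i) j = H i (Suc j)" if "i \<ge> 1" "j \<ge> 1" for i j
    using HS[of i j] HS[of j i] that S_commute H_commute by metis
  have "H i j = phi s (i + j - 1)" if "i \<ge> 1" "j \<ge> 1" for i j
    using that
  proof (induction i arbitrary: j)
    case (Suc i)
    show ?case
    proof (cases "i = 0")
      case False
      then show ?thesis using Suc step[of i j] by simp
    qed (simp add: H_def)
  qed simp
  thus ?thesis using assms by (simp add: H_def)
qed

text \<open>In the Laurent expansion, \<open>phi s a\<close> is the polynomial part of \<open>z ^ (a - 1)\<close> times the derivative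
  of \<open>z\<close>, where \<open>z\<close> is the flat spectral parameter; this is why products of two of them
  with the same index sum agree up to terms of low degree.\<close>

lemma phi_mult_cong:
  assumes "i \<in> {1..m}" "j \<in> {1..m}" "i' \<in> {1..m}" "j' \<in> {1..m}" "i + j = i' + j'" "l + 2 \<ge> m"
  shows "coeff (phi s i * phi s j) l = coeff (phi s i' * phi s j') l"
  using assms
proof (induction m arbitrary: i j i' j' l)
  case (Suc m)
  \<comment> \<open>Moving one unit of index between the factors: the terms with x cancel, and the
    difference is a combination of differences of products with equal, smaller index sums.\<close>
  have adj: "coeff (phi s i * phi s (Suc j)) l = coeff (phi s (Suc i) * phi s j) l"
    if ij: "1 \<le> i" "i \<le> m" "1 \<le> j" "j \<le> m" for i j
  proof -
    have ext: "(\<Sum>k=1..i. smult (s k) (phi s (i - k) * q)) = (\<Sum>k=1..m. smult (s k) (phi s (i - k) * q))"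
      if "i \<le> m" for i q
      by (rule sum.mono_neutral_left) (use that in auto)
    have "phi s i * phi s (Suc j) - phi s (Suc i) * phi s j =
        (\<Sum>k=1..j. smult (s k) (phi s (j - k) * phi s i)) - (\<Sum>k=1..i. smult (s k) (phi s (i - k) * phi s j))"
      using ij by (simp add: phi_Suc distrib_left distrib_right sum_distrib_left sum_distrib_right mult.commute)
    also have "\<dots> = (\<Sum>k=1..m. smult (s k) (phi s (j - k) * phi s i - phi s (i - k) * phi s j))"
      unfolding ext[OF ij(2)] ext[OF ij(4)] by (simp add: sum_subtractf smult_diff_right)
    finally have *: "coeff (phi s i * phi s (Suc j)) l - coeff (phi s (Suc i) * phi s j) l =
        (\<Sum>k=1..m. s k * (coeff (phi s (j - k) * phi s i) l - coeff (phi s (i - k) * phi s j) l))"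
      by (simp add: coeff_sum flip: coeff_diff)
    \<comment> \<open>Where the induction hypothesis does not apply, both products vanish in degree
      l, through \<open>phi s 0 = 0\<close> or through the degree bound.\<close>
    have "coeff (phi s (j - k) * phi s i) l = coeff (phi s (i - k) * phi s j) l" if k: "k \<in> {1..m}" for k
    proof (cases "k < i \<and> k < j")
      case True
      then show ?thesis using ij Suc.prems(6) k by (intro Suc.IH) auto
    next
      case False
      have "coeff (phi s (b - k) * phi s a) l = 0" if "\<not> (k < a \<and> k < b)" "b \<le> m" for a b
      proof (cases "k \<ge> b")
        case False
        thus ?thesis using that Suc.prems(6) by (intro coeff_phi_mult_eq_0) auto
      qed simp
      thus ?thesis using False ij by (metis conj_commute)
    qed
    thus ?thesis using * by simp
  qed
  have chain: "coeff (phi s i * phi s j) l = coeff (phi s (i + d) * phi s (j - d)) l"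
    if "1 \<le> i" "i + d \<le> Suc m" "j \<le> Suc m" "d < j" for i j d
    using that
  proof (induction d)
    case (Suc d)
    have "coeff (phi s (i + d) * phi s (Suc (j - Suc d))) l = coeff (phi s (Suc (i + d)) * phi s (j - Suc d)) l"
      by (rule adj) (use Suc.prems in auto)
    moreover have "Suc (j - Suc d) = j - d" using Suc.prems by simp
    ultimately show ?case using Suc by simp
  qed simp
  show ?case
  proof (cases "i \<le> i'")
    case True
    moreover have "j - (i' - i) = j'" using True Suc.prems by auto
    ultimately show ?thesis using chain[of i "i' - i" j] Suc.prems by auto
  next
    case False
    moreover have "j' - (i - i') = j" using False Suc.prems by auto
    ultimately show ?thesis using chain[of i' "i - i'" j'] Suc.prems by auto
  qed
qed simp

section \<open>Derivatives of polynomials with series coefficients\<close>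

definition pdp :: "nat \<Rightarrow> 'a::idom pseries poly \<Rightarrow> 'a pseries poly" where
  "pdp k p = map_poly (pd k) p"

lemma coeff_pdp [simp]: "coeff (pdp k p) l = pd k (coeff p l)"
  by (simp add: pdp_def coeff_map_poly)

lemma pdp_0 [simp]: "pdp k 0 = 0" and pdp_1 [simp]: "pdp k 1 = 0"
  by (simp_all add: poly_eq_iff)

lemma pdp_add: "pdp k (p + q) = pdp k p + pdp k q"
  by (simp add: poly_eq_iff pd_add)

lemma pdp_mult: "pdp k (p * q) = pdp k p * q + p * pdp k q"
  by (simp add: poly_eq_iff coeff_mult pd_sum pd_mult sum.distrib)

lemma pdp_smult: "pdp k (smult c p) = smult (pd k c) p + smult c (pdp k p)"
  by (simp add: poly_eq_iff pd_mult)

lemma pdp_sum: "pdp k (sum f A) = (\<Sum>x\<in>A. pdp k (f x))"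
  by (induction A rule: infinite_finite_induct) (simp_all add: pdp_add)

lemma pdp_pCons: "pdp k (pCons a p) = pCons (pd k a) (pdp k p)"
  by (simp add: poly_eq_iff coeff_pCons split: nat.split)

lemma pderiv_sum: "pderiv (sum f A) = (\<Sum>x\<in>A. pderiv (f x))"
  by (induction A rule: infinite_finite_induct) (simp_all add: pderiv_add)

text \<open>For Phi = 1/(p(z) - x) both the derivative in s_h and z^(-h) times the derivative in x
  equal z^(-h)/(p(z) - x)^2; the factor z^(-h) shifts the index by h.\<close>

lemma pdp_phi:
  assumes s: "\<And>j. pd k (s j) = (if j = h then 1 else 0)" and "h \<ge> 1"
  shows "pdp k (phi s a) = pderiv (phi s (a - h))"
proof (induction a rule: less_induct)
  case (less a)
  show ?case
  proof (cases "a \<le> 1")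
    case True
    then show ?thesis using \<open>h \<ge> 1\<close> by (cases a) auto
  next
    case False
    define b where "b = a - 1"
    have a: "a = Suc b" "b \<ge> 1" using False by (auto simp: b_def)
    have "pdp k (phi s a) = pCons 0 (pderiv (phi s (b - h))) +
        (\<Sum>j=1..b. smult (if j = h then 1 else 0) (phi s (b - j)) + smult (s j) (pderiv (phi s (b - j - h))))"
      using less.IH a by (simp add: phi_Suc pdp_add pdp_pCons pdp_sum pdp_smult s)
    also have "\<dots> = pCons 0 (pderiv (phi s (b - h))) + (\<Sum>j=1..b. if j = h then phi s (b - j) else 0) +
        (\<Sum>j=1..b. smult (s j) (pderiv (phi s (b - j - h))))"
      by (simp add: sum.distrib if_distrib[of "\<lambda>c. smult c _"] cong: if_cong)
    also have "(\<Sum>j=1..b. if j = h then phi s (b - j) else 0) = phi s (b - h)"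
      using \<open>h \<ge> 1\<close> by (auto simp: sum.delta)
    also have "pCons 0 (pderiv (phi s (b - h))) + phi s (b - h) +
        (\<Sum>j=1..b. smult (s j) (pderiv (phi s (b - j - h)))) = pderiv (phi s (a - h))"
    proof (cases "b - h \<ge> 1")
      case True
      have "(\<Sum>j=1..b. smult (s j) (pderiv (phi s (b - j - h)))) = (\<Sum>j=1..b-h. smult (s j) (pderiv (phi s (b - h - j))))"
        by (rule sum.mono_neutral_cong_right) (auto simp: add.commute)
      moreover have "a - h = Suc (b - h)" using a True by simp
      moreover have "pderiv (\<Sum>j=1..b-h. smult (s j) (phi s (b - h - j))) = (\<Sum>j=1..b-h. smult (s j) (pderiv (phi s (b - h - j))))"
        by (simp add: pderiv_sum pderiv_smult)
      ultimately show ?thesis using True by (simp add: phi_Suc pderiv_add pderiv_pCons)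
    next
      case False
      hence "a - h = 0 \<or> a - h = 1" "b - h = 0" "\<And>j. b - j - h = 0" using a by auto
      thus ?thesis by auto
    qed
    finally show ?thesis .
  qed
qed

section \<open>Division by a monic polynomial\<close>

text \<open>\<open>S\<close> stands for a set of coefficients closed under the ring operations;
  since the leading coefficient is 1, division never leaves it. With \<open>rat_poly n\<close> for
  \<open>S\<close>, quotient and remainder keep rational polynomial coefficients.\<close>

lemma monic_division_exists:
  fixes M :: "'a::comm_ring_1 poly"
  assumes M: "coeff M n = 1" "\<And>l. l > n \<Longrightarrow> coeff M l = 0" "\<And>l. S (coeff M l)"
    and S: "S 0" "\<And>a b. S a \<Longrightarrow> S b \<Longrightarrow> S (a - b)" "\<And>a b. S a \<Longrightarrow> S b \<Longrightarrow> S (a + b)"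
      "\<And>a b. S a \<Longrightarrow> S b \<Longrightarrow> S (a * b)"
    and f: "\<And>l. S (coeff f l)"
  shows "\<exists>q r. f = M * q + r \<and> (\<forall>l. S (coeff q l)) \<and> (\<forall>l. S (coeff r l)) \<and> (\<forall>l\<ge>n. coeff r l = 0)"
proof -
  have "\<exists>q r. f = M * q + r \<and> (\<forall>l. S (coeff q l)) \<and> (\<forall>l. S (coeff r l)) \<and> (\<forall>l\<ge>n. coeff r l = 0)"
    if "\<And>l. S (coeff f l)" "\<And>l. l \<ge> k \<Longrightarrow> coeff f l = 0" for k f
    using that
  proof (induction k arbitrary: f)
    case 0
    thus ?case using S(1) by (intro exI[of _ 0] exI[of _ f]) auto
  next
    case (Suc k)
    show ?case
    proof (cases "k \<ge> n")
      case False
      thus ?thesis using Suc.prems S(1) by (intro exI[of _ 0] exI[of _ f]) auto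
    next
      case True
      define t where "t = monom (coeff f k) (k - n)"
      have tM: "coeff (t * M) l = (if l < k - n then 0 else coeff f k * coeff M (l - (k - n)))" for l
        by (simp add: t_def coeff_monom_mult)
      have "\<exists>q r. f - t * M = M * q + r \<and> (\<forall>l. S (coeff q l)) \<and> (\<forall>l. S (coeff r l)) \<and> (\<forall>l\<ge>n. coeff r l = 0)"
      proof (rule Suc.IH)
        show "S (coeff (f - t * M) l)" for l
          unfolding coeff_diff tM using Suc.prems(1) M(3) S by auto
        show "coeff (f - t * M) l = 0" if "l \<ge> k" for l
        proof (cases "l = k")
          case True
          thus ?thesis using \<open>k \<ge> n\<close> M(1) by (simp add: tM)
        next
          case False
          thus ?thesis using \<open>k \<ge> n\<close> that M(2)[of "l - (k - n)"] Suc.prems(2)[of l] by (simp add: tM)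
        qed
      qed
      then obtain q r where qr: "f - t * M = M * q + r" "\<forall>l. S (coeff q l)" "\<forall>l. S (coeff r l)" "\<forall>l\<ge>n. coeff r l = 0"
        by blast
      have "f = M * (q + t) + r" using qr(1) by (simp add: algebra_simps)
      moreover have "S (coeff (q + t) l)" for l
        using qr(2) Suc.prems(1) S by (auto simp: t_def)
      ultimately show ?thesis using qr by blast
    qed
  qed
  moreover have "coeff f l = 0" if "l \<ge> Suc (degree f)" for l
    using that by (intro coeff_eq_0) simp
  ultimately show ?thesis using f by blast
qed

text \<open>Division with remainder over an integral domain: the coefficients will be series in the
  flat coordinates, where only monic divisors are harmless.\<close>

locale monic_poly =
  fixes M :: "'a::idom poly" and n :: nat
  assumes n_pos: "n \<ge> 1" and coeff_M_n: "coeff M n = 1" and coeff_M_gt: "l > n \<Longrightarrow> coeff M l = 0"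
begin

definition low :: "'a poly \<Rightarrow> bool" where "low r \<longleftrightarrow> (\<forall>l\<ge>n. coeff r l = 0)"

lemma degree_M: "degree M = n"
  using coeff_M_n coeff_M_gt by (metis degree_le le_antisym le_degree zero_neq_one)

definition quo :: "'a poly \<Rightarrow> 'a poly" where
  "quo f = (SOME q. low (f - M * q))"

definition rem :: "'a poly \<Rightarrow> 'a poly" where "rem f = f - M * quo f"

lemma low_rem: "low (rem f)"
proof -
  obtain q r where "f = M * q + r" "\<forall>l\<ge>n. coeff r l = 0"
    using monic_division_exists[of M n "\<lambda>_. True" f] coeff_M_n coeff_M_gt by blast
  hence "low (f - M * q)" by (simp add: low_def)
  thus ?thesis unfolding rem_def quo_def by (rule someI)
qed

lemma division: "f = M * quo f + rem f"
  by (simp add: rem_def)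

lemma low_add: "low f \<Longrightarrow> low g \<Longrightarrow> low (f + g)" and low_diff: "low f \<Longrightarrow> low g \<Longrightarrow> low (f - g)"
  and low_0: "low 0"
  by (simp_all add: low_def)

lemma low_M_mult: "low (M * q) \<Longrightarrow> q = 0"
proof (rule ccontr)
  assume "low (M * q)" "q \<noteq> 0"
  hence "coeff (M * q) (n + degree q) \<noteq> 0"
    using coeff_mult_degree_sum[of M q] by (simp add: degree_M coeff_M_n)
  thus False using \<open>low (M * q)\<close> by (simp add: low_def)
qed

lemma division_unique:
  assumes "f = M * q + r" "low r"
  shows "quo f = q" "rem f = r"
proof -
  have "M * (quo f - q) = r - rem f"
    using assms(1) division[of f] by (simp add: algebra_simps)
  hence "low (M * (quo f - q))" using assms(2) low_rem low_diff by simp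
  hence "quo f - q = 0" by (rule low_M_mult)
  thus "quo f = q" by simp
  thus "rem f = r" using assms(1) by (simp add: rem_def)
qed

lemma quo_add: "quo (f + g) = quo f + quo g" and rem_add: "rem (f + g) = rem f + rem g"
  by (rule division_unique[where q = "quo f + quo g" and r = "rem f + rem g"];
      use division[of f] division[of g] low_rem low_add in \<open>simp add: algebra_simps\<close>)+

lemma quo_uminus: "quo (- f) = - quo f" and rem_uminus: "rem (- f) = - rem f"
  by (rule division_unique[where q = "- quo f" and r = "- rem f"];
      use division[of f] low_rem[of f] in \<open>simp add: algebra_simps low_def\<close>)+

lemma rem_low: "low f \<Longrightarrow> rem f = f"
  using division_unique[of f 0 f] by simp

lemma quo_M_mult: "quo (M * f) = f" and rem_M_mult: "rem (M * f) = 0"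
  using division_unique[of "M * f" f 0] by (simp_all add: low_0)

text \<open>\<open>rho f\<close> and \<open>sigma f\<close> are the coefficients of $1/x$ in the expansions of $f/M$ and $f/M^2$ at infinity.\<close>

definition rho :: "'a poly \<Rightarrow> 'a" where "rho f = coeff (rem f) (n - 1)"
definition sigma :: "'a poly \<Rightarrow> 'a" where "sigma f = rho (quo f)"

lemma rho_add: "rho (f + g) = rho f + rho g"
  by (simp add: rho_def rem_add)

lemma rho_uminus: "rho (- f) = - rho f"
  by (simp add: rho_def rem_uminus)

lemma rho_diff: "rho (f - g) = rho f - rho g"
  using rho_add[of f "- g"] by (simp add: rho_uminus)

lemma rho_M_mult [simp]: "rho (M * f) = 0"
  by (simp add: rho_def rem_M_mult)

lemma rho_low: "low f \<Longrightarrow> rho f = coeff f (n - 1)"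
  by (simp add: rho_def rem_low)

lemma rho_smult: "rho (smult c f) = c * rho f"
proof -
  have "rem (smult c f) = smult c (rem f)"
    by (rule division_unique[where q = "smult c (quo f)"])
       (use division[of f] low_rem[of f] in \<open>auto simp: low_def smult_add_right[symmetric]\<close>)
  thus ?thesis by (simp add: rho_def)
qed

lemma rho_sum: "rho (sum f A) = (\<Sum>x\<in>A. rho (f x))"
  by (induction A rule: infinite_finite_induct) (simp_all add: rho_add rho_low low_0)

lemma sigma_add: "sigma (f + g) = sigma f + sigma g"
  by (simp add: sigma_def quo_add rho_add)

lemma sigma_uminus: "sigma (- f) = - sigma f"
  by (simp add: sigma_def quo_uminus rho_uminus)

lemma sigma_diff: "sigma (f - g) = sigma f - sigma g"
  using sigma_add[of f "- g"] by (simp add: sigma_uminus)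

lemma sigma_M_mult [simp]: "sigma (M * f) = rho f"
  by (simp add: sigma_def quo_M_mult)

text \<open>Under this degree bound f/M^2 decays at least like x^(-2), so it has no term in
  1/x.\<close>

lemma sigma_eq_0:
  assumes "\<And>l. l \<ge> 2 * n - 1 \<Longrightarrow> coeff f l = 0"
  shows "sigma f = 0"
proof -
  have "coeff (quo f) l = 0" if "l \<ge> n - 1" for l
  proof (rule ccontr)
    assume nz: "coeff (quo f) l \<noteq> 0"
    hence d: "degree (quo f) \<ge> n - 1" using that le_degree[OF nz] by simp
    have "quo f \<noteq> 0" using nz by auto
    hence "coeff (M * quo f) (n + degree (quo f)) \<noteq> 0"
      using coeff_mult_degree_sum[of M "quo f"] by (simp add: degree_M coeff_M_n)
    moreover have "coeff f (n + degree (quo f)) = 0"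
      by (rule assms) (use d n_pos in simp)
    moreover have "coeff (rem f) (n + degree (quo f)) = 0"
      using low_rem by (simp add: low_def)
    ultimately show False by (metis coeff_add division add.right_neutral)
  qed
  hence "low (quo f)" "coeff (quo f) (n - 1) = 0" by (auto simp: low_def)
  thus ?thesis by (simp add: sigma_def rho_low)
qed

lemma sigma_low_mult_low:
  assumes "low f" "low g"
  shows "sigma (f * g) = 0"
proof (rule sigma_eq_0)
  fix l assume l: "l \<ge> 2 * n - 1"
  show "coeff (f * g) l = 0"
  proof -
    have "coeff f i * coeff g (l - i) = 0" for i
    proof (cases "i \<ge> n")
      case False
      hence "l - i \<ge> n" using l by simp
      thus ?thesis using assms by (simp add: low_def)
    qed (use assms in \<open>simp add: low_def\<close>)
    thus ?thesis unfolding coeff_mult by (intro sum.neutral) blast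
  qed
qed

lemma low_pderiv: "low f \<Longrightarrow> low (pderiv f)"
  by (simp add: low_def coeff_pderiv)

lemma rho_pderiv_low: "low f \<Longrightarrow> rho (pderiv f) = 0"
  using n_pos by (simp add: rho_low low_pderiv coeff_pderiv) (simp add: low_def)

text \<open>The residue of the derivative of $f/M$ vanishes.\<close>

lemma sigma_mult_pderiv_M: "sigma (f * pderiv M) = rho (pderiv f)"
proof -
  have 1: "sigma (rem f * pderiv M) = 0"
  proof (rule sigma_low_mult_low[OF low_rem])
    show "low (pderiv M)" using coeff_M_gt by (auto simp: low_def coeff_pderiv)
  qed
  have "sigma (f * pderiv M) = sigma (M * (quo f * pderiv M) + rem f * pderiv M)"
    by (subst division[of f]) (simp add: algebra_simps)
  also have "\<dots> = rho (quo f * pderiv M)" by (simp add: sigma_add 1)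
  also have "\<dots> = rho (quo f * pderiv M + M * pderiv (quo f) + pderiv (rem f))"
    by (simp add: rho_add rho_pderiv_low low_rem)
  also have "quo f * pderiv M + M * pderiv (quo f) + pderiv (rem f) = pderiv f"
    by (subst (4) division[of f]) (simp add: pderiv_add pderiv_mult algebra_simps)
  finally show ?thesis .
qed

lemma rho_mult_quo: "rho (f * (M * q + r)) = rho (f * r)"
  using rho_M_mult[of "f * q"] by (simp add: distrib_left rho_add mult.left_commute)

text \<open>The right side is the 1/x coefficient of (a/M)' (b/M) - (a/M) (b/M)'. Split a/M and b/M
  into polynomial and polar parts: two polynomial parts give a polynomial, two polar parts decay too
  fast, and each mixed pair doubles after integration by parts.\<close>

lemma sigma_wronskian:
  "2 * rho (pderiv (quo a) * b - pderiv (quo b) * a) = sigma (pderiv a * b - a * pderiv b)"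
proof -
  define qa ra qb rb where defs: "qa = quo a" "ra = rem a" "qb = quo b" "rb = rem b"
  have a: "a = M * qa + ra" and b: "b = M * qb + rb" unfolding defs by (rule division)+
  have low: "low ra" "low rb" unfolding defs by (rule low_rem)+
  \<comment> \<open>Integration by parts for a polynomial part q and a polar part r/M: the residue
    of (q r/M)' is 0.\<close>
  have mixed: "sigma (pderiv M * (q * r)) + rho (pderiv q * r - q * pderiv r) = 2 * rho (pderiv q * r)" for q r
    using sigma_mult_pderiv_M[of "q * r"]
    by (simp add: rho_diff rho_add pderiv_mult mult.commute)
  have "pderiv a * b - a * pderiv b =
      M * (M * (pderiv qa * qb - qa * pderiv qb))
      + (pderiv M * (qa * rb) + M * (pderiv qa * rb - qa * pderiv rb))
      - (pderiv M * (qb * ra) + M * (pderiv qb * ra - qb * pderiv ra))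
      + (pderiv ra * rb - ra * pderiv rb)"
    unfolding a b by (simp add: pderiv_add pderiv_mult algebra_simps)
  hence "sigma (pderiv a * b - a * pderiv b) = 2 * rho (pderiv qa * rb) - 2 * rho (pderiv qb * ra)
      + sigma (pderiv ra * rb - ra * pderiv rb)"
    by (simp only: sigma_add sigma_diff mixed sigma_M_mult rho_M_mult add_0)
  also have "sigma (pderiv ra * rb - ra * pderiv rb) = 0"
    using low by (simp add: sigma_diff sigma_low_mult_low low_pderiv)
  also have "rho (pderiv qa * rb) = rho (pderiv qa * b)"
    unfolding b by (rule rho_mult_quo[symmetric])
  also have "rho (pderiv qb * ra) = rho (pderiv qb * a)"
    unfolding a by (rule rho_mult_quo[symmetric])
  finally show ?thesis unfolding defs by (simp add: rho_diff right_diff_distrib)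
qed

end

text \<open>The quotient rule for f/N, read in the coefficient of 1/x. As N is monic, its leading
  coefficient is constant and \<open>pdp k N\<close> has degree below n.\<close>

lemma pd_rho:
  fixes N :: "'b::idom pseries poly"
  assumes "monic_poly N n"
  shows "pd k (monic_poly.rho N n f) = monic_poly.rho N n (pdp k f) - monic_poly.sigma N n (f * pdp k N)"
proof -
  interpret N: monic_poly N n by (rule assms)
  have 1: "N.sigma (N.rem f * pdp k N) = 0"
  proof (rule N.sigma_low_mult_low[OF N.low_rem])
    show "N.low (pdp k N)" using N.coeff_M_gt N.coeff_M_n by (auto simp: N.low_def le_less)
  qed
  have "f * pdp k N = N * (N.quo f * pdp k N) + N.rem f * pdp k N"
    by (subst N.division[of f]) (simp add: algebra_simps)
  hence "N.sigma (f * pdp k N) = N.rho (N.quo f * pdp k N)" by (simp add: N.sigma_add 1)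
  moreover have "N.rho (pdp k f) = N.rho (N.quo f * pdp k N) + pd k (N.rho f)"
  proof -
    have "pdp k f = N.quo f * pdp k N + N * pdp k (N.quo f) + pdp k (N.rem f)"
      by (subst N.division[of f]) (simp add: pdp_add pdp_mult mult.commute)
    moreover have "N.low (pdp k (N.rem f))" using N.low_rem[of f] by (auto simp: N.low_def)
    ultimately show ?thesis by (simp add: N.rho_add N.rho_low) (simp add: N.rho_def)
  qed
  ultimately show ?thesis by simp
qed

section \<open>Existence of the potential of type A\<close>

definition flat_s :: "nat \<Rightarrow> nat \<Rightarrow> complex pseries" where
  "flat_s n j = (if 1 \<le> j \<and> j \<le> n then svar (n + 1 - j) else 0)"

lemma pd_flat_s: "k \<in> {1..n} \<Longrightarrow> pd k (flat_s n j) = (if j = n + 1 - k then 1 else 0)"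
  by (auto simp: flat_s_def pd_svar)

lemma rat_poly_flat_s: "rat_poly n (flat_s n j)"
  by (auto simp: flat_s_def rat_poly_0 intro!: rat_poly_svar)

lemma rat_poly_coeff_phi: "rat_poly n (coeff (phi (flat_s n) a) l)"
proof (induction a arbitrary: l rule: less_induct)
  case (less a)
  show ?case
  proof (cases "a \<le> 1")
    case True
    then show ?thesis by (cases a) (auto simp: rat_poly_0 rat_poly_1 coeff_1)
  next
    case False
    then obtain b where "a = Suc b" "b \<ge> 1" by (cases a) auto
    then show ?thesis
      using less.IH
      by (auto simp: phi_Suc coeff_pCons coeff_sum rat_poly_0 split: nat.split
          intro!: rat_poly_add rat_poly_sum rat_poly_mult rat_poly_flat_s)
  qed
qed

lemma rat_poly_coeff_mult:
  "(\<And>l. rat_poly n (coeff p l)) \<Longrightarrow> (\<And>l. rat_poly n (coeff q l)) \<Longrightarrow> rat_poly n (coeff (p * q) l)"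
  by (auto simp: coeff_mult intro!: rat_poly_sum rat_poly_mult)

locale flat =
  fixes n :: nat
  assumes n1: "n \<ge> 1"

text \<open>This divisor is \<lambda>' written in flat coordinates, as \<open>evp_M\<close> confirms
  point by point.\<close>

sublocale flat \<subseteq> monic_poly "phi (flat_s n) (Suc n)" n
proof
  show "n \<ge> 1" by (rule n1)
  show "coeff (phi (flat_s n) (Suc n)) n = 1" using coeff_phi_top[of "Suc n"] by simp
  show "coeff (phi (flat_s n) (Suc n)) l = 0" if "n < l" for l
    using that by (intro coeff_phi_eq_0) simp
qed

section \<open>Three-point functions as residues and their integrability\<close>

context flat begin

abbreviation ph :: "nat \<Rightarrow> complex pseries poly" where "ph \<equiv> phi (flat_s n)"

text \<open>The coefficient of 1/x in phi_a phi_b phi_c / \<lambda>'. \<open>frob_eta_flat\<close>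
  matches this residue formula with the product and pairing of the Jacobian ring.\<close>

definition corr :: "nat \<Rightarrow> nat \<Rightarrow> nat \<Rightarrow> complex pseries" where
  "corr a b c = rho (ph a * ph b * ph c)"

lemma corr_commute: "corr a b c = corr b a c" "corr a b c = corr a c b"
  by (simp_all add: corr_def mult_ac)

lemma pdp_ph:
  assumes "k \<in> {1..n}"
  shows "pdp k (ph a) = pderiv (ph (a + k - (n + 1)))"
proof -
  have "pdp k (ph a) = pderiv (ph (a - (n + 1 - k)))"
    by (rule pdp_phi) (use assms in \<open>auto simp: pd_flat_s\<close>)
  thus ?thesis using assms by simp
qed

text \<open>The pairs (a, b) and (n + 1, a + b - n - 1) have the same index sum, so their products
  agree from degree n on. If a + b <= n + 1, the product already has degree below n and the
  truncated index is 0.\<close>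

lemma division_ph_mult:
  assumes "a \<in> {1..n}" "b \<in> {1..n}"
  shows "quo (ph a * ph b) = ph (a + b - (n + 1))"
proof (rule division_unique)
  show "ph a * ph b = ph (Suc n) * ph (a + b - (n + 1)) + (ph a * ph b - ph (Suc n) * ph (a + b - (n + 1)))"
    by simp
  show "low (ph a * ph b - ph (Suc n) * ph (a + b - (n + 1)))"
  proof (cases "a + b \<le> n + 1")
    case True
    thus ?thesis by (auto simp: low_def intro!: coeff_phi_mult_eq_0)
  next
    case False
    hence "coeff (ph a * ph b) l = coeff (ph (Suc n) * ph (a + b - (n + 1))) l" if "l \<ge> n" for l
      by (intro phi_mult_cong[where m = "Suc n"]) (use assms that in auto)
    thus ?thesis by (simp add: low_def)
  qed
qed

text \<open>Flatness of the pairing. For a + b > n + 1 the agreement of \<open>phi_mult_cong\<close>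
  reaches down to degree n - 1, one degree further than the quotient requires, and this kills
  \<open>rho\<close>. On the antidiagonal the product is monic of degree n - 1.\<close>

lemma rho_ph_mult:
  assumes "a \<in> {1..n}" "b \<in> {1..n + 1}"
  shows "rho (ph b * ph a) = (if a + b = n + 1 then 1 else 0)"
proof (cases "a + b \<le> n + 1")
  case True
  hence low: "low (ph b * ph a)" by (auto simp: low_def intro!: coeff_phi_mult_eq_0)
  show ?thesis
  proof (cases "a + b = n + 1")
    case True
    have "b + a - 2 = n - 1" using True assms by auto
    thus ?thesis using coeff_phi_mult_top[of b a "flat_s n"] assms True by (simp add: rho_low[OF low])
  next
    case False
    thus ?thesis using True by (simp add: rho_low[OF low] coeff_phi_mult_eq_0)
  qed
next
  case False
  let ?d = "ph b * ph a - ph (Suc n) * ph (a + b - (n + 1))"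
  have eq: "coeff (ph b * ph a) l = coeff (ph (Suc n) * ph (a + b - (n + 1))) l" if "l + 1 \<ge> n" for l
    by (rule phi_mult_cong[where m = "Suc n"]) (use assms that False in auto)
  have "low ?d" "coeff ?d (n - 1) = 0" using eq by (auto simp: low_def)
  hence "rho ?d = 0" by (simp add: rho_low)
  thus ?thesis using False by (simp add: rho_diff)
qed

text \<open>By \<open>pd_rho\<close> each side is a \<open>rho\<close> of derivatives of quotients
  minus a \<open>sigma\<close>. In the difference the \<gamma>, \<delta> quotient cancels and the
  other four pair up into two instances of \<open>sigma_wronskian\<close>, which balance the
  \<open>sigma\<close> terms. Only twice the difference is computed, and 2 is cancelled at the
  end.\<close>

lemma pd_corr_commute:
  assumes "\<alpha> \<in> {1..n}" "\<beta> \<in> {1..n}" "\<gamma> \<in> {1..n}" "\<delta> \<in> {1..n}"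
  shows "pd \<delta> (corr \<alpha> \<beta> \<gamma>) = pd \<gamma> (corr \<alpha> \<beta> \<delta>)"
proof -
  let ?q = "\<lambda>a b. ph (a + b - (n + 1))"
  let ?W = "\<lambda>a b. pderiv a * b - a * pderiv b :: complex pseries poly"
  have pdM: "pdp k (ph (Suc n)) = pderiv (ph k)" if "k \<in> {1..n}" for k
    using pdp_ph[OF that, of "Suc n"] by simp
  have pdc: "pd d (corr a b c) =
      rho (pderiv (?q a d) * (ph b * ph c) + pderiv (?q b d) * (ph a * ph c) + pderiv (?q c d) * (ph a * ph b))
      - sigma (ph a * ph b * ph c * pderiv (ph d))"
    if "d \<in> {1..n}" for a b c d
  proof -
    have "pdp d (ph a * ph b * ph c) =
        pderiv (?q a d) * (ph b * ph c) + pderiv (?q b d) * (ph a * ph c) + pderiv (?q c d) * (ph a * ph b)"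
      by (simp add: pdp_mult pdp_ph[OF that] algebra_simps)
    thus ?thesis unfolding corr_def by (subst pd_rho[OF monic_poly_axioms]) (simp add: pdM[OF that])
  qed
  have wr: "2 * rho (pderiv (?q a b) * (ph c * ph d) - pderiv (?q c d) * (ph a * ph b)) =
      sigma (?W (ph a * ph b) (ph c * ph d))"
    if "a \<in> {1..n}" "b \<in> {1..n}" "c \<in> {1..n}" "d \<in> {1..n}" for a b c d
    using sigma_wronskian[of "ph a * ph b" "ph c * ph d"] that by (simp only: division_ph_mult)
  \<comment> \<open>The two Wronskians differ by exactly twice the \<open>sigma\<close> argument:
    terms with a derivative on \<alpha> or \<beta> cancel.\<close>
  have W: "?W (ph \<alpha> * ph \<delta>) (ph \<beta> * ph \<gamma>) - ?W (ph \<alpha> * ph \<gamma>) (ph \<beta> * ph \<delta>)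
      = (ph \<alpha> * ph \<beta> * ph \<gamma> * pderiv (ph \<delta>) - ph \<alpha> * ph \<beta> * ph \<delta> * pderiv (ph \<gamma>))
      + (ph \<alpha> * ph \<beta> * ph \<gamma> * pderiv (ph \<delta>) - ph \<alpha> * ph \<beta> * ph \<delta> * pderiv (ph \<gamma>))"
    by (simp add: pderiv_mult algebra_simps)
  have "pd \<delta> (corr \<alpha> \<beta> \<gamma>) - pd \<gamma> (corr \<alpha> \<beta> \<delta>) =
      rho (pderiv (?q \<alpha> \<delta>) * (ph \<beta> * ph \<gamma>) - pderiv (?q \<beta> \<gamma>) * (ph \<alpha> * ph \<delta>))
      - rho (pderiv (?q \<alpha> \<gamma>) * (ph \<beta> * ph \<delta>) - pderiv (?q \<beta> \<delta>) * (ph \<alpha> * ph \<gamma>))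
      - sigma (ph \<alpha> * ph \<beta> * ph \<gamma> * pderiv (ph \<delta>) - ph \<alpha> * ph \<beta> * ph \<delta> * pderiv (ph \<gamma>))"
    unfolding pdc[OF assms(4)] pdc[OF assms(3)] add.commute[of \<gamma> \<delta>]
    by (simp only: rho_add rho_diff sigma_diff) simp
  hence "2 * (pd \<delta> (corr \<alpha> \<beta> \<gamma>) - pd \<gamma> (corr \<alpha> \<beta> \<delta>)) =
      2 * rho (pderiv (?q \<alpha> \<delta>) * (ph \<beta> * ph \<gamma>) - pderiv (?q \<beta> \<gamma>) * (ph \<alpha> * ph \<delta>))
      - 2 * rho (pderiv (?q \<alpha> \<gamma>) * (ph \<beta> * ph \<delta>) - pderiv (?q \<beta> \<delta>) * (ph \<alpha> * ph \<gamma>))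
      - 2 * sigma (ph \<alpha> * ph \<beta> * ph \<gamma> * pderiv (ph \<delta>) - ph \<alpha> * ph \<beta> * ph \<delta> * pderiv (ph \<gamma>))"
    by (simp only: right_diff_distrib)
  also have "\<dots> = sigma (?W (ph \<alpha> * ph \<delta>) (ph \<beta> * ph \<gamma>) - ?W (ph \<alpha> * ph \<gamma>) (ph \<beta> * ph \<delta>))
      - 2 * sigma (ph \<alpha> * ph \<beta> * ph \<gamma> * pderiv (ph \<delta>) - ph \<alpha> * ph \<beta> * ph \<delta> * pderiv (ph \<gamma>))"
    unfolding wr[OF assms(1,4,2,3)] wr[OF assms(1,3,2,4)] by (simp only: sigma_diff)
  also have "\<dots> = 0"
    unfolding W by (simp only: sigma_add mult_2) simp
  finally have "of_nat 2 * (pd \<delta> (corr \<alpha> \<beta> \<gamma>) - pd \<gamma> (corr \<alpha> \<beta> \<delta>)) = 0" by simp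
  from of_nat_mult_pseries_eq_0[OF this] show ?thesis by simp
qed

lemma rat_poly_rem:
  assumes "\<And>l. rat_poly n (coeff f l)"
  shows "rat_poly n (coeff (rem f) l)" "rat_poly n (coeff (quo f) l)"
proof -
  have "\<exists>q r. f = ph (Suc n) * q + r \<and> (\<forall>l. rat_poly n (coeff q l)) \<and> (\<forall>l. rat_poly n (coeff r l)) \<and>
      (\<forall>l\<ge>n. coeff r l = 0)"
    by (intro monic_division_exists coeff_M_n coeff_M_gt rat_poly_coeff_phi rat_poly_add rat_poly_diff
        rat_poly_mult rat_poly_0 assms)
  then obtain q r where qr: "f = ph (Suc n) * q + r" "\<forall>l. rat_poly n (coeff q l)" "\<forall>l. rat_poly n (coeff r l)"
      "\<forall>l\<ge>n. coeff r l = 0"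
    by blast
  have "low r" using qr by (simp add: low_def)
  thus "rat_poly n (coeff (rem f) l)" "rat_poly n (coeff (quo f) l)"
    using division_unique[OF qr(1)] qr by auto
qed

lemma rat_poly_corr: "rat_poly n (corr a b c)"
  unfolding corr_def rho_def by (intro rat_poly_rem rat_poly_coeff_mult rat_poly_coeff_phi)

end

lemma series_eq_of_pd_eq:
  fixes H H' :: "complex pseries"
  assumes "series_in V H" "series_in V H'" "mcoeff H 0 = mcoeff H' 0" "\<And>k. k \<in> V \<Longrightarrow> pd k H = pd k H'"
  shows "H = H'"
proof (rule pseries_eqI)
  fix m
  show "mcoeff H m = mcoeff H' m"
  proof (cases "m = 0 \<or> \<not> Poly_Mapping.keys m \<subseteq> V")
    case True
    then show ?thesis using assms(3) series_inD[OF assms(1)] series_inD[OF assms(2)] by metis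
  next
    case False
    hence "Poly_Mapping.keys m \<noteq> {}" "Poly_Mapping.keys m \<subseteq> V" by simp_all
    then obtain k where k: "k \<in> Poly_Mapping.keys m" "k \<in> V" by blast
    define m' where "m' = m - Poly_Mapping.single k 1"
    have m: "m = m' + Poly_Mapping.single k 1"
      using single_add_minus[of m k] k by (simp add: m'_def in_keys_iff add.commute)
    have "mcoeff (pd k H) m' = mcoeff (pd k H') m'" using assms(4) k by simp
    hence "of_nat (Poly_Mapping.lookup m' k + 1) * mcoeff H m = of_nat (Poly_Mapping.lookup m' k + 1) * mcoeff H' m"
      unfolding mcoeff_pd m .
    thus ?thesis by (simp only: mult_cancel_left of_nat_eq_0_iff) simp
  qed
qed

lemma low_degree_of_pd:
  fixes H :: "complex pseries"
  assumes "series_in V H" "mcoeff H 0 = 0" "\<And>k m. k \<in> V \<Longrightarrow> total_degree m < d \<Longrightarrow> mcoeff (pd k H) m = 0"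
    "total_degree m < Suc d"
  shows "mcoeff H m = 0"
proof (cases "m = 0 \<or> \<not> Poly_Mapping.keys m \<subseteq> V")
  case True
  then show ?thesis using assms(2) series_inD[OF assms(1)] by metis
next
  case False
  hence "Poly_Mapping.keys m \<noteq> {}" "Poly_Mapping.keys m \<subseteq> V" by simp_all
  then obtain k where k: "k \<in> Poly_Mapping.keys m" "k \<in> V" by blast
  define m' where "m' = m - Poly_Mapping.single k 1"
  have m: "m = m' + Poly_Mapping.single k 1"
    using single_add_minus[of m k] k by (simp add: m'_def in_keys_iff add.commute)
  have "total_degree (Poly_Mapping.single k (1::nat)) = 1"
    by (simp add: total_degree_def)
  hence "total_degree m' < d" using assms(4) unfolding m total_degree_add by simp
  hence "mcoeff (pd k H) m' = 0" using assms(3) k by simp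
  hence "of_nat (Poly_Mapping.lookup m' k + 1) * mcoeff H m = 0"
    unfolding mcoeff_pd m .
  thus ?thesis by (simp only: mult_eq_0_iff of_nat_eq_0_iff) simp
qed

context flat begin

text \<open>Three integrations, the symmetry of \<open>corr\<close> supplying closedness each time.
  All constants of integration are 0, which removes the terms of degree at most 2.\<close>

lemma potential_exists:
  "\<exists>F. rat_poly n F \<and> (\<forall>m. total_degree m \<le> 2 \<longrightarrow> mcoeff F m = 0) \<and>
     (\<forall>\<alpha>\<in>{1..n}. \<forall>\<beta>\<in>{1..n}. \<forall>\<gamma>\<in>{1..n}. pd \<alpha> (pd \<beta> (pd \<gamma> F)) = corr \<alpha> \<beta> \<gamma>)"
proof -
  let ?pot = "\<lambda>G H. rat_poly n H \<and> mcoeff H 0 = 0 \<and> (\<forall>\<alpha>\<in>{1..n}. pd \<alpha> H = G \<alpha>)"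
  have "\<exists>H. ?pot (\<lambda>\<alpha>. corr \<alpha> \<beta> \<gamma>) H" if "\<beta> \<in> {1..n}" "\<gamma> \<in> {1..n}" for \<beta> \<gamma>
  proof (rule closed_form_potential)
    fix \<alpha> \<delta> assume "\<alpha> \<in> {1..n}" "\<delta> \<in> {1..n}"
    thus "pd \<delta> (corr \<alpha> \<beta> \<gamma>) = pd \<alpha> (corr \<delta> \<beta> \<gamma>)"
      using pd_corr_commute[of \<beta> \<gamma> \<alpha> \<delta>] that by (metis corr_commute)
  qed (rule rat_poly_corr)
  then obtain P where P: "?pot (\<lambda>\<alpha>. corr \<alpha> \<beta> \<gamma>) (P \<beta> \<gamma>)" if "\<beta> \<in> {1..n}" "\<gamma> \<in> {1..n}" for \<beta> \<gamma>
    by metis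
  \<comment> \<open>Both sides have the same derivatives and the constant term 0; this symmetry is
    the closedness required by the last integration.\<close>
  have P_sym: "P \<beta> \<gamma> = P \<gamma> \<beta>" if "\<beta> \<in> {1..n}" "\<gamma> \<in> {1..n}" for \<beta> \<gamma>
  proof (rule series_eq_of_pd_eq[of "{1..n}"])
    show "series_in {1..n} (P \<beta> \<gamma>)" "series_in {1..n} (P \<gamma> \<beta>)" "mcoeff (P \<beta> \<gamma>) 0 = mcoeff (P \<gamma> \<beta>) 0"
      using P[OF that] P[OF that(2,1)] unfolding rat_poly_def by simp_all
    fix k assume "k \<in> {1..n}"
    thus "pd k (P \<beta> \<gamma>) = pd k (P \<gamma> \<beta>)"
      using P[OF that] P[OF that(2,1)] corr_commute(2)[of k \<beta> \<gamma>] by metis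
  qed
  have "\<exists>H. ?pot (\<lambda>\<beta>. P \<beta> \<gamma>) H" if "\<gamma> \<in> {1..n}" for \<gamma>
  proof (rule closed_form_potential)
    fix \<alpha> \<beta> assume "\<alpha> \<in> {1..n}" "\<beta> \<in> {1..n}"
    thus "pd \<beta> (P \<alpha> \<gamma>) = pd \<alpha> (P \<beta> \<gamma>)" using P that corr_commute(1)[of \<alpha> \<beta> \<gamma>] by simp
  qed (use P that in blast)
  then obtain Q where Q: "?pot (\<lambda>\<beta>. P \<beta> \<gamma>) (Q \<gamma>)" if "\<gamma> \<in> {1..n}" for \<gamma>
    by metis
  have "\<exists>H. ?pot Q H"
  proof (rule closed_form_potential)
    fix \<alpha> \<beta> assume "\<alpha> \<in> {1..n}" "\<beta> \<in> {1..n}"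
    thus "pd \<beta> (Q \<alpha>) = pd \<alpha> (Q \<beta>)" using Q P_sym by simp
  qed (use Q in blast)
  then obtain F where F: "?pot Q F" by blast
  have "mcoeff (P \<beta> \<gamma>) m = 0" if "\<beta> \<in> {1..n}" "\<gamma> \<in> {1..n}" "total_degree m < Suc 0" for \<beta> \<gamma> m
    by (rule low_degree_of_pd[of "{1..n}" _ 0]) (use P that in \<open>auto simp: rat_poly_def\<close>)
  hence "mcoeff (Q \<gamma>) m = 0" if "\<gamma> \<in> {1..n}" "total_degree m < Suc (Suc 0)" for \<gamma> m
    by (intro low_degree_of_pd[of "{1..n}" "Q \<gamma>" "Suc 0" m]) (use Q that in \<open>auto simp: rat_poly_def\<close>)
  hence "mcoeff F m = 0" if "total_degree m < Suc (Suc (Suc 0))" for m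
    by (intro low_degree_of_pd[of "{1..n}" F "Suc (Suc 0)" m]) (use F that in \<open>auto simp: rat_poly_def\<close>)
  hence "\<forall>m. total_degree m \<le> 2 \<longrightarrow> mcoeff F m = 0" by (simp add: le_eq_less_or_eq less_Suc_eq numeral_2_eq_2)
  moreover have "pd \<alpha> (pd \<beta> (pd \<gamma> F)) = corr \<alpha> \<beta> \<gamma>" if "\<alpha> \<in> {1..n}" "\<beta> \<in> {1..n}" "\<gamma> \<in> {1..n}" for \<alpha> \<beta> \<gamma>
    using that P Q F by simp
  ultimately show ?thesis using F by blast
qed

lemma potential_unique:
  fixes F F' :: "complex pseries"
  assumes "series_in {1..n} F" "series_in {1..n} F'"
    and low: "\<And>m. total_degree m \<le> 2 \<Longrightarrow> mcoeff F m = 0" "\<And>m. total_degree m \<le> 2 \<Longrightarrow> mcoeff F' m = 0"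
    and eq: "\<And>\<alpha> \<beta> \<gamma>. \<alpha> \<in> {1..n} \<Longrightarrow> \<beta> \<in> {1..n} \<Longrightarrow> \<gamma> \<in> {1..n} \<Longrightarrow> pd \<alpha> (pd \<beta> (pd \<gamma> F)) = pd \<alpha> (pd \<beta> (pd \<gamma> F'))"
  shows "F = F'"
proof -
  have td: "total_degree (Poly_Mapping.single k 1) = 1" for k
    by (simp add: total_degree_def)
  have z: "total_degree 0 = 0" by (simp add: total_degree_def)
  have 1: "mcoeff (pd k H) 0 = 0" "mcoeff (pd j (pd k H)) 0 = 0"
    if "\<And>m. total_degree m \<le> 2 \<Longrightarrow> mcoeff H m = 0" for H :: "complex pseries" and j k
    using that[of "Poly_Mapping.single k 1"] that[of "Poly_Mapping.single j 1 + Poly_Mapping.single k 1"]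
      td[of j] td[of k] by (simp_all add: mcoeff_pd total_degree_add)
  have 2: "pd \<beta> (pd \<gamma> F) = pd \<beta> (pd \<gamma> F')" if "\<beta> \<in> {1..n}" "\<gamma> \<in> {1..n}" for \<beta> \<gamma>
  proof (rule series_eq_of_pd_eq)
    show "mcoeff (pd \<beta> (pd \<gamma> F)) 0 = mcoeff (pd \<beta> (pd \<gamma> F')) 0"
      using 1(2)[of F] 1(2)[of F'] low by simp
  qed (use assms(1,2) eq[OF _ that] in \<open>blast intro: series_in_pd\<close>)+
  have 3: "pd \<gamma> F = pd \<gamma> F'" if "\<gamma> \<in> {1..n}" for \<gamma>
  proof (rule series_eq_of_pd_eq)
    show "mcoeff (pd \<gamma> F) 0 = mcoeff (pd \<gamma> F') 0"
      using 1(1)[of F] 1(1)[of F'] low by simp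
  qed (use assms(1,2) 2[OF _ that] in \<open>blast intro: series_in_pd\<close>)+
  show ?thesis
    by (rule series_eq_of_pd_eq[OF assms(1,2) _ 3]) (simp_all add: low z)
qed

end

section \<open>The explicit flat coordinates\<close>

definition wt :: "nat \<Rightarrow> (nat \<Rightarrow>\<^sub>0 nat) \<Rightarrow> nat" where
  "wt n m = (\<Sum>k=1..n. (n + 2 - k) * Poly_Mapping.lookup m k)"

definition fact_prod :: "nat \<Rightarrow> (nat \<Rightarrow>\<^sub>0 nat) \<Rightarrow> complex" where
  "fact_prod n m = (\<Prod>k=1..n. fact (Poly_Mapping.lookup m k))"

lemma wt_add_single: "k \<in> {1..n} \<Longrightarrow> wt n (m + Poly_Mapping.single k 1) = wt n m + (n + 2 - k)"
proof -
  assume k: "k \<in> {1..n}"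
  have "(\<Sum>j=1..n. (n + 2 - j) * Poly_Mapping.lookup (Poly_Mapping.single k 1) j) =
      (\<Sum>j=1..n. if k = j then n + 2 - j else 0)"
    by (rule sum.cong) (auto simp: lookup_single)
  also have "\<dots> = n + 2 - k" using k by simp
  finally show ?thesis by (simp only: wt_def lookup_add distrib_left sum.distrib)
qed

lemma fact_prod_add_single:
  assumes "k \<in> {1..n}"
  shows "fact_prod n (m + Poly_Mapping.single k 1) = of_nat (Poly_Mapping.lookup m k + 1) * fact_prod n m"
proof -
  have "(\<Prod>j\<in>{1..n} - {k}. fact (Poly_Mapping.lookup (m + Poly_Mapping.single k 1) j)) =
      (\<Prod>j\<in>{1..n} - {k}. fact (Poly_Mapping.lookup m j) :: complex)"
    by (rule prod.cong) (auto simp: lookup_add lookup_single)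
  thus ?thesis unfolding fact_prod_def prod.remove[OF finite_atLeastAtMost assms]
    by (simp add: lookup_add)
qed

lemma wt_eq_0: "Poly_Mapping.keys m \<subseteq> {1..n} \<Longrightarrow> wt n m = 0 \<longleftrightarrow> m = 0"
proof
  assume "Poly_Mapping.keys m \<subseteq> {1..n}" "wt n m = 0"
  hence "Poly_Mapping.lookup m k = 0" for k
    by (cases "k \<in> {1..n}") (auto simp: wt_def in_keys_iff)
  thus "m = 0" by (simp add: poly_mapping_eq_iff fun_eq_iff)
qed (simp add: wt_def)

text \<open>The multinomial coefficient counting words with c letters x and m_k letters t_k.\<close>

definition multinom :: "nat \<Rightarrow> nat \<Rightarrow> (nat \<Rightarrow>\<^sub>0 nat) \<Rightarrow> complex" where
  "multinom n c m = fact (total_degree m + c) / (fact c * fact_prod n m)"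

text \<open>Classify the words by their last letter, which is x or some t_k.\<close>

lemma multinom_pascal:
  assumes m: "Poly_Mapping.keys m \<subseteq> {1..n}" and "total_degree m + c \<noteq> 0"
  shows "multinom n c m = (if c = 0 then 0 else multinom n (c - 1) m) +
    (\<Sum>k=1..n. if Poly_Mapping.lookup m k = 0 then 0 else multinom n c (m - Poly_Mapping.single k 1))"
proof -
  obtain S where S: "total_degree m + c = Suc S" using assms(2) not0_implies_Suc by blast
  define D where "D = fact S / (fact c * fact_prod n m)"
  have 1: "(if c = 0 then 0 else multinom n (c - 1) m) = of_nat c * D"
  proof (cases c)
    case (Suc c')
    hence "total_degree m + c' = S" using S by simp
    thus ?thesis using Suc by (simp add: multinom_def D_def field_simps del: of_nat_Suc)
  qed simp
  have 2: "(if Poly_Mapping.lookup m k = 0 then 0 else multinom n c (m - Poly_Mapping.single k 1)) =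
      of_nat (Poly_Mapping.lookup m k) * D" if "k \<in> {1..n}" for k
  proof (cases "Poly_Mapping.lookup m k = 0")
    case False
    define m' where "m' = m - Poly_Mapping.single k 1"
    have mm: "m = m' + Poly_Mapping.single k 1"
      using single_add_minus[OF False] by (simp add: m'_def add.commute)
    have "total_degree (Poly_Mapping.single k (1::nat)) = 1" by (simp add: total_degree_def)
    hence "total_degree m' + c = S" using S unfolding mm total_degree_add by simp
    moreover have "fact_prod n m = of_nat (Poly_Mapping.lookup m k) * fact_prod n m'"
      using fact_prod_add_single[OF that, of m'] by (simp add: mm lookup_add)
    ultimately show ?thesis using False
      unfolding m'_def[symmetric] by (simp add: multinom_def D_def)
  qed simp
  have "multinom n c m = of_nat (Suc S) * D"
    by (simp add: multinom_def D_def S)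
  also have "of_nat (Suc S) = (of_nat c + (\<Sum>k=1..n. of_nat (Poly_Mapping.lookup m k)) :: complex)"
    using S[symmetric] total_degree_superset[OF _ m] by (simp del: of_nat_Suc)
  finally show ?thesis using 2 unfolding 1
    by (simp add: distrib_right sum_distrib_right)
qed

text \<open>Expand 1/(z - (x + sum_j s_j z^(-j))) as a geometric series: each x costs one power of
  1/z, each t_k = s_{n+1-k} costs n + 2 - k, and one more power comes from the prefactor. The
  induction matches the recursion of \<open>phi\<close> with Pascal's rule.\<close>

lemma mcoeff_coeff_phi:
  "mcoeff (coeff (phi (flat_s n) \<alpha>) c) m =
    (if Poly_Mapping.keys m \<subseteq> {1..n} \<and> wt n m + c + 1 = \<alpha> then multinom n c m else 0)"
proof (induction \<alpha> arbitrary: c m rule: less_induct)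
  case (less \<alpha>)
  show ?case
  proof (cases "\<alpha> \<le> 1")
    case True
    have "multinom n 0 0 = 1" by (simp add: multinom_def total_degree_def fact_prod_def)
    thus ?thesis using True wt_eq_0[of m n] wt_eq_0[of 0 n]
      by (cases \<alpha>) (auto simp: coeff_1 mcoeff_1)
  next
    case False
    then obtain b where b: "\<alpha> = Suc b" "b \<ge> 1" by (cases \<alpha>) auto
    define T where "T j = mcoeff (flat_s n j * coeff (phi (flat_s n) (b - j)) c) m" for j
    define P where "P \<longleftrightarrow> Poly_Mapping.keys m \<subseteq> {1..n} \<and> wt n m + c + 1 = \<alpha>"
    have L: "mcoeff (coeff (phi (flat_s n) \<alpha>) c) m =
        (if c = 0 then 0 else mcoeff (coeff (phi (flat_s n) b) (c - 1)) m) + (\<Sum>j=1..b. T j)"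
      using b by (auto simp: phi_Suc coeff_pCons coeff_sum mcoeff_sum T_def split: nat.split)
    have first: "(if c = 0 then 0 else mcoeff (coeff (phi (flat_s n) b) (c - 1)) m) =
        (if c = 0 \<or> \<not> P then 0 else multinom n (c - 1) m)"
      using less.IH[of b "c - 1" m] b by (auto simp: P_def)
    have T: "T j = (if Poly_Mapping.lookup m (n + 1 - j) = 0 \<or> \<not> P then 0
        else multinom n c (m - Poly_Mapping.single (n + 1 - j) 1))" if j: "j \<in> {1..n}" for j
    proof (cases "Poly_Mapping.lookup m (n + 1 - j) = 0")
      case True
      thus ?thesis using j by (simp add: T_def flat_s_def mcoeff_svar_mult)
    next
      case nz: False
      define k where "k = n + 1 - j"
      have k: "k \<in> {1..n}" "n + 2 - k = j + 1" using j by (auto simp: k_def)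
      define m' where "m' = m - Poly_Mapping.single k 1"
      have mm: "m = m' + Poly_Mapping.single k 1"
        using single_add_minus[of m k] nz by (simp add: m'_def k_def add.commute)
      have "Poly_Mapping.keys m \<subseteq> {1..n} \<longleftrightarrow> Poly_Mapping.keys m' \<subseteq> {1..n}"
        using k unfolding mm keys_add_nat by auto
      moreover have "wt n m = wt n m' + (j + 1)" unfolding mm wt_add_single[OF k(1)] k(2) by simp
      ultimately have "P \<longleftrightarrow> Poly_Mapping.keys m' \<subseteq> {1..n} \<and> wt n m' + c + 1 = b - j"
        using b by (auto simp: P_def)
      moreover have "T j = mcoeff (coeff (phi (flat_s n) (b - j)) c) m'"
        using j nz by (simp add: T_def flat_s_def mcoeff_svar_mult m'_def k_def)
      ultimately show ?thesis using less.IH[of "b - j" c m'] b nz by (simp add: m'_def k_def)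
    qed
    have sum_T: "(\<Sum>j=1..b. T j) = (\<Sum>j=1..n. T j)"
    proof (rule sum.mono_neutral_cong)
      fix j assume "j \<in> {1..n} - {1..b}"
      hence "b - j = 0" by auto
      thus "T j = 0" by (simp add: T_def)
    next
      fix j assume "j \<in> {1..b} - {1..n}"
      thus "T j = 0" by (auto simp: T_def flat_s_def)
    qed auto
    also have "\<dots> = (\<Sum>k=1..n. if Poly_Mapping.lookup m k = 0 \<or> \<not> P then 0
        else multinom n c (m - Poly_Mapping.single k 1))"
      by (rule sum.reindex_bij_witness[where i = "\<lambda>k. n + 1 - k" and j = "\<lambda>k. n + 1 - k"]) (auto simp: T)
    finally have second: "(\<Sum>j=1..b. T j) = (\<Sum>k=1..n. if Poly_Mapping.lookup m k = 0 \<or> \<not> P then 0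
        else multinom n c (m - Poly_Mapping.single k 1))" .
    show ?thesis
    proof (cases P)
      case True
      have "total_degree m + c \<noteq> 0"
      proof
        assume "total_degree m + c = 0"
        hence "m = 0" "c = 0" using lookup_le_total_degree[of m]
          by (auto simp: poly_mapping_eq_iff fun_eq_iff)
        thus False using True b by (auto simp: P_def wt_def)
      qed
      thus ?thesis using multinom_pascal[of m n c] True
        unfolding L first second by (simp add: P_def)
    next
      case False
      thus ?thesis unfolding L first second by (auto simp: P_def)
    qed
  qed
qed

lemma finite_v_exponents:
  assumes "\<gamma> \<in> {1..n}"
  shows "finite (v_exponents n \<gamma>)"
proof (rule finite_subset)
  show "v_exponents n \<gamma> \<subseteq> (\<Union>d\<in>{..n + 2}. {m. Poly_Mapping.keys m \<subseteq> {1..n} \<and> total_degree m = d})"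
  proof
    fix a assume a: "a \<in> v_exponents n \<gamma>"
    hence keys: "Poly_Mapping.keys a \<subseteq> {1..n}" by (simp add: v_exponents_def)
    have "total_degree a = (\<Sum>k=1..n. Poly_Mapping.lookup a k)"
      by (rule total_degree_superset) (use keys in auto)
    also have "\<dots> \<le> (\<Sum>k=1..n. (n + 2 - k) * Poly_Mapping.lookup a k)"
      by (rule sum_mono) (simp, linarith)
    also have "\<dots> \<le> n + 2" using a by (simp add: v_exponents_def)
    finally show "a \<in> (\<Union>d\<in>{..n + 2}. {m. Poly_Mapping.keys m \<subseteq> {1..n} \<and> total_degree m = d})"
      using keys by auto
  qed
qed (auto intro: finite_monomials)

lemma mcoeff_v_series:
  assumes "\<gamma> \<in> {1..n}"
  shows "mcoeff (v_series n \<gamma>) m = (if m \<in> v_exponents n \<gamma> then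
    fact (total_degree m + \<gamma> - 2) / (fact (\<gamma> - 1) * fact_prod n m) else 0)"
proof -
  have "(\<Prod>k=1..n. sconst (1 / fact (Poly_Mapping.lookup a k)) * svar k ^ Poly_Mapping.lookup a k)
      = sconst (1 / fact_prod n a) * smonom a" if "a \<in> v_exponents n \<gamma>" for a
    using that
    by (simp add: prod.distrib sconst_prod[symmetric] prod_svar_power v_exponents_def fact_prod_def prod_dividef)
  hence "mcoeff (v_series n \<gamma>) m = (\<Sum>a\<in>v_exponents n \<gamma>. if a = m then
      fact (total_degree a + \<gamma> - 2) / (fact (\<gamma> - 1) * fact_prod n a) else 0)"
    unfolding v_series_def mcoeff_sum
    by (intro sum.cong refl) (simp add: mcoeff_smonom)
  thus ?thesis using finite_v_exponents[OF assms] by simp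
qed

lemma is_polynomial_v_series: "\<gamma> \<in> {1..n} \<Longrightarrow> is_polynomial (v_series n \<gamma>)"
  unfolding is_polynomial_def
  by (rule finite_subset[OF _ finite_v_exponents[of \<gamma> n]]) (auto simp: mcoeff_v_series split: if_splits)

text \<open>This says phi_\<alpha> = \<partial>\<lambda>/\<partial>t_\<alpha>. Differentiation
  cancels one factor of the factorial of the exponent of t_\<alpha> and lowers the required weight
  from n + 2 - a to \<alpha> - a.\<close>

lemma pd_v_series:
  assumes "\<alpha> \<in> {1..n}" "a \<in> {1..n}"
  shows "pd \<alpha> (v_series n a) = coeff (phi (flat_s n) \<alpha>) (a - 1)"
proof (rule pseries_eqI)
  fix m :: "nat \<Rightarrow>\<^sub>0 nat"
  let ?M = "m + Poly_Mapping.single \<alpha> 1"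
  have "?M \<in> v_exponents n a \<longleftrightarrow> Poly_Mapping.keys m \<subseteq> {1..n} \<and> wt n m + (n + 2 - \<alpha>) = n + 2 - a"
    unfolding v_exponents_def mem_Collect_eq wt_def[symmetric] wt_add_single[OF assms(1)] keys_add_nat
    using assms by auto
  also have "\<dots> \<longleftrightarrow> Poly_Mapping.keys m \<subseteq> {1..n} \<and> wt n m + (a - 1) + 1 = \<alpha>"
    using assms by auto
  finally have *: "?M \<in> v_exponents n a \<longleftrightarrow> Poly_Mapping.keys m \<subseteq> {1..n} \<and> wt n m + (a - 1) + 1 = \<alpha>" .
  have td: "total_degree (Poly_Mapping.single \<alpha> (1::nat)) = 1" by (simp add: total_degree_def)
  have "total_degree ?M + a - 2 = total_degree m + (a - 1)"
    using assms unfolding total_degree_add td by simp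
  hence "mcoeff (pd \<alpha> (v_series n a)) m = (if ?M \<in> v_exponents n a then multinom n (a - 1) m else 0)"
    unfolding mcoeff_pd mcoeff_v_series[OF assms(2)] fact_prod_add_single[OF assms(1)]
    by (simp add: multinom_def del: of_nat_add of_nat_Suc)
  thus "mcoeff (pd \<alpha> (v_series n a)) m = mcoeff (coeff (phi (flat_s n) \<alpha>) (a - 1)) m"
    unfolding * mcoeff_coeff_phi .
qed

text \<open>With the next lemma, this is \<lambda>' = phi_{n+1} below the leading term.\<close>

lemma v_series_eq_coeff_phi:
  assumes "Suc (Suc c) \<le> n"
  shows "of_nat (Suc c) * v_series n (Suc (Suc c)) = coeff (phi (flat_s n) (Suc n)) c"
proof (rule pseries_eqI)
  fix m
  have "m \<in> v_exponents n (Suc (Suc c)) \<longleftrightarrow> Poly_Mapping.keys m \<subseteq> {1..n} \<and> wt n m + c + 1 = Suc n"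
    unfolding v_exponents_def mem_Collect_eq wt_def[symmetric] using assms by auto
  thus "mcoeff (of_nat (Suc c) * v_series n (Suc (Suc c))) m = mcoeff (coeff (phi (flat_s n) (Suc n)) c) m"
    unfolding mcoeff_coeff_phi mcoeff_of_nat_mult using assms
    by (simp add: mcoeff_v_series multinom_def del: of_nat_Suc)
qed

text \<open>Such a coefficient would need a monomial of weight 1, but every flat coordinate has
  weight at least 2. It matches the missing x^(n-1) in \<lambda>'.\<close>

lemma coeff_phi_Suc_top: "n \<ge> 1 \<Longrightarrow> coeff (phi (flat_s n) (Suc n)) (n - 1) = 0"
proof (rule pseries_eqI)
  fix m assume "n \<ge> 1"
  have "wt n m \<noteq> 1" if "Poly_Mapping.keys m \<subseteq> {1..n}"
  proof (cases "m = 0")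
    case False
    hence "Poly_Mapping.keys m \<noteq> {}" by simp
    then obtain k where "k \<in> Poly_Mapping.keys m" by (meson ex_in_conv)
    hence k: "Poly_Mapping.lookup m k \<noteq> 0" "k \<in> {1..n}" using subsetD[OF that] by (simp_all add: in_keys_iff)
    have "2 * 1 \<le> (n + 2 - k) * Poly_Mapping.lookup m k"
      using k by (intro mult_le_mono) auto
    also have "\<dots> \<le> wt n m" unfolding wt_def using k(2) by (intro member_le_sum) auto
    finally show ?thesis by simp
  qed (simp add: wt_def)
  thus "mcoeff (coeff (phi (flat_s n) (Suc n)) (n - 1)) m = mcoeff 0 m"
    using \<open>n \<ge> 1\<close> by (auto simp: mcoeff_coeff_phi)
qed

section \<open>The Jacobian ring at a point\<close>

definition lam :: "nat \<Rightarrow> (nat \<Rightarrow> complex) \<Rightarrow> complex poly" where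
  "lam n v = monom (1 / of_nat (n + 1)) (n + 1) + (\<Sum>k=1..n. monom (v k) (k - 1))"

definition vec_poly :: "nat \<Rightarrow> (nat \<Rightarrow> complex) \<Rightarrow> complex poly" where
  "vec_poly n v = (\<Sum>k=1..n. monom (v k) (k - 1))"

lemma coeff_vec_poly: "coeff (vec_poly n v) l = (if l < n then v (Suc l) else 0)"
proof -
  have "coeff (vec_poly n v) l = (\<Sum>k=1..n. if k = Suc l then v k else 0)"
    unfolding vec_poly_def coeff_sum by (rule sum.cong) auto
  thus ?thesis by simp
qed

lemma degree_vec_poly: "n \<ge> 1 \<Longrightarrow> degree (vec_poly n v) < n"
proof -
  assume "n \<ge> 1"
  moreover have "degree (vec_poly n v) \<le> n - 1" by (rule degree_le) (auto simp: coeff_vec_poly)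
  ultimately show ?thesis by linarith
qed

lemma vec_poly_coeff: "degree p < n \<Longrightarrow> vec_poly n (\<lambda>k. coeff p (k - 1)) = p"
  by (auto simp: poly_eq_iff coeff_vec_poly coeff_eq_0)

lemma X_poly_power: "X_poly ^ k = [:monom 1 k:]"
  by (induction k) (simp_all add: X_poly_def monom_Suc one_pCons monom_0)

lemma C_X_poly: "C_poly c * X_poly ^ k = [:monom c k:]"
  by (simp add: X_poly_power smult_monom)

lemma const_poly_sum: "(\<Sum>x\<in>A. [:f x:]) = [:\<Sum>x\<in>A. f x:]"
  by (induction A rule: infinite_finite_induct) simp_all

lemma Lambda_eq: "Lambda n v = [:lam n v, 0, 1:]"
  unfolding Lambda_def C_X_poly const_poly_sum lam_def Y_poly_def
  by (simp add: power2_eq_square one_pCons)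

lemma diff_x_Lambda: "diff_x (Lambda n v) = [:pderiv (lam n v):]"
  unfolding diff_x_def Lambda_eq
  by (rule poly_eqI) (simp add: coeff_map_poly coeff_pCons split: nat.split)

lemma diff_y_Lambda: "diff_y (Lambda n v) = [:0, 2:]"
  unfolding diff_y_def Lambda_eq by (simp add: pderiv_pCons)

lemma coeff_pderiv_lam:
  "n \<ge> 1 \<Longrightarrow> coeff (pderiv (lam n v)) l =
    (if l = n then 1 else if Suc (Suc l) \<le> n then of_nat (Suc l) * v (Suc (Suc l)) else 0)"
  unfolding coeff_pderiv lam_def vec_poly_def[symmetric] coeff_add coeff_vec_poly
  by (auto simp del: of_nat_Suc)

lemma degree_pderiv_lam: "n \<ge> 1 \<Longrightarrow> degree (pderiv (lam n v)) = n"
  by (intro antisym degree_le le_degree) (auto simp: coeff_pderiv_lam)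

text \<open>The generator 2 y eliminates y, so the ring is that of polynomials in x modulo
  \<lambda>'. Uniqueness of remainders of degree below n resolves the definite description.\<close>

lemma structure_const_eq:
  assumes n: "n \<ge> 1"
  shows "structure_const n v a b k =
    (if k \<in> {1..n} then coeff (monom 1 (a - 1 + (b - 1)) mod pderiv (lam n v)) (k - 1) else 0)"
proof -
  let ?M = "pderiv (lam n v)" and ?f = "monom 1 (a - 1 + (b - 1)) :: complex poly"
  let ?c = "\<lambda>k. if k \<in> {1..n} then coeff (?f mod ?M) (k - 1) else 0"
  have M: "?M \<noteq> 0" "degree ?M = n" using degree_pderiv_lam[OF n, of v] n by auto
  have lhs: "X_poly ^ (a - 1) * X_poly ^ (b - 1) - (\<Sum>k=1..n. C_poly (c k) * X_poly ^ (k - 1))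
      = [:?f - vec_poly n c:]" for c
    unfolding C_X_poly const_poly_sum vec_poly_def[symmetric]
    by (simp add: X_poly_power mult_monom add.commute)
  have "degree (?f mod ?M) < n" using degree_mod_less'[of ?M ?f] M n by (cases "?f mod ?M = 0") auto
  have r: "vec_poly n ?c = ?f mod ?M"
  proof -
    have "vec_poly n ?c = vec_poly n (\<lambda>k. coeff (?f mod ?M) (k - 1))"
      unfolding vec_poly_def by (rule sum.cong) auto
    thus ?thesis using vec_poly_coeff[OF \<open>degree (?f mod ?M) < n\<close>] by simp
  qed
  have "structure_const n v a b = ?c"
    unfolding structure_const_def lhs diff_x_Lambda diff_y_Lambda
  proof (rule the_equality)
    have "[:?f - vec_poly n ?c:] = [:?f div ?M:] * [:?M:] + 0 * [:0, 2:]"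
      unfolding r by (simp add: minus_mod_eq_div_mult)
    thus "(\<forall>k. k \<notin> {1..n} \<longrightarrow> ?c k = 0) \<and> (\<exists>p q. [:?f - vec_poly n ?c:] = p * [:?M:] + q * [:0, 2:])"
      by (intro conjI) (simp, blast)
  next
    fix c assume c: "(\<forall>k. k \<notin> {1..n} \<longrightarrow> c k = 0) \<and> (\<exists>p q. [:?f - vec_poly n c:] = p * [:?M:] + q * [:0, 2:])"
    then obtain p q where pq: "[:?f - vec_poly n c:] = p * [:?M:] + q * [:0, 2:]" by blast
    \<comment> \<open>Setting y = 0 turns membership in the ideal into divisibility by
      \<lambda>'.\<close>
    from arg_cong[OF pq, of "\<lambda>p. coeff p 0"] have "?f = vec_poly n c + coeff p 0 * ?M"
      by (simp add: coeff_mult algebra_simps)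
    hence "?f mod ?M = vec_poly n c mod ?M" by simp
    also have "\<dots> = vec_poly n c"
      by (rule mod_poly_less) (use degree_vec_poly[OF n, of c] M in simp)
    finally have "vec_poly n c = vec_poly n ?c" using r by simp
    hence "coeff (vec_poly n c) l = coeff (vec_poly n ?c) l" for l by simp
    hence eq: "l < n \<Longrightarrow> c (Suc l) = ?c (Suc l)" for l unfolding coeff_vec_poly by metis
    show "c = ?c"
    proof
      fix k show "c k = ?c k" using eq[of "k - 1"] c by (cases "k \<in> {1..n}") auto
    qed
  qed
  thus ?thesis by simp
qed

lemma mod_poly_sum: "(\<Sum>x\<in>A. f x) mod M = (\<Sum>x\<in>A. f x mod M :: 'a::field poly)"
  by (induction A rule: infinite_finite_induct) (simp_all add: poly_mod_add_left)

lemma structure_const_bilinear: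
  assumes "n \<ge> 1" "k \<in> {1..n}"
  shows "(\<Sum>a=1..n. \<Sum>b=1..n. \<xi> a * \<zeta> b * structure_const n v a b k) =
    coeff ((vec_poly n \<xi> * vec_poly n \<zeta>) mod pderiv (lam n v)) (k - 1)"
proof -
  have "vec_poly n \<xi> * vec_poly n \<zeta> = (\<Sum>a=1..n. \<Sum>b=1..n. smult (\<xi> a * \<zeta> b) (monom 1 (a - 1 + (b - 1))))"
    by (simp add: vec_poly_def sum_product mult_monom smult_monom)
  thus ?thesis using assms
    by (simp add: mod_poly_sum mod_smult_left coeff_sum structure_const_eq)
qed

lemma frob_eta_mult:
  assumes n: "n \<ge> 1"
  shows "frob_eta n v (frob_mult n v \<xi> \<zeta>) \<omega> =
    coeff ((vec_poly n \<xi> * vec_poly n \<zeta> * vec_poly n \<omega>) mod pderiv (lam n v)) (n - 1)"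
proof -
  let ?M = "pderiv (lam n v)"
  have M: "?M \<noteq> 0" "degree ?M = n" using degree_pderiv_lam[OF n, of v] n by auto
  have "degree ((vec_poly n \<xi> * vec_poly n \<zeta>) mod ?M) < n"
    using degree_mod_less'[of ?M "vec_poly n \<xi> * vec_poly n \<zeta>"] M n
    by (cases "(vec_poly n \<xi> * vec_poly n \<zeta>) mod ?M = 0") auto
  hence "(vec_poly n \<xi> * vec_poly n \<zeta>) mod ?M = vec_poly n (\<lambda>k. coeff ((vec_poly n \<xi> * vec_poly n \<zeta>) mod ?M) (k - 1))"
    by (rule vec_poly_coeff[symmetric])
  also have "\<dots> = vec_poly n (frob_mult n v \<xi> \<zeta>)"
    unfolding vec_poly_def[of n "frob_mult n v \<xi> \<zeta>"] vec_poly_def[of n "\<lambda>k. coeff _ (k - 1)"] frob_mult_def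
    by (rule sum.cong) (simp_all only: structure_const_bilinear[OF n])
  finally have "vec_poly n (frob_mult n v \<xi> \<zeta>) = (vec_poly n \<xi> * vec_poly n \<zeta>) mod ?M" ..
  moreover have "n \<in> {1..n}" using n by simp
  ultimately show ?thesis unfolding frob_eta_def structure_const_bilinear[OF n \<open>n \<in> {1..n}\<close>]
    by (simp add: mod_mult_left_eq)
qed

section \<open>Specialising the flat coordinates to a point\<close>

definition evp :: "(nat \<Rightarrow> complex) \<Rightarrow> complex pseries poly \<Rightarrow> complex poly" where
  "evp t p = map_poly (\<lambda>f. peval f t) p"

lemma coeff_evp: "coeff (evp t p) l = peval (coeff p l) t"
  by (simp add: evp_def coeff_map_poly)

lemma is_polynomial_sum: "(\<And>x. x \<in> A \<Longrightarrow> is_polynomial (f x :: complex pseries)) \<Longrightarrow> is_polynomial (sum f A)"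
  by (induction A rule: infinite_finite_induct)
     (simp_all add: is_polynomial_add is_polynomial_sconst[of 0, simplified])

lemma peval_sum: "(\<And>x. x \<in> A \<Longrightarrow> is_polynomial (f x :: complex pseries)) \<Longrightarrow>
    peval (sum f A) t = (\<Sum>x\<in>A. peval (f x) t)"
  by (induction A rule: infinite_finite_induct) (simp_all add: peval_add is_polynomial_sum)

lemma rat_poly_polynomial: "rat_poly n f \<Longrightarrow> is_polynomial f"
  by (simp add: rat_poly_def)

lemma evp_mult:
  assumes "\<And>l. rat_poly n (coeff p l)" "\<And>l. rat_poly n (coeff q l)"
  shows "evp t (p * q) = evp t p * evp t q"
  using assms[THEN rat_poly_polynomial]
  by (intro poly_eqI) (simp add: coeff_evp coeff_mult peval_sum peval_mult is_polynomial_mult)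

lemma evp_add:
  assumes "\<And>l. rat_poly n (coeff p l)" "\<And>l. rat_poly n (coeff q l)"
  shows "evp t (p + q) = evp t p + evp t q"
  using assms[THEN rat_poly_polynomial]
  by (intro poly_eqI) (simp add: coeff_evp peval_add)

context flat begin

text \<open>Identifies the symbolic divisor with the relation of the Jacobian ring at t. Degree n -
  1 is a case of its own, as \<lambda>' has no such term.\<close>

lemma evp_M: "evp t (ph (Suc n)) = pderiv (lam n (v_point n t))"
proof (rule poly_eqI)
  fix l
  consider "l = n" | "l > n" | "l = n - 1" "l < n" | "Suc (Suc l) \<le> n" by linarith
  thus "coeff (evp t (ph (Suc n))) l = coeff (pderiv (lam n (v_point n t))) l"
  proof cases
    case 1
    thus ?thesis by (simp add: coeff_evp coeff_pderiv_lam[OF n1] coeff_M_n)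
  next
    case 2
    thus ?thesis by (simp add: coeff_evp coeff_pderiv_lam[OF n1] coeff_M_gt)
  next
    case 3
    thus ?thesis using coeff_phi_Suc_top[OF n1] by (simp add: coeff_evp coeff_pderiv_lam[OF n1])
  next
    case 4
    have "coeff (evp t (ph (Suc n))) l = peval (sconst (of_nat (Suc l)) * v_series n (Suc (Suc l))) t"
      using v_series_eq_coeff_phi[OF 4] by (simp only: coeff_evp sconst_of_nat)
    also have "\<dots> = of_nat (Suc l) * v_point n t (Suc (Suc l))"
      using 4 by (subst peval_mult) (auto simp only: is_polynomial_sconst peval_sconst v_point_def
          intro!: is_polynomial_v_series, simp_all)
    finally show ?thesis using 4 n1 by (simp add: coeff_pderiv_lam)
  qed
qed

lemma vec_poly_flat_vec:
  assumes "\<alpha> \<in> {1..n}"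
  shows "vec_poly n (flat_vec n t \<alpha>) = evp t (ph \<alpha>)"
proof (rule poly_eqI)
  fix l show "coeff (vec_poly n (flat_vec n t \<alpha>)) l = coeff (evp t (ph \<alpha>)) l"
  proof (cases "l < n")
    case True
    thus ?thesis using assms by (simp add: coeff_vec_poly flat_vec_def pd_v_series coeff_evp)
  next
    case False
    thus ?thesis using assms by (simp add: coeff_vec_poly coeff_evp coeff_phi_eq_0)
  qed
qed

text \<open>Evaluating the symbolic division at t yields the division at t, because the divisor
  keeps degree n and the remainder stays below it.\<close>

lemma frob_eta_flat:
  assumes "\<alpha> \<in> {1..n}" "\<beta> \<in> {1..n}" "\<gamma> \<in> {1..n}"
  shows "frob_eta n (v_point n t) (frob_mult n (v_point n t) (flat_vec n t \<alpha>) (flat_vec n t \<beta>)) (flat_vec n t \<gamma>)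
    = peval (corr \<alpha> \<beta> \<gamma>) t"
proof -
  let ?f = "ph \<alpha> * ph \<beta> * ph \<gamma>" and ?M = "pderiv (lam n (v_point n t))"
  have rat: "rat_poly n (coeff ?f l)" for l
    by (intro rat_poly_coeff_mult rat_poly_coeff_phi)
  have "evp t ?f = evp t (ph (Suc n) * quo ?f + rem ?f)" by (simp only: division[symmetric])
  also have "\<dots> = ?M * evp t (quo ?f) + evp t (rem ?f)"
    by (subst evp_add[of n]) (auto intro!: rat_poly_coeff_mult rat_poly_coeff_phi rat_poly_rem rat
      simp: evp_mult[OF rat_poly_coeff_phi rat_poly_rem(2)[OF rat]] evp_M)
  finally have "evp t ?f mod ?M = evp t (rem ?f) mod ?M" by simp
  also have "\<dots> = evp t (rem ?f)"
  proof (rule mod_poly_less)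
    have "degree (evp t (rem ?f)) \<le> n - 1"
      using low_rem[of ?f] by (intro degree_le) (auto simp: coeff_evp low_def)
    thus "degree (evp t (rem ?f)) < degree ?M" using n1 by (simp add: degree_pderiv_lam)
  qed
  finally have "coeff (evp t ?f mod ?M) (n - 1) = peval (corr \<alpha> \<beta> \<gamma>) t"
    by (simp add: coeff_evp corr_def rho_def)
  moreover have "evp t ?f = evp t (ph \<alpha>) * evp t (ph \<beta>) * evp t (ph \<gamma>)"
    by (simp add: evp_mult[of n] rat_poly_coeff_mult rat_poly_coeff_phi)
  ultimately show ?thesis using assms by (simp add: frob_eta_mult[OF n1] vec_poly_flat_vec)
qed

text \<open>The third derivatives and \<open>corr\<close> are polynomials, so equality at all points
  is equality of series.\<close>

lemma is_A_potential_iff: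
  "is_A_potential n F \<longleftrightarrow> rat_poly n F \<and> (\<forall>m. total_degree m \<le> 2 \<longrightarrow> mcoeff F m = 0) \<and>
     (\<forall>\<alpha>\<in>{1..n}. \<forall>\<beta>\<in>{1..n}. \<forall>\<gamma>\<in>{1..n}. pd \<alpha> (pd \<beta> (pd \<gamma> F)) = corr \<alpha> \<beta> \<gamma>)"
proof -
  have "(\<forall>t. peval (pd \<alpha> (pd \<beta> (pd \<gamma> F))) t = peval (corr \<alpha> \<beta> \<gamma>) t) \<longleftrightarrow> pd \<alpha> (pd \<beta> (pd \<gamma> F)) = corr \<alpha> \<beta> \<gamma>"
    if "is_polynomial F" for \<alpha> \<beta> \<gamma>
  proof -
    have "is_polynomial (pd \<alpha> (pd \<beta> (pd \<gamma> F)))" by (intro is_polynomial_pd that)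
    thus ?thesis using polynomial_eqI[OF _ rat_poly_polynomial[OF rat_poly_corr]] by metis
  qed
  hence "(\<forall>\<alpha>\<in>{1..n}. \<forall>\<beta>\<in>{1..n}. \<forall>\<gamma>\<in>{1..n}. \<forall>t.
        peval (pd \<alpha> (pd \<beta> (pd \<gamma> F))) t = peval (corr \<alpha> \<beta> \<gamma>) t) \<longleftrightarrow>
      (\<forall>\<alpha>\<in>{1..n}. \<forall>\<beta>\<in>{1..n}. \<forall>\<gamma>\<in>{1..n}. pd \<alpha> (pd \<beta> (pd \<gamma> F)) = corr \<alpha> \<beta> \<gamma>)"
    if "is_polynomial F" using that by simp
  thus ?thesis unfolding is_A_potential_def rat_poly_def by (simp add: frob_eta_flat cong: conj_cong)
qed

lemma pd_F_A:
  assumes "\<alpha> \<in> {1..n}" "\<beta> \<in> {1..n}" "\<gamma> \<in> {1..n}"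
  shows "pd \<alpha> (pd \<beta> (pd \<gamma> (F_A n))) = corr \<alpha> \<beta> \<gamma>"
proof -
  obtain F where F: "is_A_potential n F" using potential_exists unfolding is_A_potential_iff by blast
  have "is_A_potential n (F_A n)"
    unfolding F_A_def
  proof (rule theI[of "is_A_potential n"])
    fix F' assume "is_A_potential n F'"
    note FF' = this[unfolded is_A_potential_iff rat_poly_def] F[unfolded is_A_potential_iff rat_poly_def]
    show "F' = F"
    proof (rule potential_unique)
      show "series_in {1..n} F'" "series_in {1..n} F" using FF' by blast+
      show "total_degree m \<le> 2 \<Longrightarrow> mcoeff F' m = 0" "total_degree m \<le> 2 \<Longrightarrow> mcoeff F m = 0" for m
        using FF' by blast+
      show "pd \<alpha> (pd \<beta> (pd \<gamma> F')) = pd \<alpha> (pd \<beta> (pd \<gamma> F))"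
        if "\<alpha> \<in> {1..n}" "\<beta> \<in> {1..n}" "\<gamma> \<in> {1..n}" for \<alpha> \<beta> \<gamma>
        using FF' that by metis
    qed
  qed (rule F)
  thus ?thesis using assms unfolding is_A_potential_iff by blast
qed

end

section \<open>Series in two variables\<close>

abbreviation bnth :: "'a fps fps \<Rightarrow> nat \<Rightarrow> nat \<Rightarrow> 'a" where
  "bnth G i j \<equiv> fps_nth (fps_nth G i) j"

lemma bnth_bps [simp]: "bnth (bps c) i j = c i j"
  by (simp add: bps_def)

lemma bps_eqI: "(\<And>i j. bnth F i j = bnth G i j) \<Longrightarrow> F = G"
  by (simp add: fps_eq_iff)

lemma bnth_mult: "bnth (F * G) i j = (\<Sum>a=0..i. \<Sum>b=0..j. bnth F a b * bnth G (i - a) (j - b))"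
  for F G :: "'a::comm_ring_1 fps fps"
  by (simp add: fps_mult_nth fps_sum_nth)

lemma bnth_1: "bnth (1 :: 'a::comm_ring_1 fps fps) i j = (if i = 0 \<and> j = 0 then 1 else 0)"
  by (simp add: fps_one_nth)

definition bmap :: "('a \<Rightarrow> 'b) \<Rightarrow> 'a fps fps \<Rightarrow> 'b fps fps" where
  "bmap h G = bps (\<lambda>i j. h (bnth G i j))"

lemma bnth_bmap [simp]: "bnth (bmap h G) i j = h (bnth G i j)"
  by (simp add: bmap_def)

lemma bmap_mult:
  fixes h :: "'a::comm_ring_1 \<Rightarrow> 'b::comm_ring_1"
  assumes "\<And>x y. h (x + y) = h x + h y" "\<And>x y. h (x * y) = h x * h y"
  shows "bmap h (F * G) = bmap h F * bmap h G"
proof -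
  have "h 0 = 0" using assms(1)[of 0 0] by simp
  hence sum: "h (sum f A) = (\<Sum>x\<in>A. h (f x))" for f :: "nat \<Rightarrow> 'a" and A
    by (induction A rule: infinite_finite_induct) (simp_all add: assms)
  show ?thesis by (rule bps_eqI) (simp add: bnth_mult sum assms)
qed

text \<open>Equality up to total degree d: the product of K with the third derivatives is known only
  up to a bound depending on n.\<close>

definition deg_cong :: "nat \<Rightarrow> 'a fps fps \<Rightarrow> 'a fps fps \<Rightarrow> bool" where
  "deg_cong d F G \<longleftrightarrow> (\<forall>i j. i + j \<le> d \<longrightarrow> bnth F i j = bnth G i j)"

lemma deg_cong_refl [simp]: "deg_cong d F F"
  by (simp add: deg_cong_def)

lemma deg_cong_mult:
  fixes F G :: "'a::comm_ring_1 fps fps"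
  assumes "deg_cong d F F'" "deg_cong d G G'"
  shows "deg_cong d (F * G) (F' * G')"
  unfolding deg_cong_def
proof (intro allI impI)
  fix i j assume ij: "i + j \<le> d"
  show "bnth (F * G) i j = bnth (F' * G') i j"
    unfolding bnth_mult
  proof (intro sum.cong refl)
    fix a b assume ab: "a \<in> {0..i}" "b \<in> {0..j}"
    hence "a + b \<le> d" "(i - a) + (j - b) \<le> d" using ij by auto
    thus "bnth F a b * bnth G (i - a) (j - b) = bnth F' a b * bnth G' (i - a) (j - b)"
      using assms unfolding deg_cong_def by metis
  qed
qed

lemma deg_cong_power: "deg_cong d F F' \<Longrightarrow> deg_cong d (F ^ m) (F' ^ m)" for F :: "'a::comm_ring_1 fps fps"
  by (induction m) (auto intro: deg_cong_mult)

text \<open>\<open>Eser g\<close> is $\sum_{i+j=g+1} z_1^{-i} z_2^{-j}$ over $i, j \ge 1$.  With $p(z) = z - \sum_j s_j z^{-j}$,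
  the series \<open>Kser s\<close> is $(p(z_1) - p(z_2)) / (z_1 - z_2)$.\<close>

definition Eser :: "nat \<Rightarrow> 'a::comm_ring_1 fps fps" where
  "Eser g = bps (\<lambda>i j. if i \<ge> 1 \<and> j \<ge> 1 \<and> i + j = g + 1 then 1 else 0)"

definition Kser :: "(nat \<Rightarrow> 'a::comm_ring_1) \<Rightarrow> 'a fps fps" where
  "Kser s = bps (\<lambda>i j. if i = 0 \<or> j = 0 then (if i = 0 \<and> j = 0 then 1 else 0) else s (i + j - 1))"

lemma bnth_Eser: "bnth (Eser g) i j = (if i \<ge> 1 \<and> j \<ge> 1 \<and> i + j = g + 1 then 1 else 0)"
  by (simp add: Eser_def)

lemma bnth_Kser: "bnth (Kser s) i j =
    (if i = 0 \<or> j = 0 then (if i = 0 \<and> j = 0 then 1 else 0) else s (i + j - 1))"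
  by (simp add: Kser_def)

lemma bmap_Eser: "h 0 = 0 \<Longrightarrow> h 1 = 1 \<Longrightarrow> bmap h (Eser g) = Eser g"
  by (rule bps_eqI) (simp add: bnth_Eser)

lemma bmap_prod_Eser:
  fixes h :: "'a::comm_ring_1 \<Rightarrow> 'b::comm_ring_1"
  assumes "\<And>x y. h (x + y) = h x + h y" "\<And>x y. h (x * y) = h x * h y" "h 1 = 1"
  shows "bmap h (\<Prod>g\<leftarrow>gs. Eser g) = (\<Prod>g\<leftarrow>gs. Eser g)"
proof -
  have h0: "h 0 = 0" using assms(1)[of 0 0] by simp
  have "bmap h 1 = 1" by (rule bps_eqI) (simp only: bnth_bmap bnth_1 if_distrib[of h] h0 assms(3))
  thus ?thesis by (induction gs) (simp_all add: bmap_mult[OF assms(1,2)] bmap_Eser h0 assms(3))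
qed

text \<open>\<open>Eser g\<close> is homogeneous of degree g + 1, and degrees add.\<close>

lemma bnth_prod_Eser_nonzero:
  "bnth (\<Prod>g\<leftarrow>gs. Eser g :: 'a::comm_ring_1 fps fps) i j \<noteq> 0 \<Longrightarrow> i + j = (\<Sum>g\<leftarrow>gs. g + 1)"
proof (induction gs arbitrary: i j)
  case (Cons g gs)
  hence "\<exists>a\<in>{0..i}. (\<Sum>b=0..j. bnth (Eser g :: 'a fps fps) a b * bnth (\<Prod>g\<leftarrow>gs. Eser g) (i - a) (j - b)) \<noteq> 0"
    unfolding list.map prod_list.Cons bnth_mult by (meson sum.neutral)
  then obtain a where a: "a \<in> {0..i}"
    "(\<Sum>b=0..j. bnth (Eser g :: 'a fps fps) a b * bnth (\<Prod>g\<leftarrow>gs. Eser g) (i - a) (j - b)) \<noteq> 0" by blast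
  hence "\<exists>b\<in>{0..j}. bnth (Eser g :: 'a fps fps) a b * bnth (\<Prod>g\<leftarrow>gs. Eser g) (i - a) (j - b) \<noteq> 0"
    by (meson sum.neutral)
  then obtain b where b: "b \<in> {0..j}" "bnth (Eser g :: 'a fps fps) a b * bnth (\<Prod>g\<leftarrow>gs. Eser g :: 'a fps fps) (i - a) (j - b) \<noteq> 0" by blast
  hence "a + b = g + 1" "(i - a) + (j - b) = (\<Sum>g\<leftarrow>gs. g + 1)"
    using Cons.IH[of "i - a" "j - b"] by (auto simp: bnth_Eser split: if_splits)
  thus ?case using a(1) b(1) by auto
qed (auto simp: bnth_1 split: if_splits)

lemma fps_nth_Kser_0: "fps_nth (Kser s) 0 = 1"
  by (rule fps_ext) (simp add: bnth_Kser fps_one_nth)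

definition Kinv :: "(nat \<Rightarrow> 'a::comm_ring_1) \<Rightarrow> 'a fps fps" where
  "Kinv s = fps_right_inverse (Kser s) 1"

lemma Kser_Kinv: "Kser s * Kinv s = 1"
  unfolding Kinv_def by (rule fps_right_inverse) (simp add: fps_nth_Kser_0)

lemma bnth_pd_coeffs [simp]: "bnth (pd_coeffs k G) i j = pd k (bnth G i j)"
  by (simp add: pd_coeffs_def)

lemma pd_coeffs_add: "pd_coeffs k (F + G) = pd_coeffs k F + pd_coeffs k G"
  by (rule bps_eqI) (simp add: pd_add)

lemma pd_coeffs_uminus: "pd_coeffs k (- F) = - pd_coeffs k F"
  by (rule bps_eqI) (simp add: pd_uminus)

lemma pd_coeffs_mult: "pd_coeffs k (F * G) = pd_coeffs k F * G + F * pd_coeffs k G"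
  by (rule bps_eqI) (simp add: bnth_mult pd_sum pd_mult sum.distrib)

lemma pd_coeffs_1 [simp]: "pd_coeffs k 1 = 0"
  by (rule bps_eqI) (simp add: bnth_1)

lemma pd_coeffs_Eser [simp]: "pd_coeffs k (Eser g) = 0"
  by (rule bps_eqI) (simp add: bnth_Eser)

lemma pd_coeffs_0 [simp]: "pd_coeffs k 0 = 0"
  by (rule bps_eqI) simp

lemma pd_coeffs_of_nat [simp]: "pd_coeffs k (of_nat m) = 0"
  by (induction m) (simp_all add: pd_coeffs_add)

lemma pd_coeffs_power: "pd_coeffs k (F ^ m) = of_nat m * F ^ (m - 1) * pd_coeffs k F"
proof (induction m)
  case (Suc m)
  show ?case by (cases m) (use Suc in \<open>simp_all add: pd_coeffs_mult algebra_simps\<close>)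
qed simp

lemma foldr_pd_commute: "pd k (foldr (\<lambda>h. pd (r h)) hs F) = foldr (\<lambda>h. pd (r h)) hs (pd k (F :: complex pseries))"
  by (induction hs) (simp_all add: pd_commute[of k])

lemma bnth_foldr_pd_coeffs:
  "bnth (foldr (\<lambda>h. pd_coeffs (r h)) hs G) i j = foldr (\<lambda>h. pd (r h)) hs (bnth G i j)"
  by (induction hs) simp_all

lemma deg_cong_foldr: "deg_cong d F G \<Longrightarrow>
    deg_cong d (foldr (\<lambda>h. pd_coeffs (r h)) hs F) (foldr (\<lambda>h. pd_coeffs (r h)) hs G)"
  by (simp add: deg_cong_def bnth_foldr_pd_coeffs)

section \<open>Taylor coefficients of the third derivatives at the origin\<close>

context flat begin

definition Cser :: "nat \<Rightarrow> complex pseries fps fps" where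
  "Cser c = bps (\<lambda>i j. corr i j c)"

text \<open>Multiply \<open>phi_mult\<close> by phi_c and apply \<open>rho\<close>: the pairing
  leaves only the antidiagonal i + j = n + 2 - c. The degree bound keeps i + j - 1 in the range of
  \<open>rho_ph_mult\<close>.\<close>

lemma Kser_Cser:
  assumes "c \<in> {1..n}"
  shows "deg_cong (n + 1) (Kser (flat_s n) * Cser c) (Eser (n + 1 - c))"
  unfolding deg_cong_def
proof (intro allI impI)
  fix i j assume ij: "i + j \<le> n + 1"
  let ?s = "flat_s n"
  have split: "(\<Sum>a=0..m. f a) = f 0 + (\<Sum>a=1..m. f a)" for f :: "nat \<Rightarrow> complex pseries" and m
    by (simp add: sum.atLeast_Suc_atMost)
  have "bnth (Kser ?s * Cser c) i j = corr i j c + (\<Sum>a=1..i. \<Sum>b=1..j. ?s (a + b - 1) * corr (i - a) (j - b) c)"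
    unfolding bnth_mult by (simp add: split bnth_Kser Cser_def)
  also have "\<dots> = (if i \<ge> 1 \<and> j \<ge> 1 then rho (ph (i + j - 1) * ph c) else 0)"
  proof (cases "i \<ge> 1 \<and> j \<ge> 1")
    case True
    have "rho (ph (i + j - 1) * ph c) =
        rho (ph i * ph j * ph c + (\<Sum>a=1..i. \<Sum>b=1..j. smult (?s (a + b - 1)) (ph (i - a) * ph (j - b) * ph c)))"
      unfolding phi_mult[OF conjunct1[OF True] conjunct2[OF True], of ?s, symmetric]
        distrib_right sum_distrib_right mult_smult_left by (rule refl)
    thus ?thesis using True by (simp add: rho_add rho_sum rho_smult corr_def)
  next
    case False
    hence "i = 0 \<or> j = 0" by auto
    thus ?thesis by (auto simp: corr_def rho_low low_0)
  qed
  also have "\<dots> = bnth (Eser (n + 1 - c)) i j"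
  proof (cases "i \<ge> 1 \<and> j \<ge> 1")
    case True
    have "rho (ph (i + j - 1) * ph c) = (if c + (i + j - 1) = n + 1 then 1 else 0)"
      by (rule rho_ph_mult) (use assms True ij in auto)
    moreover have "c + (i + j - 1) = n + 1 \<longleftrightarrow> i + j = n + 1 - c + 1" using assms True by auto
    ultimately show ?thesis unfolding bnth_Eser using True by presburger
  qed (auto simp: bnth_Eser)
  finally show "bnth (Kser ?s * Cser c) i j = bnth (Eser (n + 1 - c)) i j" .
qed

lemma Cser_cong:
  assumes "c \<in> {1..n}"
  shows "deg_cong (n + 1) (Cser c) (Eser (n + 1 - c) * Kinv (flat_s n))"
proof -
  have "deg_cong (n + 1) (Kser (flat_s n) * Cser c * Kinv (flat_s n)) (Eser (n + 1 - c) * Kinv (flat_s n))"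
    by (intro deg_cong_mult Kser_Cser assms deg_cong_refl)
  moreover have "Kser (flat_s n) * Cser c * Kinv (flat_s n) = Cser c"
    using Kser_Kinv[of "flat_s n"] by (metis mult.commute mult.left_commute mult.right_neutral)
  ultimately show ?thesis by simp
qed

text \<open>The variable n + 1 - h is s_h, and K is affine in s with derivative E_h; differentiate K
  K^(-1) = 1.\<close>

lemma pd_coeffs_Kinv:
  assumes "h \<in> {1..n}"
  shows "pd_coeffs (n + 1 - h) (Kinv (flat_s n)) = - (Eser h * Kinv (flat_s n) ^ 2)"
proof -
  let ?K = "Kser (flat_s n)" and ?V = "Kinv (flat_s n)"
  have h: "n + 1 - h \<in> {1..n}" "n + 1 - (n + 1 - h) = h" using assms by auto
  have K: "pd_coeffs (n + 1 - h) ?K = Eser h"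
  proof (rule bps_eqI)
    fix i j
    show "bnth (pd_coeffs (n + 1 - h) ?K) i j = bnth (Eser h) i j"
      using pd_flat_s[OF h(1), of "i + j - 1"] unfolding h(2) by (auto simp: bnth_Kser bnth_Eser)
  qed
  have "pd_coeffs (n + 1 - h) (?K * ?V) = 0" by (simp add: Kser_Kinv)
  hence "Eser h * ?V + ?K * pd_coeffs (n + 1 - h) ?V = 0" unfolding pd_coeffs_mult K .
  hence "?K * pd_coeffs (n + 1 - h) ?V = - (Eser h * ?V)"
    by (simp only: eq_neg_iff_add_eq_0 add.commute)
  note KV = this
  have "?V * ?K = 1" by (simp only: mult.commute[of ?V] Kser_Kinv)
  hence "pd_coeffs (n + 1 - h) ?V = ?V * (?K * pd_coeffs (n + 1 - h) ?V)"
    by (simp only: mult.assoc[symmetric] mult_1_left)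
  also have "\<dots> = - (Eser h * ?V ^ 2)"
    unfolding KV by (simp add: power2_eq_square mult_ac)
  finally show ?thesis .
qed

lemma foldr_pd_coeffs_Kinv:
  assumes "set hs \<subseteq> {1..n}"
  shows "foldr (\<lambda>h. pd_coeffs (n + 1 - h)) hs (Eser g * Kinv (flat_s n)) =
    of_nat (fact (length hs)) * ((\<Prod>h\<leftarrow>hs. - Eser h) * Eser g * Kinv (flat_s n) ^ (length hs + 1))"
  using assms
proof (induction hs)
  case (Cons h hs)
  have P: "pd_coeffs k (\<Prod>h\<leftarrow>hs. - Eser h) = 0" for k
    by (induction hs) (simp_all add: pd_coeffs_mult pd_coeffs_uminus)
  let ?m = "length hs" and ?V = "Kinv (flat_s n)" and ?P = "\<Prod>h\<leftarrow>hs. - Eser h :: complex pseries fps fps"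
  have h: "h \<in> {1..n}" and hs: "set hs \<subseteq> {1..n}" using Cons.prems by auto
  have "foldr (\<lambda>h. pd_coeffs (n + 1 - h)) (h # hs) (Eser g * ?V) =
      pd_coeffs (n + 1 - h) (of_nat (fact ?m) * (?P * Eser g * ?V ^ (?m + 1)))"
    by (simp only: foldr.simps o_apply Cons.IH[OF hs])
  also have "\<dots> = of_nat (fact ?m) * (?P * Eser g * (of_nat (?m + 1) * ?V ^ ?m * (- (Eser h * ?V ^ 2))))"
    by (simp only: pd_coeffs_mult pd_coeffs_of_nat P pd_coeffs_Eser pd_coeffs_power pd_coeffs_Kinv[OF h]
        mult_zero_left mult_zero_right add_0 add_diff_cancel_right')
  also have "\<dots> = of_nat (?m + 1) * of_nat (fact ?m) * (- Eser h * ?P * Eser g * (?V ^ ?m * ?V ^ 2))"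
    by (simp only: mult_ac mult_minus_left mult_minus_right)
  also have "?V ^ ?m * ?V ^ 2 = ?V ^ (length (h # hs) + 1)"
    by (simp only: power_add[symmetric]) simp
  also have "of_nat (?m + 1) * of_nat (fact ?m) = (of_nat (fact (length (h # hs))) :: complex pseries fps fps)"
    by (simp only: of_nat_mult[symmetric] list.size) simp
  finally show ?case by simp
qed simp

text \<open>The derivative belonging to g completes a third derivative E_g / K; the remaining ones,
  in \<open>hs\<close>, are then computed from K^(-1) alone.\<close>

lemma pd_foldr_F_A_at_0:
  assumes "a \<in> {1..n}" "b \<in> {1..n}" "a + b \<le> n + 1" "g \<in> {1..n}" "set hs \<subseteq> {1..n}"
  shows "mcoeff (pd a (pd b (foldr (\<lambda>h. pd (n + 1 - h)) (g # hs) (F_A n)))) 0 =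
    (- 1) ^ length hs * fact (length hs) * bnth (\<Prod>h\<leftarrow>g # hs. Eser h) a b"
proof -
  \<comment> \<open>The constant term is a ring homomorphism and sends K, hence every power of its
    inverse, to 1.\<close>
  define c0 :: "complex pseries \<Rightarrow> complex" where "c0 f = mcoeff f 0" for f
  have c0_add: "c0 (f + f') = c0 f + c0 f'" and c0_mult: "c0 (f * f') = c0 f * c0 f'" and c0_1: "c0 1 = 1" for f f'
    by (simp_all add: c0_def mcoeff_mult_0 mcoeff_1)
  have c0_0: "c0 0 = 0" and c0_uminus: "c0 (- f) = - c0 f" for f by (simp_all add: c0_def)
  have bmap_1: "bmap c0 1 = 1" by (rule bps_eqI) (simp only: bnth_bmap bnth_1 if_distrib[of c0] c0_0 c0_1)
  have bmap_m: "bmap c0 (F * G) = bmap c0 F * bmap c0 G" for F G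
    by (rule bmap_mult) (simp_all add: c0_add c0_mult)
  have "c0 (flat_s n j) = 0" for j
  proof -
    have "Poly_Mapping.single (n + 1 - j) (1::nat) \<noteq> 0" by (metis lookup_single_eq lookup_zero zero_neq_one)
    thus ?thesis by (auto simp: c0_def flat_s_def svar.rep_eq)
  qed
  hence "bmap c0 (Kser (flat_s n)) = 1"
    by (intro bps_eqI) (simp add: bnth_Kser bnth_1 c0_0 c0_1)
  hence V: "bmap c0 (Kinv (flat_s n)) = 1"
    using bmap_m[of "Kser (flat_s n)" "Kinv (flat_s n)"] by (simp add: Kser_Kinv bmap_1)
  have Vp: "bmap c0 (Kinv (flat_s n) ^ m) = 1" for m
    by (induction m) (simp_all add: bmap_1 bmap_m V)
  have N: "bmap c0 (of_nat m) = of_nat m" for m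
  proof (induction m)
    case 0
    show ?case by (rule bps_eqI) (simp add: c0_0)
  next
    case (Suc m)
    have "bmap c0 (1 + of_nat m) = bmap c0 1 + bmap c0 (of_nat m)" by (rule bps_eqI) (simp add: c0_add)
    thus ?case using Suc bmap_1 by simp
  qed
  have E: "bmap c0 (\<Prod>h\<leftarrow>hs. - Eser h) = (- 1) ^ length hs * (\<Prod>h\<leftarrow>hs. Eser h)"
  proof (induction hs)
    case (Cons h hs)
    have "bmap c0 (- Eser h) = - Eser h" by (rule bps_eqI) (simp add: bnth_Eser c0_0 c0_1 c0_uminus)
    thus ?case using Cons unfolding list.map prod_list.Cons bmap_m by simp
  qed (simp add: bmap_1)
  define c where "c = n + 1 - g"
  have c: "c \<in> {1..n}" "n + 1 - c = g" using assms by (auto simp: c_def)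
  have "pd a (pd b (foldr (\<lambda>h. pd (n + 1 - h)) (g # hs) (F_A n))) =
      foldr (\<lambda>h. pd (n + 1 - h)) hs (pd a (pd b (pd c (F_A n))))"
    by (simp add: foldr_pd_commute c_def)
  also have "pd a (pd b (pd c (F_A n))) = bnth (Cser c) a b"
    using pd_F_A[OF assms(1,2) c(1)] by (simp add: Cser_def)
  also have "foldr (\<lambda>h. pd (n + 1 - h)) hs (bnth (Cser c) a b) =
      bnth (foldr (\<lambda>h. pd_coeffs (n + 1 - h)) hs (Cser c)) a b"
    by (simp add: bnth_foldr_pd_coeffs)
  also have "\<dots> = bnth (foldr (\<lambda>h. pd_coeffs (n + 1 - h)) hs (Eser g * Kinv (flat_s n))) a b"
    using deg_cong_foldr[OF Cser_cong[OF c(1)]] assms(3) unfolding c(2) deg_cong_def by blast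
  also have "\<dots> = bnth (of_nat (fact (length hs)) * ((\<Prod>h\<leftarrow>hs. - Eser h) * Eser g * Kinv (flat_s n) ^ (length hs + 1))) a b"
    by (simp only: foldr_pd_coeffs_Kinv[OF assms(5)])
  finally have "mcoeff (pd a (pd b (foldr (\<lambda>h. pd (n + 1 - h)) (g # hs) (F_A n)))) 0 =
      bnth (bmap c0 (of_nat (fact (length hs)) * ((\<Prod>h\<leftarrow>hs. - Eser h) * Eser g * Kinv (flat_s n) ^ (length hs + 1)))) a b"
    by (simp add: c0_def)
  also have "bmap c0 (of_nat (fact (length hs)) * ((\<Prod>h\<leftarrow>hs. - Eser h) * Eser g * Kinv (flat_s n) ^ (length hs + 1)))
      = of_nat (fact (length hs)) * ((- 1) ^ length hs * (\<Prod>h\<leftarrow>hs. Eser h) * Eser g)"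
    unfolding bmap_m N E Vp by (simp add: bmap_Eser c0_0 c0_1)
  also have "\<dots> = of_int ((- 1) ^ length hs * fact (length hs)) * (\<Prod>h\<leftarrow>g # hs. Eser h)"
    by (simp add: mult_ac)
  also have "bnth \<dots> a b = (- 1) ^ length hs * fact (length hs) * bnth (\<Prod>h\<leftarrow>g # hs. Eser h) a b"
    unfolding fps_of_int[symmetric] by simp
  finally show ?thesis .
qed

end

section \<open>Substituting multiples of variables for the odd variables\<close>

text \<open>One substitution for two purposes: c = 1 produces \<open>F_B\<close>, and c_j = 1/j the
  change of the BKP times.\<close>

definition odd_subst :: "(nat \<Rightarrow> complex) \<Rightarrow> complex pseries \<Rightarrow> complex pseries" where
  "odd_subst c = psubst (\<lambda>j. if odd j then sconst (c j) * svar ((j + 1) div 2) else 0)"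

text \<open>The exponent vector of $\prod_k T_{2k-1}^{m_k}$.\<close>

lift_definition odd_exps :: "(nat \<Rightarrow>\<^sub>0 nat) \<Rightarrow> (nat \<Rightarrow>\<^sub>0 nat)"
  is "\<lambda>m j. if odd j then m ((j + 1) div 2) else 0"
proof -
  fix m :: "nat \<Rightarrow> nat" assume "finite {x. m x \<noteq> 0}"
  moreover have "{j. (if odd j then m ((j + 1) div 2) else 0) \<noteq> 0} \<subseteq> (\<lambda>k. 2 * k - 1) ` {x. m x \<noteq> 0}"
    by (auto elim!: oddE intro!: image_eqI[of _ _ "Suc _"])
  ultimately show "finite {j. (if odd j then m ((j + 1) div 2) else 0) \<noteq> 0}"
    by (meson finite_imageI finite_subset)
qed

text \<open>At k = 0 the truncated 2 k - 1 is 0, which keeps the index map injective; it inverts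
  \<open>odd_exps\<close> only on monomials without variable 0.\<close>

definition half_exps :: "(nat \<Rightarrow>\<^sub>0 nat) \<Rightarrow> (nat \<Rightarrow>\<^sub>0 nat)" where
  "half_exps M = Poly_Mapping.map_key (\<lambda>k. 2 * k - 1) M"

lemma lookup_odd_exps: "Poly_Mapping.lookup (odd_exps m) j = (if odd j then Poly_Mapping.lookup m ((j + 1) div 2) else 0)"
  by (simp add: odd_exps.rep_eq)

lemma lookup_half_exps: "Poly_Mapping.lookup (half_exps M) k = Poly_Mapping.lookup M (2 * k - 1)"
proof -
  have "inj (\<lambda>k::nat. 2 * k - 1)" by (intro injI) arith
  thus ?thesis by (simp add: half_exps_def map_key.rep_eq)
qed

lemma half_odd_exps: "Poly_Mapping.lookup m 0 = 0 \<Longrightarrow> half_exps (odd_exps m) = m"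
  by (rule poly_mapping_eqI) (auto simp: lookup_half_exps lookup_odd_exps)

lemma odd_half_exps: "Poly_Mapping.keys M \<subseteq> {n. odd n} \<Longrightarrow> odd_exps (half_exps M) = M"
proof (rule poly_mapping_eqI)
  fix j assume M: "Poly_Mapping.keys M \<subseteq> {n. odd n}"
  show "Poly_Mapping.lookup (odd_exps (half_exps M)) j = Poly_Mapping.lookup M j"
  proof (cases "odd j")
    case False
    hence "j \<notin> Poly_Mapping.keys M" using M by blast
    thus ?thesis using False by (simp add: lookup_odd_exps in_keys_iff)
  qed (auto simp: lookup_odd_exps lookup_half_exps elim!: oddE)
qed

lemma keys_odd_exps: "Poly_Mapping.keys (odd_exps m) \<subseteq> {n. odd n}"
  by (auto simp: in_keys_iff lookup_odd_exps split: if_splits)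

lemma odd_exps_add: "odd_exps (a + b) = odd_exps a + odd_exps b"
  by (rule poly_mapping_eqI) (simp add: lookup_odd_exps lookup_add)

lemma odd_exps_0 [simp]: "odd_exps 0 = 0"
  by (rule poly_mapping_eqI) (simp add: lookup_odd_exps)

lemma odd_exps_single: "k \<ge> 1 \<Longrightarrow> odd_exps (Poly_Mapping.single k 1) = Poly_Mapping.single (2 * k - 1) 1"
  by (rule poly_mapping_eqI) (auto simp: lookup_odd_exps lookup_single when_def elim!: oddE)

lemma odd_subst_monomial:
  fixes c :: "nat \<Rightarrow> complex"
  shows "(\<Prod>j\<in>Poly_Mapping.keys M. (if odd j then sconst (c j) * svar ((j + 1) div 2) else 0) ^ Poly_Mapping.lookup M j) =
    (if Poly_Mapping.keys M \<subseteq> {n. odd n} then sconst (monom_val M c) * smonom (half_exps M) else 0)"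
proof (cases "Poly_Mapping.keys M \<subseteq> {n. odd n}")
  case True
  have "(\<Prod>j\<in>Poly_Mapping.keys M. (if odd j then sconst (c j) * svar ((j + 1) div 2) else 0) ^ Poly_Mapping.lookup M j) =
      (\<Prod>j\<in>Poly_Mapping.keys M. sconst (c j ^ Poly_Mapping.lookup M j) *
        smonom (Poly_Mapping.single ((j + 1) div 2) (Poly_Mapping.lookup M j)))"
    using True by (intro prod.cong) (auto simp: power_mult_distrib sconst_power svar_power)
  also have "\<dots> = sconst (monom_val M c) *
      smonom (\<Sum>j\<in>Poly_Mapping.keys M. Poly_Mapping.single ((j + 1) div 2) (Poly_Mapping.lookup M j))"
    by (simp add: prod.distrib sconst_prod[symmetric] smonom_sum monom_val_def)
  also have "(\<Sum>j\<in>Poly_Mapping.keys M. Poly_Mapping.single ((j + 1) div 2) (Poly_Mapping.lookup M j)) = half_exps M"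
  proof (rule poly_mapping_eqI)
    fix k
    have "Poly_Mapping.lookup (\<Sum>j\<in>Poly_Mapping.keys M. Poly_Mapping.single ((j + 1) div 2) (Poly_Mapping.lookup M j)) k =
        (\<Sum>j\<in>Poly_Mapping.keys M. if j = 2 * k - 1 then Poly_Mapping.lookup M j else 0)"
      unfolding lookup_sum
    proof (rule sum.cong[OF refl])
      fix j assume "j \<in> Poly_Mapping.keys M"
      hence "odd j" using True by blast
      hence "(j + 1) div 2 = k \<longleftrightarrow> j = 2 * k - 1" by (auto elim!: oddE)
      thus "Poly_Mapping.lookup (Poly_Mapping.single ((j + 1) div 2) (Poly_Mapping.lookup M j)) k =
          (if j = 2 * k - 1 then Poly_Mapping.lookup M j else 0)"
        by (auto simp: lookup_single when_def)
    qed
    thus "Poly_Mapping.lookup (\<Sum>j\<in>Poly_Mapping.keys M. Poly_Mapping.single ((j + 1) div 2) (Poly_Mapping.lookup M j)) k =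
        Poly_Mapping.lookup (half_exps M) k"
      by (simp add: lookup_half_exps in_keys_iff)
  qed
  finally show ?thesis using True by simp
next
  case False
  then obtain j where "j \<in> Poly_Mapping.keys M" "even j" by auto
  hence "(if odd j then sconst (c j) * svar ((j + 1) div 2) else 0 :: complex pseries) ^ Poly_Mapping.lookup M j = 0"
    by (simp add: in_keys_iff)
  hence "(\<Prod>j\<in>Poly_Mapping.keys M. (if odd j then sconst (c j) * svar ((j + 1) div 2) else 0 :: complex pseries) ^ Poly_Mapping.lookup M j) = 0"
    using \<open>j \<in> Poly_Mapping.keys M\<close> by (intro prod_zero[OF finite_keys] bexI)
  thus ?thesis using False by simp
qed

text \<open>A monomial of the result comes from a single monomial in the odd variables, so the
  infinite sum in \<open>psubst\<close> has at most one nonzero term. Variable 0 never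
  arises.\<close>

lemma mcoeff_odd_subst:
  "mcoeff (odd_subst c F) m =
    (if Poly_Mapping.lookup m 0 = 0 then monom_val (odd_exps m) c * mcoeff F (odd_exps m) else 0)"
proof -
  let ?g = "\<lambda>M. mcoeff F M * mcoeff (if Poly_Mapping.keys M \<subseteq> {n. odd n}
      then sconst (monom_val M c) * smonom (half_exps M) else 0) m"
  have "mcoeff (odd_subst c F) m = Sum_any ?g"
    unfolding odd_subst_def psubst_def mcoeff_Abs_pseries odd_subst_monomial ..
  also have "\<dots> = (\<Sum>M\<in>{odd_exps m}. ?g M)"
  proof (rule Sum_any.expand_superset)
    show "{M. ?g M \<noteq> 0} \<subseteq> {odd_exps m}"
      by (auto simp: mcoeff_smonom odd_half_exps split: if_splits)
  qed simp
  also have "\<dots> = (if Poly_Mapping.lookup m 0 = 0 then monom_val (odd_exps m) c * mcoeff F (odd_exps m) else 0)"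
  proof (cases "Poly_Mapping.lookup m 0 = 0")
    case True
    thus ?thesis using keys_odd_exps[of m] by (simp add: mcoeff_smonom half_odd_exps)
  next
    case False
    have "Poly_Mapping.lookup (half_exps (odd_exps m)) 0 = 0" by (simp add: lookup_half_exps lookup_odd_exps)
    hence "m \<noteq> half_exps (odd_exps m)" using False by auto
    thus ?thesis using False by (simp add: mcoeff_smonom)
  qed
  finally show ?thesis .
qed

lemma odd_subst_add: "odd_subst c (F + G) = odd_subst c F + odd_subst c G"
  by (rule pseries_eqI) (simp add: mcoeff_odd_subst distrib_left)

lemma odd_subst_diff: "odd_subst c (F - G) = odd_subst c F - odd_subst c G"
  by (rule pseries_eqI) (simp add: mcoeff_odd_subst right_diff_distrib)

lemma odd_subst_0 [simp]: "odd_subst c 0 = 0"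
  by (rule pseries_eqI) (simp add: mcoeff_odd_subst)

lemma odd_subst_sum: "odd_subst c (sum f A) = (\<Sum>x\<in>A. odd_subst c (f x))"
  by (induction A rule: infinite_finite_induct) (simp_all add: odd_subst_add)

lemma odd_subst_sconst_mult: "odd_subst c (sconst a * F) = sconst a * odd_subst c F"
  by (rule pseries_eqI) (simp add: mcoeff_odd_subst)

lemma odd_subst_1 [simp]: "odd_subst c 1 = 1"
proof (rule pseries_eqI)
  fix m
  have "odd_exps m = 0 \<longleftrightarrow> m = 0" if "Poly_Mapping.lookup m 0 = 0"
    using half_odd_exps[OF that] half_odd_exps[of 0] by (metis lookup_zero odd_exps_0)
  thus "mcoeff (odd_subst c 1) m = mcoeff 1 m" by (auto simp: mcoeff_odd_subst mcoeff_1)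
qed

lemma odd_subst_mult: "odd_subst c (F * G) = odd_subst c F * odd_subst c G"
proof (rule pseries_eqI)
  fix m
  show "mcoeff (odd_subst c (F * G)) m = mcoeff (odd_subst c F * odd_subst c G) m"
  proof (cases "Poly_Mapping.lookup m 0 = 0")
    case True
    have "mcoeff (odd_subst c (F * G)) m =
        (\<Sum>(a, b) | a + b = odd_exps m. monom_val (odd_exps m) c * (mcoeff F a * mcoeff G b))"
      using True by (simp add: mcoeff_odd_subst mcoeff_mult sum_distrib_left case_prod_unfold)
    also have "\<dots> = (\<Sum>(a, b) | a + b = m. mcoeff (odd_subst c F) a * mcoeff (odd_subst c G) b)"
    proof (rule sum.reindex_bij_witness[where i = "\<lambda>(a, b). (odd_exps a, odd_exps b)"
          and j = "\<lambda>(a, b). (half_exps a, half_exps b)"])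
      fix p assume "p \<in> {(a, b). a + b = odd_exps m}"
      then obtain a b where p: "p = (a, b)" "a + b = odd_exps m" by auto
      have k: "Poly_Mapping.keys a \<subseteq> {n. odd n}" "Poly_Mapping.keys b \<subseteq> {n. odd n}"
        using keys_odd_exps[of m] p(2) by (metis keys_add_nat le_sup_iff)+
      note id = odd_half_exps[OF k(1)] odd_half_exps[OF k(2)]
      show "(case case p of (a, b) \<Rightarrow> (half_exps a, half_exps b) of (a, b) \<Rightarrow> (odd_exps a, odd_exps b)) = p"
        by (simp add: p id)
      have "half_exps a + half_exps b = half_exps (odd_exps m)"
        unfolding p(2)[symmetric] by (rule poly_mapping_eqI) (simp add: lookup_half_exps lookup_add)
      hence sum: "half_exps a + half_exps b = m" by (simp add: half_odd_exps True)
      thus "(case p of (a, b) \<Rightarrow> (half_exps a, half_exps b)) \<in> {(a, b). a + b = m}"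
        by (simp add: p)
      have "Poly_Mapping.lookup (half_exps a) 0 = 0" "Poly_Mapping.lookup (half_exps b) 0 = 0"
        using arg_cong[OF sum, of "\<lambda>m. Poly_Mapping.lookup m 0"] True by (auto simp: lookup_add)
      thus "(case case p of (a, b) \<Rightarrow> (half_exps a, half_exps b) of
            (a, b) \<Rightarrow> mcoeff (odd_subst c F) a * mcoeff (odd_subst c G) b) =
          (case p of (a, b) \<Rightarrow> monom_val (odd_exps m) c * (mcoeff F a * mcoeff G b))"
        by (simp add: p mcoeff_odd_subst id monom_val_add flip: p(2))
    next
      fix p assume "p \<in> {(a, b). a + b = m}"
      then obtain a b where p: "p = (a, b)" "a + b = m" by auto
      have z: "Poly_Mapping.lookup a 0 = 0" "Poly_Mapping.lookup b 0 = 0"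
        using p(2) True by (auto simp: lookup_add)
      show "(case case p of (a, b) \<Rightarrow> (odd_exps a, odd_exps b) of (a, b) \<Rightarrow> (half_exps a, half_exps b)) = p"
        by (simp add: p half_odd_exps z)
      show "(case p of (a, b) \<Rightarrow> (odd_exps a, odd_exps b)) \<in> {(a, b). a + b = odd_exps m}"
        by (simp add: p odd_exps_add flip: p(2))
    qed
    finally show ?thesis by (simp add: mcoeff_mult)
  next
    case False
    hence "mcoeff (odd_subst c F) a * mcoeff (odd_subst c G) b = 0" if "a + b = m" for a b
      using that by (auto simp: mcoeff_odd_subst lookup_add)
    hence "mcoeff (odd_subst c F * odd_subst c G) m = 0"
      unfolding mcoeff_mult by (intro sum.neutral) auto
    thus ?thesis using False by (simp add: mcoeff_odd_subst)
  qed
qed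

lemma odd_subst_prod_list: "odd_subst c (\<Prod>x\<leftarrow>xs. f x) = (\<Prod>x\<leftarrow>xs. odd_subst c (f x))"
  by (induction xs) (simp_all add: odd_subst_mult)

lemma pd_odd_subst:
  assumes "k \<ge> 1"
  shows "pd k (odd_subst c F) = sconst (c (2 * k - 1)) * odd_subst c (pd (2 * k - 1) F)"
proof (rule pseries_eqI)
  fix m
  have 1: "odd_exps (m + Poly_Mapping.single k 1) = odd_exps m + Poly_Mapping.single (2 * k - 1) 1"
    by (simp only: odd_exps_add odd_exps_single[OF assms])
  have 2: "Poly_Mapping.lookup (m + Poly_Mapping.single k 1) 0 = Poly_Mapping.lookup m 0"
    using assms by (simp add: lookup_add lookup_single)
  have 3: "Poly_Mapping.lookup (odd_exps m) (2 * k - 1) = Poly_Mapping.lookup m k"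
    using assms by (auto simp: lookup_odd_exps)
  have 4: "monom_val (Poly_Mapping.single (2 * k - 1) 1) c = c (2 * k - 1)"
    by (simp add: monom_val_def)
  show "mcoeff (pd k (odd_subst c F)) m = mcoeff (sconst (c (2 * k - 1)) * odd_subst c (pd (2 * k - 1) F)) m"
    unfolding mcoeff_sconst_mult mcoeff_pd mcoeff_odd_subst 1 2 3 monom_val_add 4 by simp
qed

text \<open>Injectivity on series in the odd variables, where nonzero scalings only rename and
  rescale coefficients.\<close>

lemma odd_subst_eq_0:
  assumes "series_in {n. odd n} F" "\<And>j. odd j \<Longrightarrow> c j \<noteq> 0" "odd_subst c F = 0"
  shows "F = 0"
proof (rule pseries_eqI)
  fix M
  show "mcoeff F M = mcoeff 0 M"
  proof (cases "Poly_Mapping.keys M \<subseteq> {n. odd n}")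
    case True
    have "0 \<notin> Poly_Mapping.keys M" using True by auto
    hence z: "Poly_Mapping.lookup (half_exps M) 0 = 0" by (simp add: lookup_half_exps in_keys_iff)
    have "monom_val M c \<noteq> 0" using True assms(2) by (auto simp: monom_val_def)
    moreover have "mcoeff (odd_subst c F) (half_exps M) = 0" using assms(3) by simp
    ultimately show ?thesis using z by (simp add: mcoeff_odd_subst odd_half_exps[OF True])
  next
    case False
    thus ?thesis using series_inD[OF assms(1)] by simp
  qed
qed

section \<open>The coefficients of the system of type B\<close>

lemma F_B_eq: "F_B N = odd_subst (\<lambda>_. 1) (F_A (2 * N - 1))"
proof -
  have "(\<lambda>j. if odd j then svar ((j + 1) div 2) else 0) =
      (\<lambda>j. if odd j then sconst 1 * svar ((j + 1) div 2) else 0 :: complex pseries)" by (simp add: fun_eq_iff)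
  thus ?thesis by (simp only: F_B_def odd_subst_def)
qed

text \<open>With n = 2 N - 1, differentiating in number N + 1 - \<gamma> of type B is
  differentiating in s_{2\<gamma>-1} of type A, because 2 (N + 1 - \<gamma>) - 1 = n + 1 - (2
  \<gamma> - 1). The quotient (m-1)!/m! leaves 1/m.\<close>

lemma R_B_eq:
  assumes "\<alpha> \<ge> 1" "\<beta> \<ge> 1" "gs \<in> pde_indices \<alpha> \<beta>"
  shows "R_B \<alpha> \<beta> gs = (- 1) ^ (length gs - 1) / of_nat (length gs) *
    bnth (\<Prod>\<gamma>\<leftarrow>gs. Eser (2 * \<gamma> - 1)) (2 * \<alpha> - 1) (2 * \<beta> - 1)"
proof -
  define N where "N = \<alpha> + \<beta> + 1"
  define n where "n = 2 * N - 1"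
  interpret flat n by standard (simp add: n_def N_def)
  have gs: "\<gamma> \<ge> 1 \<and> \<gamma> \<le> \<alpha> + \<beta> - 1" if "\<gamma> \<in> set gs" for \<gamma>
    using assms(3) that member_le_sum_list[OF that] by (auto simp: pde_indices_def)
  have pd1: "pd k (odd_subst (\<lambda>_. 1) G) = odd_subst (\<lambda>_. 1) (pd (2 * k - 1) G)" if "k \<ge> 1" for k G
    using pd_odd_subst[OF that, of "\<lambda>_. 1" G] by simp
  have fold: "foldr (\<lambda>\<gamma>. pd (N + 1 - \<gamma>)) hs (odd_subst (\<lambda>_. 1) G) =
      odd_subst (\<lambda>_. 1) (foldr (\<lambda>h. pd (n + 1 - h)) (map (\<lambda>\<gamma>. 2 * \<gamma> - 1) hs) G)"
    if "set hs \<subseteq> set gs" for hs G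
    using that
  proof (induction hs)
    case (Cons h hs)
    have "h \<ge> 1" "h \<le> \<alpha> + \<beta> - 1" using gs[of h] Cons.prems by auto
    hence "N + 1 - h \<ge> 1" "2 * (N + 1 - h) - 1 = n + 1 - (2 * h - 1)" by (auto simp: N_def n_def)
    thus ?case using Cons by (simp add: pd1)
  qed simp
  obtain g hs where ghs: "gs = g # hs" using assms(3) by (cases gs) (auto simp: pde_indices_def)
  have sub: "set (map (\<lambda>\<gamma>. 2 * \<gamma> - 1) gs) \<subseteq> {1..n}"
    using gs by (force simp: n_def N_def)
  have "R_B \<alpha> \<beta> gs = 1 / fact (length gs) * mcoeff (pd (2 * \<alpha> - 1) (pd (2 * \<beta> - 1)
      (foldr (\<lambda>h. pd (n + 1 - h)) (map (\<lambda>\<gamma>. 2 * \<gamma> - 1) gs) (F_A n)))) 0"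
    unfolding R_B_def Let_def N_def[symmetric] F_B_eq n_def[symmetric] fold[OF subset_refl] peval_at_0
    using assms(1,2) by (simp add: pd1 mcoeff_odd_subst)
  also have "\<dots> = 1 / fact (length gs) * ((- 1) ^ (length hs) * fact (length hs) *
      bnth (\<Prod>\<gamma>\<leftarrow>gs. Eser (2 * \<gamma> - 1)) (2 * \<alpha> - 1) (2 * \<beta> - 1))"
  proof -
    have 1: "2 * \<alpha> - 1 \<in> {1..n}" "2 * \<beta> - 1 \<in> {1..n}" "(2 * \<alpha> - 1) + (2 * \<beta> - 1) \<le> n + 1"
      using assms(1,2) by (auto simp: n_def N_def)
    have 2: "2 * g - 1 \<in> {1..n}" "set (map (\<lambda>\<gamma>. 2 * \<gamma> - 1) hs) \<subseteq> {1..n}"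
      using sub by (auto simp: ghs)
    show ?thesis
      using pd_foldr_F_A_at_0[OF 1 2] unfolding ghs list.map length_map map_map o_def by simp
  qed
  finally show ?thesis by (simp add: ghs)
qed

section \<open>Logarithm and exponential over the ring of series\<close>

text \<open>Characteristic zero lets derivatives determine a series up to its constant term and lets
  factors 2 be cancelled.\<close>

instance pseries :: ("{comm_ring_1, ring_char_0}") ring_char_0
proof
  show "inj (of_nat :: nat \<Rightarrow> 'a pseries)"
  proof (rule injI)
    fix x y :: nat assume "(of_nat x :: 'a pseries) = of_nat y"
    hence "mcoeff (of_nat x * 1 :: 'a pseries) 0 = mcoeff (of_nat y * 1) 0" by simp
    thus "x = y" unfolding mcoeff_of_nat_mult by (simp add: mcoeff_1)
  qed
qed

text \<open>Taylor coefficients of log(1 + X); at m = 0 division by zero gives the correct value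
  0.\<close>

definition log_coeff :: "nat \<Rightarrow> complex" where
  "log_coeff m = (- 1) ^ (m - 1) / of_nat m"

definition blog :: "complex pseries fps fps \<Rightarrow> complex pseries fps fps" where
  "blog G = Abs_fps (\<lambda>m. fps_const (sconst (log_coeff m))) oo (G - 1)"

lemma log_coeff_0 [simp]: "log_coeff 0 = 0"
  by (simp add: log_coeff_def)

lemma blog_nth_0: "fps_nth (blog G) 0 = 0"
  by (simp add: blog_def)

text \<open>The relation (1 + X) L'(X) = 1 for L = log(1 + X), composed with X = G - 1; composition
  respects products because G - 1 has no constant term.\<close>

lemma fps_deriv_blog:
  assumes "fps_nth G 0 = 1"
  shows "G * fps_deriv (blog G) = fps_deriv G"
proof -
  let ?L = "Abs_fps (\<lambda>m. fps_const (sconst (log_coeff m))) :: complex pseries fps fps"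
  let ?Y = "G - 1"
  have Y0: "fps_nth ?Y 0 = 0" using assms by simp
  define dL where "dL = fps_deriv ?L"
  have "(1 + fps_X) * dL = 1"
  proof (rule fps_ext)
    fix m
    have D: "fps_nth dL k = fps_const (sconst ((- 1) ^ k))" for k
    proof -
      have "of_nat (k + 1) * log_coeff (k + 1) = (- 1) ^ k"
        by (simp add: log_coeff_def del: of_nat_add of_nat_Suc)
      hence "fps_const (sconst (of_nat (k + 1))) * fps_const (sconst (log_coeff (k + 1))) =
          (fps_const (sconst ((- 1) ^ k)) :: complex pseries fps)"
        by (simp only: fps_const_mult sconst_mult[symmetric])
      thus ?thesis unfolding dL_def fps_deriv_nth sconst_of_nat fps_of_nat by simp
    qed
    have "fps_nth ((1 + fps_X) * dL) m = fps_nth dL m +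
        (if m = 0 then 0 else fps_nth dL (m - 1))"
      by (simp add: distrib_right)
    also have "\<dots> = fps_nth 1 m"
      by (cases m) (simp_all add: D sconst_uminus)
    finally show "fps_nth ((1 + fps_X) * dL) m = fps_nth 1 m" .
  qed
  hence "((1 + fps_X) * dL) oo ?Y = 1 oo ?Y" by simp
  hence "G * (dL oo ?Y) = 1"
    by (simp add: fps_compose_mult_distrib[OF Y0] fps_compose_add_distrib fps_X_fps_compose_startby0[OF Y0])
  moreover have "fps_deriv (blog G) = (dL oo ?Y) * fps_deriv G"
    unfolding blog_def dL_def by (simp add: fps_compose_deriv[OF Y0])
  ultimately show ?thesis by (simp add: mult.assoc[symmetric])
qed

lemma bexp_nth_0: "fps_nth (bexp G) 0 = 1"
  by (simp add: bexp_def)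

lemma fps_deriv_bexp:
  assumes "fps_nth G 0 = 0"
  shows "fps_deriv (bexp G) = bexp G * fps_deriv G"
proof -
  let ?E = "Abs_fps (\<lambda>n. fps_const (sconst (1 / fact n))) :: complex pseries fps fps"
  have "fps_deriv ?E = ?E"
  proof (rule fps_ext)
    fix n
    have "of_nat (n + 1) * (1 / fact (n + 1)) = (1 / fact n :: complex)"
      by (simp del: of_nat_Suc)
    hence "fps_const (sconst (of_nat (n + 1))) * fps_const (sconst (1 / fact (n + 1))) =
        (fps_const (sconst (1 / fact n)) :: complex pseries fps)"
      by (simp only: fps_const_mult sconst_mult[symmetric])
    thus "fps_nth (fps_deriv ?E) n = fps_nth ?E n"
      unfolding fps_deriv_nth sconst_of_nat fps_of_nat by simp
  qed
  thus ?thesis unfolding bexp_def by (simp add: fps_compose_deriv[OF assms])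
qed

text \<open>Both sides of $K_1 e^G = K_2$ have the same logarithmic derivative with respect to
  $z_1^{-1}$ precisely when \<open>G\<close> is the difference of the logarithms.\<close>

lemma mult_bexp_eq_iff:
  assumes "fps_nth K1 0 = 1" "fps_nth K2 0 = 1" "fps_nth G 0 = 0"
  shows "K1 * bexp G = K2 \<longleftrightarrow> G = blog K2 - blog K1"
proof
  note D = fps_deriv_blog[OF assms(1)] fps_deriv_blog[OF assms(2)]
  have nz: "K1 \<noteq> 0" "K2 \<noteq> 0" using assms by auto
  {
    assume eq: "K1 * bexp G = K2"
    have "fps_deriv K2 = K1 * (bexp G * fps_deriv G) + fps_deriv K1 * bexp G"
      unfolding eq[symmetric] by (simp add: fps_deriv_bexp[OF assms(3)])
    also have "\<dots> = K1 * bexp G * (fps_deriv G + fps_deriv (blog K1))"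
      unfolding D(1)[symmetric] by (simp add: algebra_simps)
    finally have "K2 * fps_deriv (blog K2) = K2 * (fps_deriv G + fps_deriv (blog K1))"
      unfolding eq D(2) .
    hence "fps_deriv G = fps_deriv (blog K2 - blog K1)" using nz by simp
    thus "G = blog K2 - blog K1"
      unfolding fps_deriv_eq_iff by (simp add: blog_nth_0 assms(3))
  }
  assume G: "G = blog K2 - blog K1"
  let ?P = "K1 * bexp G"
  have dP: "fps_deriv ?P = ?P * fps_deriv (blog K2)"
  proof -
    have "fps_deriv ?P = K1 * (bexp G * fps_deriv G) + (K1 * fps_deriv (blog K1)) * bexp G"
      by (simp add: fps_deriv_bexp[OF assms(3)] D(1))
    thus ?thesis by (simp add: G algebra_simps)
  qed
  \<comment> \<open>Uniqueness for the equation P' = P (log K2)': dividing P by its solution K2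
    gives derivative 0 and constant term 1.\<close>
  define V where "V = fps_right_inverse K2 1"
  have V: "K2 * V = 1" unfolding V_def by (rule fps_right_inverse) (simp add: assms(2))
  hence "fps_deriv (K2 * V) = 0" by simp
  hence "K2 * fps_deriv V + fps_deriv K2 * V = 0" unfolding fps_deriv_mult .
  hence "K2 * (fps_deriv V + fps_deriv (blog K2) * V) = 0"
    by (simp add: D(2)[symmetric] algebra_simps)
  hence "fps_deriv V = - (fps_deriv (blog K2) * V)" using nz by (simp add: eq_neg_iff_add_eq_0)
  hence "fps_deriv (?P * V) = 0"
    unfolding fps_deriv_mult[of ?P V] dP by (simp add: algebra_simps)
  moreover have "fps_nth (?P * V) 0 = 1"
    using arg_cong[OF V, of "\<lambda>f. fps_nth f 0"] assms bexp_nth_0[of G] by simp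
  ultimately have PV: "?P * V = 1" by (metis fps_deriv_eq_0_iff fps_const_1_eq_1)
  have "?P = ?P * (K2 * V)" by (simp only: V mult_1_right)
  also have "\<dots> = K2 * (?P * V)" by (simp only: mult_ac)
  also have "\<dots> = K2" by (simp only: PV mult_1_right)
  finally show "?P = K2" .
qed

section \<open>The dispersionless BKP hierarchy in components\<close>

definition qs :: "complex pseries \<Rightarrow> nat \<Rightarrow> complex pseries" where
  "qs F i = pd 1 (2 * DB i F)"

lemma qs_even: "even i \<Longrightarrow> qs F i = 0"
  by (simp add: qs_def DB_def)

text \<open>The substitution z_2 -> -z_2.\<close>

definition twist :: "'a::comm_ring_1 fps fps \<Rightarrow> 'a fps fps" where
  "twist G = bps (\<lambda>i j. (- 1) ^ j * bnth G i j)"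

lemma bnth_twist [simp]: "bnth (twist G) i j = (- 1) ^ j * bnth G i j"
  by (simp add: twist_def)

lemma twist_mult: "twist (F * G) = twist F * twist G"
proof (rule bps_eqI)
  fix i j
  have "(- 1) ^ j * bnth F a b * bnth G (i - a) (j - b) =
      ((- 1) ^ b * bnth F a b) * ((- 1) ^ (j - b) * bnth G (i - a) (j - b))" if "b \<in> {0..j}" for a b
  proof -
    have "(- 1 :: 'a) ^ j = (- 1) ^ b * (- 1) ^ (j - b)" using that by (simp add: power_add[symmetric])
    thus ?thesis by (simp add: mult_ac)
  qed
  thus "bnth (twist (F * G)) i j = bnth (twist F * twist G) i j"
    by (simp add: bnth_mult sum_distrib_left mult.assoc)
qed

lemma twist_1 [simp]: "twist 1 = 1"
  by (rule bps_eqI) (simp add: bnth_1)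

lemma twist_power: "twist (F ^ m) = twist F ^ m"
  by (induction m) (simp_all add: twist_mult)

lemma twist_diff: "twist (F - G) = twist F - twist G"
  by (rule bps_eqI) (simp add: right_diff_distrib)

lemma bnth_blog: "bnth (blog G) i j = (\<Sum>m=0..i. sconst (log_coeff m) * bnth ((G - 1) ^ m) i j)"
  by (simp add: blog_def fps_compose_nth fps_sum_nth)

lemma blog_twist: "blog (twist G) = twist (blog G)"
proof (rule bps_eqI)
  fix i j
  have "(twist G - 1) ^ m = twist ((G - 1) ^ m)" for m
    by (simp add: twist_power twist_diff)
  thus "bnth (blog (twist G)) i j = bnth (twist (blog G)) i j"
    by (simp add: bnth_blog sum_distrib_left mult.left_commute)
qed

lemma dBKP_iff_Kser: "dBKP F \<longleftrightarrow> twist (Kser (qs F)) * bexp (2 * 2 * DB12 F) = Kser (qs F)"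
proof -
  let ?a = "qs F"
  have num: "bnth (2 * G) i j = 2 * bnth G i j" for G :: "complex pseries fps fps" and i j
    by (simp only: mult_2 fps_add_nth)
  have plus: "bnth (pd_coeffs 1 (2 * DB1 F + 2 * DB2 F)) i j =
      (if j = 0 then ?a i else 0) + (if i = 0 then ?a j else 0)" for i j
    by (simp add: num DB1_def DB2_def qs_def pd_add)
  have minus: "bnth (pd_coeffs 1 (2 * DB1 F - 2 * DB2 F)) i j =
      (if j = 0 then ?a i else 0) - (if i = 0 then ?a j else 0)" for i j
    by (simp add: num DB1_def DB2_def qs_def pd_diff)
  \<comment> \<open>Dividing by the sum of the inverse variables telescopes along each antidiagonal
    with alternating signs; the end at i = 0 has the right sign because only odd-indexed
    coefficients survive.\<close>
  define q where "q = bps (\<lambda>i j. (- 1) ^ j * ?a (i + j + 1))"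
  have "bnth (q * (z1_inv + z2_inv)) i j = (if j = 0 then ?a i else 0) + (if i = 0 then ?a j else 0)" for i j
    by (cases i; cases j; cases "even j")
       (simp_all add: ring_distribs nth_mult_z1_inv nth_mult_z2_inv q_def qs_even del: fps_mult_nth_0)
  hence q: "q * (z1_inv + z2_inv) = pd_coeffs 1 (2 * DB1 F + 2 * DB2 F)"
    by (intro bps_eqI) (simp only: plus)
  define r where "r = bps (\<lambda>i j. - ?a (i + j + 1))"
  have "bnth (r * (z2_inv - z1_inv)) i j = (if j = 0 then ?a i else 0) - (if i = 0 then ?a j else 0)" for i j
    by (cases i; cases j)
       (simp_all add: right_diff_distrib nth_mult_z1_inv nth_mult_z2_inv r_def qs_even del: fps_mult_nth_0)
  hence r: "r * (z2_inv - z1_inv) = pd_coeffs 1 (2 * DB1 F - 2 * DB2 F)"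
    by (intro bps_eqI) (simp only: minus)
  have shift: "bnth (1 - z1_inv * z2_inv * G) i j =
      (if i = 0 \<and> j = 0 then 1 else 0) - (if i = 0 \<or> j = 0 then 0 else bnth G (i - 1) (j - 1))" for G i j
  proof -
    have "z1_inv * z2_inv * G = (G * z2_inv) * z1_inv" by (simp only: mult_ac)
    thus ?thesis by (simp only: fps_sub_nth nth_mult_z1_inv nth_mult_z2_inv bnth_1) auto
  qed
  have "exact_quot (z1_inv * z2_inv * pd_coeffs 1 (2 * DB1 F + 2 * DB2 F)) (z1_inv + z2_inv) = z1_inv * z2_inv * q"
    by (rule exact_quot_eqI) (simp, simp only: mult.assoc q)
  moreover have "1 - z1_inv * z2_inv * q = twist (Kser ?a)"
  proof (rule bps_eqI)
    fix i j show "bnth (1 - z1_inv * z2_inv * q) i j = bnth (twist (Kser ?a)) i j"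
      unfolding shift by (cases i; cases j) (simp_all add: q_def bnth_Kser)
  qed
  moreover have "exact_quot (z1_inv * z2_inv * pd_coeffs 1 (2 * DB1 F - 2 * DB2 F)) (z2_inv - z1_inv) = z1_inv * z2_inv * r"
    by (rule exact_quot_eqI) (simp, simp only: mult.assoc r)
  moreover have "1 - z1_inv * z2_inv * r = Kser ?a"
  proof (rule bps_eqI)
    fix i j show "bnth (1 - z1_inv * z2_inv * r) i j = bnth (Kser ?a) i j"
      unfolding shift by (cases i; cases j) (simp_all add: r_def bnth_Kser)
  qed
  ultimately show ?thesis unfolding dBKP_def by simp
qed

text \<open>With s supported on odd indices, K is invariant under changing both signs, (z_1, z_2) ->
  (-z_1, -z_2).\<close>

lemma bnth_power_Kser_odd:
  assumes "\<And>k. even k \<Longrightarrow> s k = 0" "odd (i + j)"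
  shows "bnth ((Kser s - 1) ^ m) i j = 0"
  using assms(2)
proof (induction m arbitrary: i j)
  case 0
  thus ?case by (auto simp: bnth_1)
next
  case (Suc m)
  have "bnth (Kser s - 1) a b * bnth ((Kser s - 1) ^ m) (i - a) (j - b) = 0"
    if ab: "a \<in> {0..i}" "b \<in> {0..j}" for a b
  proof (cases "odd (a + b)")
    case True
    thus ?thesis using assms(1)[of "a + b - 1"] by (auto simp: bnth_Kser bnth_1)
  next
    case False
    have "i + j = (a + b) + ((i - a) + (j - b))" using ab by auto
    hence "odd ((i - a) + (j - b))" using False Suc.prems by (metis even_add)
    thus ?thesis using Suc.IH by simp
  qed
  thus ?case unfolding power_Suc bnth_mult by (intro sum.neutral ballI) blast
qed

text \<open>In log K - twist(log K) the coefficients with even j cancel, those with odd j double,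
  and parity removes the mixed ones; so 4 against 2 remains at odd-odd positions.\<close>

lemma dBKP_iff:
  "dBKP F \<longleftrightarrow> (\<forall>\<alpha>\<ge>1. \<forall>\<beta>\<ge>1. 2 * DB (2 * \<alpha> - 1) (DB (2 * \<beta> - 1) F) = bnth (blog (Kser (qs F))) (2 * \<alpha> - 1) (2 * \<beta> - 1))"
proof -
  let ?L = "blog (Kser (qs F))" and ?D = "\<lambda>i j. DB i (DB j F)"
  have K: "fps_nth (Kser (qs F)) 0 = 1" "fps_nth (twist (Kser (qs F))) 0 = 1"
    by (rule fps_ext, auto simp: bnth_Kser fps_one_nth)+
  have four: "bnth (2 * 2 * DB12 F) i j = 4 * ?D i j" for i j
  proof -
    have "2 * 2 * DB12 F = DB12 F + DB12 F + DB12 F + DB12 F" by simp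
    hence "bnth (2 * 2 * DB12 F) i j = ?D i j + ?D i j + ?D i j + ?D i j"
      by (simp only: fps_add_nth DB12_def bnth_bps)
    thus ?thesis by simp
  qed
  have D0: "?D i j = 0" if "even i \<or> even j" for i j
    using that by (auto simp: DB_def)
  have "bnth (2 * 2 * DB12 F) 0 j = 0" for j
    unfolding four using D0[of 0 j] by simp
  hence "fps_nth (2 * 2 * DB12 F) 0 = 0"
    by (intro fps_ext) (simp only: fps_zero_nth)
  hence "dBKP F \<longleftrightarrow> 2 * 2 * DB12 F = ?L - twist ?L"
    by (simp only: dBKP_iff_Kser mult_bexp_eq_iff[OF K(2) K(1)] blog_twist)
  also have "\<dots> \<longleftrightarrow> (\<forall>i j. 4 * ?D i j = bnth ?L i j - (- 1) ^ j * bnth ?L i j)"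
    unfolding four[symmetric] by (auto intro!: bps_eqI)
  also have "\<dots> \<longleftrightarrow> (\<forall>i j. odd i \<longrightarrow> odd j \<longrightarrow> 2 * ?D i j = bnth ?L i j)"
  proof -
    have L0: "bnth ?L i j = 0" if "even i" "odd j" for i j
      using that bnth_power_Kser_odd[of "qs F" i j] qs_even by (simp add: bnth_blog)
    have two: "4 * x = y + y \<longleftrightarrow> 2 * x = y" for x y :: "complex pseries"
    proof -
      have "4 * x = y + y \<longleftrightarrow> 2 * (2 * x) = 2 * y" by (simp only: mult_2 distrib_left[symmetric]) (simp add: mult.assoc[symmetric])
      thus ?thesis by simp
    qed
    have "4 * ?D i j = bnth ?L i j - (- 1) ^ j * bnth ?L i j \<longleftrightarrow>
        (odd i \<longrightarrow> odd j \<longrightarrow> 2 * ?D i j = bnth ?L i j)" for i j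
    proof (cases "odd i \<and> odd j")
      case True
      thus ?thesis using two[of "?D i j" "bnth ?L i j"] by simp
    next
      case False
      thus ?thesis using D0[of i j] L0[of i j] by (cases "odd j") simp_all
    qed
    thus ?thesis by (simp only:)
  qed
  also have "\<dots> \<longleftrightarrow> (\<forall>\<alpha>\<ge>1. \<forall>\<beta>\<ge>1. 2 * ?D (2 * \<alpha> - 1) (2 * \<beta> - 1) = bnth ?L (2 * \<alpha> - 1) (2 * \<beta> - 1))"
  proof safe
    fix i j :: nat
    assume h: "\<forall>\<alpha>\<ge>1. \<forall>\<beta>\<ge>1. 2 * ?D (2 * \<alpha> - 1) (2 * \<beta> - 1) = bnth ?L (2 * \<alpha> - 1) (2 * \<beta> - 1)" and "odd i" "odd j"
    then obtain a b where "i = 2 * a + 1" "j = 2 * b + 1" by (elim oddE)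
    thus "2 * ?D i j = bnth ?L i j" using h[rule_format, of "a + 1" "b + 1"] by simp
  qed auto
  finally show ?thesis .
qed

lemma power_sum_lists:
  fixes f :: "'b \<Rightarrow> 'a::comm_ring_1"
  assumes "finite A"
  shows "(\<Sum>x\<in>A. f x) ^ m = (\<Sum>xs | set xs \<subseteq> A \<and> length xs = m. \<Prod>x\<leftarrow>xs. f x)"
proof (induction m)
  case 0
  have "{xs. set xs \<subseteq> A \<and> length xs = 0} = {[]}" by auto
  thus ?case by simp
next
  case (Suc m)
  have "(\<Sum>xs | set xs \<subseteq> A \<and> length xs = Suc m. \<Prod>x\<leftarrow>xs. f x) =
      (\<Sum>(x, xs)\<in>A \<times> {xs. set xs \<subseteq> A \<and> length xs = m}. f x * (\<Prod>x\<leftarrow>xs. f x))"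
    by (rule sum.reindex_bij_witness[where i = "\<lambda>(x, xs). x # xs" and j = "\<lambda>xs. (hd xs, tl xs)"])
       (auto simp: length_Suc_conv)
  thus ?case by (simp add: Suc sum_product sum.cartesian_product)
qed

text \<open>Expand the powers of K - 1 into ordered products of factors E_{2\<gamma>-1}. Each has
  degree 2 \<gamma>, so the position 2 \<alpha> - 1, 2 \<beta> - 1 forces the sum of the \<gamma> to
  be \<alpha> + \<beta> - 1, and the numbers are those of \<open>R_B_eq\<close>.\<close>

lemma bnth_blog_Kser:
  assumes s: "\<And>k. even k \<Longrightarrow> s k = 0" and "\<alpha> \<ge> 1" "\<beta> \<ge> 1"
  shows "bnth (blog (Kser s)) (2 * \<alpha> - 1) (2 * \<beta> - 1) =
    (\<Sum>gs\<in>pde_indices \<alpha> \<beta>. sconst (R_B \<alpha> \<beta> gs) * (\<Prod>\<gamma>\<leftarrow>gs. s (2 * \<gamma> - 1)))"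
proof -
  define i j D where "i = 2 * \<alpha> - 1" and "j = 2 * \<beta> - 1" and "D = \<alpha> + \<beta> - 1"
  have ij: "i + j = 2 * D" using assms by (auto simp: i_def j_def D_def)
  let ?c = "\<lambda>x. fps_const (fps_const x) :: complex pseries fps fps"
  let ?Y = "Kser s - 1"
  \<comment> \<open>K - 1 cut off above degree 2 D; the vanishing of s at even indices leaves only
    the terms 2 \<gamma> - 1.\<close>
  define YD where "YD = (\<Sum>\<gamma>=1..D. ?c (s (2 * \<gamma> - 1)) * Eser (2 * \<gamma> - 1))"
  have "deg_cong (2 * D) ?Y YD"
    unfolding deg_cong_def
  proof (intro allI impI)
    fix a b assume ab: "a + b \<le> 2 * D"
    have sum: "bnth YD a b = (\<Sum>\<gamma>=1..D. s (2 * \<gamma> - 1) * bnth (Eser (2 * \<gamma> - 1)) a b)"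
      by (simp add: YD_def fps_sum_nth)
    show "bnth ?Y a b = bnth YD a b"
    proof (cases "a \<ge> 1 \<and> b \<ge> 1")
      case False
      thus ?thesis unfolding sum by (auto simp: bnth_Kser bnth_1 bnth_Eser)
    next
      case True
      have "bnth YD a b = (\<Sum>\<gamma>=1..D. if 2 * \<gamma> = a + b then s (a + b - 1) else 0)"
        unfolding sum using True by (intro sum.cong) (auto simp: bnth_Eser)
      also have "\<dots> = s (a + b - 1)"
      proof (cases "even (a + b)")
        case even: True
        then obtain g where g: "a + b = 2 * g" by (elim evenE)
        hence "(\<Sum>\<gamma>=1..D. if 2 * \<gamma> = a + b then s (a + b - 1) else 0) = (\<Sum>\<gamma>=1..D. if \<gamma> = g then s (a + b - 1) else 0)"
          by (intro sum.cong) auto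
        thus ?thesis using g True ab by simp
      next
        case False
        hence "s (a + b - 1) = 0" using True by (intro s) auto
        moreover from this have "(\<Sum>\<gamma>=1..D. if 2 * \<gamma> = a + b then s (a + b - 1) else 0) = 0"
          by (intro sum.neutral) auto
        ultimately show ?thesis by simp
      qed
      finally show ?thesis using True by (simp add: bnth_Kser bnth_1)
    qed
  qed
  hence "deg_cong (2 * D) (?Y ^ m) (YD ^ m)" for m by (rule deg_cong_power)
  hence Ym: "bnth (?Y ^ m) i j = bnth (YD ^ m) i j" for m unfolding deg_cong_def ij[symmetric] by simp
  have prod: "(\<Prod>\<gamma>\<leftarrow>gs. ?c (s (2 * \<gamma> - 1)) * Eser (2 * \<gamma> - 1)) =
      ?c (\<Prod>\<gamma>\<leftarrow>gs. s (2 * \<gamma> - 1)) * (\<Prod>\<gamma>\<leftarrow>gs. Eser (2 * \<gamma> - 1))" for gs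
  proof (induction gs)
    case (Cons g gs)
    have "?c (x * y) = ?c x * ?c y" for x y by simp
    thus ?case using Cons by (simp only: list.map prod_list.Cons mult_ac)
  qed simp
  define e where "e gs = bnth (\<Prod>\<gamma>\<leftarrow>gs. Eser (2 * \<gamma> - 1) :: complex fps fps) i j" for gs
  \<comment> \<open>\<open>R_B\<close> is a complex number whereas K has series coefficients;
    embedding the constants transfers the numbers.\<close>
  have e: "bnth (\<Prod>\<gamma>\<leftarrow>gs. Eser (2 * \<gamma> - 1) :: complex pseries fps fps) i j = sconst (e gs)" for gs
  proof -
    have "bmap sconst (\<Prod>g\<leftarrow>map (\<lambda>\<gamma>. 2 * \<gamma> - 1) gs. Eser g :: complex fps fps) =
        (\<Prod>g\<leftarrow>map (\<lambda>\<gamma>. 2 * \<gamma> - 1) gs. Eser g :: complex pseries fps fps)"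
      by (rule bmap_prod_Eser) (simp_all add: sconst_add sconst_mult)
    from arg_cong[OF this, of "\<lambda>G. bnth G i j"] show ?thesis by (simp add: e_def o_def)
  qed
  have pow: "bnth (?Y ^ m) i j = (\<Sum>gs | set gs \<subseteq> {1..D} \<and> length gs = m. (\<Prod>\<gamma>\<leftarrow>gs. s (2 * \<gamma> - 1)) * sconst (e gs))" for m
    unfolding Ym YD_def power_sum_lists[OF finite_atLeastAtMost] fps_sum_nth prod
    by (simp add: e[unfolded One_nat_def])
  have fin: "finite {gs. set gs \<subseteq> {1..D} \<and> length gs = m}" for m
    by (rule finite_lists_length_eq) simp
  let ?A = "\<lambda>m. {gs. set gs \<subseteq> {1..D} \<and> length gs = m}"
  let ?t = "\<lambda>gs. sconst (log_coeff (length gs) * e gs) * (\<Prod>\<gamma>\<leftarrow>gs. s (2 * \<gamma> - 1))"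
  have Y0: "fps_nth ?Y 0 = 0" by (simp add: fps_nth_Kser_0)
  have "bnth (blog (Kser s)) i j = (\<Sum>m=0..i. sconst (log_coeff m) * bnth (?Y ^ m) i j)"
    by (rule bnth_blog)
  \<comment> \<open>Powers above i have no term of order i in the first variable, so the range may
    grow to 2 D, which covers every list in \<open>pde_indices\<close>.\<close>
  also have "\<dots> = (\<Sum>m=0..2 * D. sconst (log_coeff m) * bnth (?Y ^ m) i j)"
  proof (rule sum.mono_neutral_left)
    show "\<forall>m\<in>{0..2 * D} - {0..i}. sconst (log_coeff m) * bnth (?Y ^ m) i j = 0"
    proof
      fix m assume "m \<in> {0..2 * D} - {0..i}"
      hence "fps_nth (?Y ^ m) i = 0" using startsby_zero_power_prefix[OF Y0] by auto
      thus "sconst (log_coeff m) * bnth (?Y ^ m) i j = 0" by simp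
    qed
  qed (use ij in auto)
  also have "\<dots> = (\<Sum>m=0..2 * D. \<Sum>gs\<in>?A m. ?t gs)"
    by (intro sum.cong refl) (simp add: pow sum_distrib_left sconst_mult mult_ac)
  also have "\<dots> = (\<Sum>gs\<in>(\<Union>m\<in>{0..2 * D}. ?A m). ?t gs)"
    by (rule sum.UNION_disjoint[symmetric]) (use fin in auto)
  also have "\<dots> = (\<Sum>gs\<in>pde_indices \<alpha> \<beta>. ?t gs)"
  proof (rule sum.mono_neutral_right)
    show "finite (\<Union>m\<in>{0..2 * D}. ?A m)" using fin by blast
    show "pde_indices \<alpha> \<beta> \<subseteq> (\<Union>m\<in>{0..2 * D}. ?A m)"
    proof
      fix gs assume gs: "gs \<in> pde_indices \<alpha> \<beta>"
      have "length xs \<le> sum_list xs" if "\<forall>\<gamma>\<in>set xs. \<gamma> \<ge> 1" for xs :: "nat list"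
        using that by (induction xs) auto
      from this[of gs] have "length gs \<le> D" using gs by (simp add: pde_indices_def D_def)
      moreover have "set gs \<subseteq> {1..D}"
        using gs member_le_sum_list[of _ gs] by (auto simp: pde_indices_def D_def)
      ultimately show "gs \<in> (\<Union>m\<in>{0..2 * D}. ?A m)" by auto
    qed
    show "\<forall>gs\<in>(\<Union>m\<in>{0..2 * D}. ?A m) - pde_indices \<alpha> \<beta>. ?t gs = 0"
    proof
      fix gs assume gs: "gs \<in> (\<Union>m\<in>{0..2 * D}. ?A m) - pde_indices \<alpha> \<beta>"
      have pos: "\<forall>\<gamma>\<in>set gs. \<gamma> \<ge> 1" using gs by auto
      show "?t gs = 0"
      \<comment> \<open>The empty list is killed by \<open>log_coeff 0 = 0\<close>, every other
        excluded list by its total degree.\<close>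
      proof (cases "gs = []")
        case False
        hence "sum_list gs \<noteq> D" using gs pos by (auto simp: pde_indices_def D_def Suc_le_eq)
        moreover have "(\<Sum>g\<leftarrow>map (\<lambda>\<gamma>. 2 * \<gamma> - 1) gs. g + 1) = 2 * sum_list gs"
          using pos by (induction gs) auto
        ultimately have "e gs = 0"
          using bnth_prod_Eser_nonzero[of "map (\<lambda>\<gamma>. 2 * \<gamma> - 1) gs" i j, where ?'a = complex] ij
          by (auto simp: e_def o_def)
        thus ?thesis by simp
      qed simp
    qed
  qed
  also have "\<dots> = (\<Sum>gs\<in>pde_indices \<alpha> \<beta>. sconst (R_B \<alpha> \<beta> gs) * (\<Prod>\<gamma>\<leftarrow>gs. s (2 * \<gamma> - 1)))"
    by (intro sum.cong refl) (simp add: R_B_eq[OF assms(2,3)] log_coeff_def e_def i_def j_def)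
  finally show ?thesis by (simp add: i_def j_def)
qed

lemma DB_mult_2: "DB i (2 * F) = 2 * DB i F"
  unfolding DB_def mult_2 pd_add distrib_left by (cases "odd i") auto

theorem theorem6p3:
  fixes F0 :: "complex pseries"
  assumes "series_in {n. odd n} F0"
  shows "B_system (2 * odd_time_change F0) \<longleftrightarrow> dBKP F0"
proof -
  define S where "S = odd_subst (\<lambda>j. 1 / of_nat j)"
  have S: "odd_time_change = S"
    by (simp add: fun_eq_iff odd_time_change_def S_def odd_subst_def)
  have S_2: "S (2 * G) = 2 * S G" for G
    unfolding mult_2 S_def by (rule odd_subst_add)
  \<comment> \<open>The chain rule factor 1/(2 k - 1) is exactly the one in \<open>DB\<close>, so no
    constants are left over.\<close>
  have pd_S: "pd k (S G) = S (DB (2 * k - 1) G)" if "k \<ge> 1" for k G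
    using that unfolding S_def pd_odd_subst[OF that] by (simp add: DB_def odd_subst_sconst_mult)
  have DB1: "DB (2 * 1 - 1) G = pd 1 G" for G by (simp add: DB_def)
  have pd1_2: "pd 1 (2 * G) = 2 * pd 1 G" for G :: "complex pseries"
    unfolding mult_2 by (rule pd_add)
  let ?L = "\<lambda>\<alpha> \<beta>. \<Sum>gs\<in>pde_indices \<alpha> \<beta>. sconst (R_B \<alpha> \<beta> gs) * (\<Prod>\<gamma>\<leftarrow>gs. qs F0 (2 * \<gamma> - 1))"
  have eq: "pd \<alpha> (pd \<beta> (2 * S F0)) =
      (\<Sum>gs\<in>pde_indices \<alpha> \<beta>. sconst (R_B \<alpha> \<beta> gs) * (\<Prod>\<gamma>\<leftarrow>gs. pd 1 (pd \<gamma> (2 * S F0))))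
    \<longleftrightarrow> 2 * DB (2 * \<alpha> - 1) (DB (2 * \<beta> - 1) F0) = ?L \<alpha> \<beta>" if ab: "\<alpha> \<ge> 1" "\<beta> \<ge> 1" for \<alpha> \<beta>
  proof -
    have l: "pd \<alpha> (pd \<beta> (2 * S F0)) = S (2 * DB (2 * \<alpha> - 1) (DB (2 * \<beta> - 1) F0))"
      unfolding S_2[symmetric] pd_S[OF ab(2)] pd_S[OF ab(1)] DB_mult_2 ..
    have "pd 1 (pd \<gamma> (2 * S F0)) = S (qs F0 (2 * \<gamma> - 1))" if "\<gamma> \<ge> 1" for \<gamma>
      unfolding S_2[symmetric] pd_S[OF that] pd_S[OF order_refl] DB_mult_2 qs_def DB1 pd1_2 ..
    hence "(\<Prod>\<gamma>\<leftarrow>gs. pd 1 (pd \<gamma> (2 * S F0))) = S (\<Prod>\<gamma>\<leftarrow>gs. qs F0 (2 * \<gamma> - 1))"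
      if "gs \<in> pde_indices \<alpha> \<beta>" for gs
      unfolding S_def odd_subst_prod_list
      by (intro arg_cong[of _ _ prod_list] map_cong refl) (use that in \<open>auto simp: pde_indices_def\<close>)
    hence r: "(\<Sum>gs\<in>pde_indices \<alpha> \<beta>. sconst (R_B \<alpha> \<beta> gs) * (\<Prod>\<gamma>\<leftarrow>gs. pd 1 (pd \<gamma> (2 * S F0)))) = S (?L \<alpha> \<beta>)"
      by (simp add: S_def odd_subst_sum odd_subst_sconst_mult)
    have in_DB: "series_in {n. odd n} (DB i G)" if "series_in {n. odd n} G" for i G
    proof -
      have "series_in {n. odd n} (0 :: complex pseries)" using series_in_sconst[of _ 0] by simp
      thus ?thesis using that by (simp add: DB_def series_in_mult series_in_sconst series_in_pd)
    qed
    have in_2: "series_in {n. odd n} (2 * G)" if "series_in {n. odd n} G" for G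
      unfolding mult_2 by (rule series_in_add[OF that that])
    have in_qs: "series_in {n. odd n} (qs F0 i)" for i
      unfolding qs_def by (intro series_in_pd in_2 in_DB assms)
    have in_prod: "series_in {n. odd n} (\<Prod>\<gamma>\<leftarrow>gs. qs F0 (2 * \<gamma> - 1))" for gs
    proof (induction gs)
      case Nil
      show ?case using series_in_sconst[of _ 1] by simp
    qed (simp add: series_in_mult in_qs)
    have "series_in {n. odd n} (\<Sum>gs\<in>A. sconst (R_B \<alpha> \<beta> gs) * (\<Prod>\<gamma>\<leftarrow>gs. qs F0 (2 * \<gamma> - 1)))" for A
    proof (induction A rule: infinite_finite_induct)
      case (insert x F)
      show ?case unfolding sum.insert[OF insert(1,2)]
        by (intro series_in_add series_in_mult in_prod series_in_sconst insert)
    qed (use series_in_sconst[of _ 0] in simp_all)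
    hence "series_in {n. odd n} (2 * DB (2 * \<alpha> - 1) (DB (2 * \<beta> - 1) F0) + - ?L \<alpha> \<beta>)"
      by (intro series_in_add series_in_uminus in_2 in_DB assms)
    \<comment> \<open>Injectivity of \<open>S\<close> on series in the odd times brings the PDE
      system back to an identity for \<open>F0\<close>.\<close>
    hence "S (2 * DB (2 * \<alpha> - 1) (DB (2 * \<beta> - 1) F0) - ?L \<alpha> \<beta>) = 0 \<longleftrightarrow>
        2 * DB (2 * \<alpha> - 1) (DB (2 * \<beta> - 1) F0) - ?L \<alpha> \<beta> = 0"
      using odd_subst_eq_0[of "2 * DB (2 * \<alpha> - 1) (DB (2 * \<beta> - 1) F0) - ?L \<alpha> \<beta>" "\<lambda>j. 1 / of_nat j"]
      by (auto simp: S_def odd_pos)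
    thus ?thesis unfolding l r by (simp add: S_def odd_subst_diff)
  qed
  show ?thesis
    unfolding B_system_def dBKP_iff S using eq bnth_blog_Kser[of "qs F0", OF qs_even] by simp
qed

end
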